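(* Let $\mathcal{C}$ be a finite tensor category, let $\mathcal{M}$ be a finite left $\mathcal{C}$-module category with action functor $\rho_{\mathcal{M}}$, and let $\mathcal{C}_{\mathcal{M}}^*=\mathrm{Rex}_{\mathcal{C}}(\mathcal{M})^{\mathrm{rev}}$. Let $\mathsf{U}:\mathcal{Z}(\mathcal{C}_{\mathcal{M}}^* )\to\mathcal{C}_{\mathcal{M}}^*$ be the forgetful functor and let $\theta_{\mathcal{M}}:\mathcal{Z}(\mathcal{C})\to\mathcal{Z}(\mathcal{C}_{\mathcal{M}}^* )$ be Schauenburg's functor. Then $$\big(\mathsf{U}\circ\theta_{\mathcal{M}}:\mathcal{Z}(\mathcal{C})\to\mathcal{C}_{\mathcal{M}}^*,\quad \mathcal{Z}(\rho_{\mathcal{M}}^{\mathrm{ra}}):\mathcal{C}_{\mathcal{M}}^*\to\mathcal{Z}(\mathcal{C})\big)$$ is an adjoint pair (the first functor being left adjoint to the second).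
   Context: $k$ is an algebraically closed field. A finite abelian category is a $k$-linear category equivalent to finite-dimensional left modules over a finite-dimensional $k$-algebra. A finite tensor category is a rigid monoidal category $\mathcal{C}$ that is finite abelian, with $k$-linear tensor product in each variable and simple unit $\mathbf{1}$. A finite left $\mathcal{C}$-module category is a left $\mathcal{C}$-module category that is finite abelian with action $k$-linear and right exact in each variable. Associativity constraints are suppressed. $\mathrm{Rex}(\mathcal{M})$ is the category of $k$-linear right exact endofunctors of $\mathcal{M}$; $\mathrm{Rex}_{\mathcal{C}}(\mathcal{M})$ is the monoidal category (under composition) of $k$-linear right exact left $\mathcal{C}$-module endofunctors $(F,s)$, $s_{X,M}:X\otimes F(M)\to F(X\otimes M)$; the superscript $\mathrm{rev}$ means the reversed tensor product. $\mathcal{C}_{\mathcal{M}}^*$ is called the dual of $\mathcal{C}$ with respect to $\mathcal{M}$. For a monoidal category $\mathcal{D}$, the Drinfeld center $\mathcal{Z}(\mathcal{D})$ has objects $(V,\sigma)$ with $\sigma_X:V\otimes X\to X\otimes V$ a natural isomorphism (half-braiding) satisfying $\sigma_{\mathbf{1}}=\mathrm{id}$ and $\sigma_{X\otimes Y}=(\mathrm{id}_X\otimes\sigma_Y)\circ(\sigma_X\otimes\mathrm{id}_Y)$. Schauenburg's functor: for $\mathbf{V}=(V,\sigma)\in\mathcal{Z}(\mathcal{C})$, $\theta_{\mathcal{M}}(\mathbf{V})$ is the functor $V\otimes(-):\mathcal{M}\to\mathcal{M}$ with $\mathcal{C}$-module structure $\sigma_X^{-1}\otimes\mathrm{id}_M:X\otimes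 V\otimes M\to V\otimes X\otimes M$, and with half-braiding determined by the natural isomorphism $s_{V,M}:\theta_{\mathcal{M}}(\mathbf{V})(F(M))=V\otimes F(M)\to F(V\otimes M)=F(\theta_{\mathcal{M}}(\mathbf{V})(M))$ for $(F,s)\in\mathcal{C}_{\mathcal{M}}^*$, $M\in\mathcal{M}$. On morphisms, $\theta_{\mathcal{M}}(f)=f\otimes\mathrm{id}$. The action functor $\rho=\rho_{\mathcal{M}}:\mathcal{C}\to\mathrm{Rex}(\mathcal{M})$, $\rho(X)=X\otimes\mathrm{id}_{\mathcal{M}}$, is a $\mathcal{C}$-bimodule functor, where $(X\otimes F)(M)=X\otimes F(M)$ and $(F\otimes X)(M)=F(X\otimes M)$ for $F\in\mathrm{Rex}(\mathcal{M})$. It has a right adjoint $\rho^{\mathrm{ra}}$, which is a $\mathcal{C}$-bimodule functor with structure isomorphisms $\xi^{(\ell)}_{X,F}:X\otimes\rho^{\mathrm{ra}}(F)\to\rho^{\mathrm{ra}}(X\otimes F)$ and $\xi^{(r)}_{F,X}:\rho^{\mathrm{ra}}(F)\otimes X\to\rho^{\mathrm{ra}}(F\otimes X)$, uniquely determined by requiring that the unit and counit of $\rho\dashv\rho^{\mathrm{ra}}$ be bimodule transformations. The functor $\mathcal{Z}(\rho^{\mathrm{ra}})$ sends $(F,s)$ to $(\rho^{\mathrm{ra}}(F),\sigma^{\mathbf{F}})$ with $\sigma^{\mathbf{F}}_X=(\xi^{(\ell)}_{X,F})^{-1}\circ\rho^{\mathrm{ra}}(s_{X,-}^{-1})\circ\xi^{(r)}_{F,X}$,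 and acts as $\rho^{\mathrm{ra}}$ on morphisms. *)

theory Defs
  imports
    "HOL-Library.FuncSet"
    "HOL-Computational_Algebra.Polynomial"
    "Jordan_Normal_Form.Matrix"
begin

text \<open>
  Categories are records with explicit carriers for objects and arrows, in the style of HOL-Algebra.
  Composition is written in the usual order. Operations are only meaningful on the carriers. Where
  functors, transformations or structure maps themselves become objects or arrows of a category,
  they are required to be \<open>extensional\<close>, i.e. \<open>undefined\<close> outside their domain, so that equality is
  the intended one. Associativity and unit constraints are carried explicitly throughout.
\<close>

section \<open>Categories, functors, natural transformations, adjunctions\<close>

record ('o, 'a) cat =
  Obj :: "'o set"
  Arr :: "'a set"
  Dom :: "'a \<Rightarrow> 'o"
  Cod :: "'a \<Rightarrow> 'o"
  Ide :: "'o \<Rightarrow> 'a"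
  Cmp :: "'a \<Rightarrow> 'a \<Rightarrow> 'a"  (infixr \<open>\<cdot>\<index>\<close> 55)

definition Hom :: "('o, 'a, 'z) cat_scheme \<Rightarrow> 'o \<Rightarrow> 'o \<Rightarrow> 'a set" where
  "Hom C X Y = {f \<in> Arr C. Dom C f = X \<and> Cod C f = Y}"

locale category =
  fixes C :: "('o, 'a, 'z) cat_scheme" (structure)
  assumes Dom_obj: "f \<in> Arr C \<Longrightarrow> Dom C f \<in> Obj C"
    and Cod_obj: "f \<in> Arr C \<Longrightarrow> Cod C f \<in> Obj C"
    and Ide_hom: "X \<in> Obj C \<Longrightarrow> Ide C X \<in> Hom C X X"
    and Cmp_hom: "\<lbrakk>f \<in> Hom C X Y; g \<in> Hom C Y Z\<rbrakk> \<Longrightarrow> g \<cdot> f \<in> Hom C X Z"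
    and Ide_left: "f \<in> Hom C X Y \<Longrightarrow> Ide C Y \<cdot> f = f"
    and Ide_right: "f \<in> Hom C X Y \<Longrightarrow> f \<cdot> Ide C X = f"
    and Cmp_assoc: "\<lbrakk>f \<in> Hom C W X; g \<in> Hom C X Y; h \<in> Hom C Y Z\<rbrakk>
          \<Longrightarrow> (h \<cdot> g) \<cdot> f = h \<cdot> (g \<cdot> f)"

definition inverse_arrows :: "('o, 'a, 'z) cat_scheme \<Rightarrow> 'a \<Rightarrow> 'a \<Rightarrow> bool" where
  "inverse_arrows C f g \<longleftrightarrow> f \<in> Arr C \<and> g \<in> Hom C (Cod C f) (Dom C f) \<and>
     g \<cdot>\<^bsub>C\<^esub> f = Ide C (Dom C f) \<and> f \<cdot>\<^bsub>C\<^esub> g = Ide C (Cod C f)"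

definition is_iso :: "('o, 'a, 'z) cat_scheme \<Rightarrow> 'a \<Rightarrow> bool" where
  "is_iso C f \<longleftrightarrow> (\<exists>g. inverse_arrows C f g)"

definition inv_arr :: "('o, 'a, 'z) cat_scheme \<Rightarrow> 'a \<Rightarrow> 'a" where
  "inv_arr C f = (THE g. inverse_arrows C f g)"

definition is_mono :: "('o, 'a, 'z) cat_scheme \<Rightarrow> 'a \<Rightarrow> bool" where
  "is_mono C f \<longleftrightarrow> f \<in> Arr C \<and>
     (\<forall>X g h. g \<in> Hom C X (Dom C f) \<longrightarrow> h \<in> Hom C X (Dom C f) \<longrightarrow> f \<cdot>\<^bsub>C\<^esub> g = f \<cdot>\<^bsub>C\<^esub> h \<longrightarrow> g = h)"

record ('o, 'a, 'p, 'b) func =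
  FO :: "'o \<Rightarrow> 'p"
  FA :: "'a \<Rightarrow> 'b"

locale cat_functor = A: category A + B: category B
  for A :: "('o, 'a, 'y) cat_scheme" and B :: "('p, 'b, 'z) cat_scheme" +
  fixes F :: "('o, 'a, 'p, 'b, 'w) func_scheme"
  assumes FO_obj: "X \<in> Obj A \<Longrightarrow> FO F X \<in> Obj B"
    and FA_hom: "f \<in> Hom A X Y \<Longrightarrow> FA F f \<in> Hom B (FO F X) (FO F Y)"
    and FA_Ide: "X \<in> Obj A \<Longrightarrow> FA F (Ide A X) = Ide B (FO F X)"
    and FA_Cmp: "\<lbrakk>f \<in> Hom A X Y; g \<in> Hom A Y Z\<rbrakk> \<Longrightarrow> FA F (g \<cdot>\<^bsub>A\<^esub> f) = FA F g \<cdot>\<^bsub>B\<^esub> FA F f"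

definition fid :: "('o, 'a, 'z) cat_scheme \<Rightarrow> ('o, 'a, 'o, 'a) func" where
  "fid A = \<lparr>FO = (\<lambda>X\<in>Obj A. X), FA = (\<lambda>f\<in>Arr A. f)\<rparr>"

text \<open>\<open>fcomp A G F\<close> is the composite of \<open>G\<close> after \<open>F\<close>, where \<open>F\<close> has domain \<open>A\<close>.\<close>

definition fcomp :: "('o, 'a, 'z) cat_scheme \<Rightarrow> ('p, 'b, 'q, 'c, 'v) func_scheme \<Rightarrow>
    ('o, 'a, 'p, 'b, 'w) func_scheme \<Rightarrow> ('o, 'a, 'q, 'c) func" where
  "fcomp A G F = \<lparr>FO = (\<lambda>X\<in>Obj A. FO G (FO F X)), FA = (\<lambda>f\<in>Arr A. FA G (FA F f))\<rparr>"

locale nat_trans = F: cat_functor A B F + G: cat_functor A B G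
  for A :: "('o, 'a, 'y) cat_scheme" and B :: "('p, 'b, 'z) cat_scheme"
    and F :: "('o, 'a, 'p, 'b, 'v) func_scheme" and G :: "('o, 'a, 'p, 'b, 'w) func_scheme" +
  fixes \<eta> :: "'o \<Rightarrow> 'b"
  assumes component: "X \<in> Obj A \<Longrightarrow> \<eta> X \<in> Hom B (FO F X) (FO G X)"
    and natural: "f \<in> Hom A X Y \<Longrightarrow> \<eta> Y \<cdot>\<^bsub>B\<^esub> FA F f = FA G f \<cdot>\<^bsub>B\<^esub> \<eta> X"

definition naturally_isomorphic :: "('o, 'a, 'y) cat_scheme \<Rightarrow> ('p, 'b, 'z) cat_scheme \<Rightarrow>
    ('o, 'a, 'p, 'b, 'v) func_scheme \<Rightarrow> ('o, 'a, 'p, 'b, 'w) func_scheme \<Rightarrow> bool" where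
  "naturally_isomorphic A B F G \<longleftrightarrow> (\<exists>\<eta>. nat_trans A B F G \<eta> \<and> (\<forall>X\<in>Obj A. is_iso B (\<eta> X)))"

locale adjunction = F: cat_functor A B F + G: cat_functor B A G +
    unit: nat_trans A A "fid A" "fcomp A G F" \<eta> + counit: nat_trans B B "fcomp B F G" "fid B" \<epsilon>
  for A :: "('o, 'a, 'y) cat_scheme" and B :: "('p, 'b, 'z) cat_scheme"
    and F :: "('o, 'a, 'p, 'b, 'v) func_scheme" and G :: "('p, 'b, 'o, 'a, 'w) func_scheme"
    and \<eta> :: "'o \<Rightarrow> 'a" and \<epsilon> :: "'p \<Rightarrow> 'b" +
  assumes triangle_left: "X \<in> Obj A \<Longrightarrow> \<epsilon> (FO F X) \<cdot>\<^bsub>B\<^esub> FA F (\<eta> X) = Ide B (FO F X)"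
    and triangle_right: "Y \<in> Obj B \<Longrightarrow> FA G (\<epsilon> Y) \<cdot>\<^bsub>A\<^esub> \<eta> (FO G Y) = Ide A (FO G Y)"

text \<open>\<open>adjoint_pair A B F G\<close>: the functor \<open>F : A \<rightarrow> B\<close> is left adjoint to \<open>G : B \<rightarrow> A\<close>.\<close>

definition adjoint_pair :: "('o, 'a, 'y) cat_scheme \<Rightarrow> ('p, 'b, 'z) cat_scheme \<Rightarrow>
    ('o, 'a, 'p, 'b, 'v) func_scheme \<Rightarrow> ('p, 'b, 'o, 'a, 'w) func_scheme \<Rightarrow> bool" where
  "adjoint_pair A B F G \<longleftrightarrow> (\<exists>\<eta> \<epsilon>. adjunction A B F G \<eta> \<epsilon>)"


section \<open>Linear categories and finite abelian categories\<close>

text \<open>The linear structure on a category: zero arrows, addition of parallel arrows, scaling.\<close>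

record ('k, 'o, 'a) lin =
  Zer :: "'o \<Rightarrow> 'o \<Rightarrow> 'a"
  Add :: "'a \<Rightarrow> 'a \<Rightarrow> 'a"
  Scl :: "'k \<Rightarrow> 'a \<Rightarrow> 'a"

locale linear_category = category C for C :: "('o, 'a, 'z) cat_scheme" (structure) +
  fixes L :: "('k::field, 'o, 'a) lin"
  assumes Zer_hom: "\<lbrakk>X \<in> Obj C; Y \<in> Obj C\<rbrakk> \<Longrightarrow> Zer L X Y \<in> Hom C X Y"
    and Add_hom: "\<lbrakk>f \<in> Hom C X Y; g \<in> Hom C X Y\<rbrakk> \<Longrightarrow> Add L f g \<in> Hom C X Y"
    and Scl_hom: "f \<in> Hom C X Y \<Longrightarrow> Scl L c f \<in> Hom C X Y"
    and Add_assoc: "\<lbrakk>f \<in> Hom C X Y; g \<in> Hom C X Y; h \<in> Hom C X Y\<rbrakk>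
          \<Longrightarrow> Add L (Add L f g) h = Add L f (Add L g h)"
    and Add_comm: "\<lbrakk>f \<in> Hom C X Y; g \<in> Hom C X Y\<rbrakk> \<Longrightarrow> Add L f g = Add L g f"
    and Add_Zer: "f \<in> Hom C X Y \<Longrightarrow> Add L (Zer L X Y) f = f"
    and Add_neg: "f \<in> Hom C X Y \<Longrightarrow> \<exists>g\<in>Hom C X Y. Add L g f = Zer L X Y"
    and Scl_Add: "\<lbrakk>f \<in> Hom C X Y; g \<in> Hom C X Y\<rbrakk>
          \<Longrightarrow> Scl L c (Add L f g) = Add L (Scl L c f) (Scl L c g)"
    and Scl_plus: "f \<in> Hom C X Y \<Longrightarrow> Scl L (c + d) f = Add L (Scl L c f) (Scl L d f)"
    and Scl_mult: "f \<in> Hom C X Y \<Longrightarrow> Scl L (c * d) f = Scl L c (Scl L d f)"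
    and Scl_one: "f \<in> Hom C X Y \<Longrightarrow> Scl L 1 f = f"
    and Cmp_Add_left: "\<lbrakk>f \<in> Hom C X Y; g \<in> Hom C Y Z; h \<in> Hom C Y Z\<rbrakk>
          \<Longrightarrow> Add L g h \<cdot> f = Add L (g \<cdot> f) (h \<cdot> f)"
    and Cmp_Add_right: "\<lbrakk>f \<in> Hom C X Y; g \<in> Hom C X Y; h \<in> Hom C Y Z\<rbrakk>
          \<Longrightarrow> h \<cdot> Add L f g = Add L (h \<cdot> f) (h \<cdot> g)"
    and Cmp_Scl_left: "\<lbrakk>f \<in> Hom C X Y; g \<in> Hom C Y Z\<rbrakk> \<Longrightarrow> Scl L c g \<cdot> f = Scl L c (g \<cdot> f)"
    and Cmp_Scl_right: "\<lbrakk>f \<in> Hom C X Y; g \<in> Hom C Y Z\<rbrakk> \<Longrightarrow> g \<cdot> Scl L c f = Scl L c (g \<cdot> f)"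

locale linear_functor = cat_functor A B F + A: linear_category A LA + B: linear_category B LB
  for A :: "('o, 'a, 'y) cat_scheme" and LA :: "('k::field, 'o, 'a) lin"
    and B :: "('p, 'b, 'z) cat_scheme" and LB :: "('k, 'p, 'b) lin"
    and F :: "('o, 'a, 'p, 'b, 'w) func_scheme" +
  assumes FA_Add: "\<lbrakk>f \<in> Hom A X Y; g \<in> Hom A X Y\<rbrakk> \<Longrightarrow> FA F (Add LA f g) = Add LB (FA F f) (FA F g)"
    and FA_Scl: "f \<in> Hom A X Y \<Longrightarrow> FA F (Scl LA c f) = Scl LB c (FA F f)"

definition is_zero_obj :: "('o, 'a, 'z) cat_scheme \<Rightarrow> ('k, 'o, 'a) lin \<Rightarrow> 'o \<Rightarrow> bool" where
  "is_zero_obj C L X \<longleftrightarrow> X \<in> Obj C \<and> Ide C X = Zer L X X"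

definition is_simple :: "('o, 'a, 'z) cat_scheme \<Rightarrow> ('k, 'o, 'a) lin \<Rightarrow> 'o \<Rightarrow> bool" where
  "is_simple C L X \<longleftrightarrow> X \<in> Obj C \<and> \<not> is_zero_obj C L X \<and>
     (\<forall>i. is_mono C i \<and> Cod C i = X \<longrightarrow> is_zero_obj C L (Dom C i) \<or> is_iso C i)"

definition is_cokernel :: "('o, 'a, 'z) cat_scheme \<Rightarrow> ('k, 'o, 'a) lin \<Rightarrow> 'a \<Rightarrow> 'a \<Rightarrow> bool" where
  "is_cokernel C L f q \<longleftrightarrow> f \<in> Arr C \<and> q \<in> Arr C \<and> Dom C q = Cod C f \<and>
     q \<cdot>\<^bsub>C\<^esub> f = Zer L (Dom C f) (Cod C q) \<and>
     (\<forall>h\<in>Arr C. Dom C h = Cod C f \<and> h \<cdot>\<^bsub>C\<^esub> f = Zer L (Dom C f) (Cod C h) \<longrightarrow>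
        (\<exists>!u. u \<in> Hom C (Cod C q) (Cod C h) \<and> u \<cdot>\<^bsub>C\<^esub> q = h))"

text \<open>
  A sequence \<open>X \<rightarrow> Y \<rightarrow> Z \<rightarrow> 0\<close> in an abelian category is exact iff its second arrow is a cokernel of
  the first; a linear functor is right exact iff it preserves such sequences.
\<close>

locale right_exact = linear_functor A LA B LB F
  for A :: "('o, 'a, 'y) cat_scheme" and LA :: "('k::field, 'o, 'a) lin"
    and B :: "('p, 'b, 'z) cat_scheme" and LB :: "('k, 'p, 'b) lin"
    and F :: "('o, 'a, 'p, 'b, 'w) func_scheme" +
  assumes preserves_cokernels: "is_cokernel A LA f q \<Longrightarrow> is_cokernel B LB (FA F f) (FA F q)"

text \<open>
  A finite-dimensional algebra, presented on the coordinate space \<open>k\<^sup>d\<close>, \<open>d = adim A\<close>. The zero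
  algebra is allowed.
\<close>

record 'k alg =
  adim :: nat
  amul :: "'k vec \<Rightarrow> 'k vec \<Rightarrow> 'k vec"
  aone :: "'k vec"

locale fd_algebra =
  fixes A :: "'k::field alg"
  assumes amul_closed: "\<lbrakk>a \<in> carrier_vec (adim A); b \<in> carrier_vec (adim A)\<rbrakk>
          \<Longrightarrow> amul A a b \<in> carrier_vec (adim A)"
    and aone_closed: "aone A \<in> carrier_vec (adim A)"
    and amul_add_left: "\<lbrakk>a \<in> carrier_vec (adim A); b \<in> carrier_vec (adim A); c \<in> carrier_vec (adim A)\<rbrakk>
          \<Longrightarrow> amul A (a + b) c = amul A a c + amul A b c"
    and amul_add_right: "\<lbrakk>a \<in> carrier_vec (adim A); b \<in> carrier_vec (adim A); c \<in> carrier_vec (adim A)\<rbrakk>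
          \<Longrightarrow> amul A c (a + b) = amul A c a + amul A c b"
    and amul_smult_left: "\<lbrakk>a \<in> carrier_vec (adim A); b \<in> carrier_vec (adim A)\<rbrakk>
          \<Longrightarrow> amul A (x \<cdot>\<^sub>v a) b = x \<cdot>\<^sub>v amul A a b"
    and amul_smult_right: "\<lbrakk>a \<in> carrier_vec (adim A); b \<in> carrier_vec (adim A)\<rbrakk>
          \<Longrightarrow> amul A a (x \<cdot>\<^sub>v b) = x \<cdot>\<^sub>v amul A a b"
    and amul_assoc: "\<lbrakk>a \<in> carrier_vec (adim A); b \<in> carrier_vec (adim A); c \<in> carrier_vec (adim A)\<rbrakk>
          \<Longrightarrow> amul A (amul A a b) c = amul A a (amul A b c)"
    and aone_left: "a \<in> carrier_vec (adim A) \<Longrightarrow> amul A (aone A) a = a"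
    and aone_right: "a \<in> carrier_vec (adim A) \<Longrightarrow> amul A a (aone A) = a"

text \<open>
  A finite-dimensional left module is a pair \<open>(n, \<phi>)\<close>: underlying space \<open>k\<^sup>n\<close>, with \<open>a\<close> acting by the
  \<open>n \<times> n\<close> matrix \<open>\<phi> a\<close>. An arrow is a triple (source, target, matrix).
\<close>

type_synonym 'k alg_mod = "nat \<times> ('k vec \<Rightarrow> 'k mat)"

definition is_alg_mod :: "'k::field alg \<Rightarrow> 'k alg_mod \<Rightarrow> bool" where
  "is_alg_mod A = (\<lambda>(n, \<phi>).
     \<phi> \<in> carrier_vec (adim A) \<rightarrow>\<^sub>E carrier_mat n n \<and>
     (\<forall>a\<in>carrier_vec (adim A). \<forall>b\<in>carrier_vec (adim A).
        \<phi> (a + b) = \<phi> a + \<phi> b \<and> \<phi> (amul A a b) = \<phi> a * \<phi> b) \<and>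
     (\<forall>x. \<forall>a\<in>carrier_vec (adim A). \<phi> (x \<cdot>\<^sub>v a) = x \<cdot>\<^sub>m \<phi> a) \<and>
     \<phi> (aone A) = 1\<^sub>m n)"

definition mod_cat :: "'k::field alg \<Rightarrow> ('k alg_mod, 'k alg_mod \<times> 'k alg_mod \<times> 'k mat) cat" where
  "mod_cat A = \<lparr>
     Obj = {V. is_alg_mod A V},
     Arr = {(V, W, T). is_alg_mod A V \<and> is_alg_mod A W \<and> T \<in> carrier_mat (fst W) (fst V) \<and>
              (\<forall>a\<in>carrier_vec (adim A). T * snd V a = snd W a * T)},
     Dom = (\<lambda>(V, W, T). V),
     Cod = (\<lambda>(V, W, T). W),
     Ide = (\<lambda>V. (V, V, 1\<^sub>m (fst V))),
     Cmp = (\<lambda>(W', X, S) (V, W, T). (V, X, S * T))\<rparr>"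

definition mod_lin :: "('k::field, 'k alg_mod, 'k alg_mod \<times> 'k alg_mod \<times> 'k mat) lin" where
  "mod_lin = \<lparr>
     Zer = (\<lambda>V W. (V, W, 0\<^sub>m (fst W) (fst V))),
     Add = (\<lambda>(V, W, S) (V', W', T). (V, W, S + T)),
     Scl = (\<lambda>c (V, W, T). (V, W, c \<cdot>\<^sub>m T))\<rparr>"

definition linearly_equivalent :: "('o, 'a, 'y) cat_scheme \<Rightarrow> ('k::field, 'o, 'a) lin \<Rightarrow>
    ('p, 'b, 'z) cat_scheme \<Rightarrow> ('k, 'p, 'b) lin \<Rightarrow> bool" where
  "linearly_equivalent A LA B LB \<longleftrightarrow>
     (\<exists>(F :: ('o, 'a, 'p, 'b) func) (G :: ('p, 'b, 'o, 'a) func).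
        linear_functor A LA B LB F \<and> linear_functor B LB A LA G \<and>
        naturally_isomorphic A A (fcomp A G F) (fid A) \<and>
        naturally_isomorphic B B (fcomp B F G) (fid B))"

locale finite_abelian = linear_category C L
  for C :: "('o, 'a, 'z) cat_scheme" (structure) and L :: "('k::field, 'o, 'a) lin" +
  assumes equivalent_to_modules:
    "\<exists>A. fd_algebra A \<and> linearly_equivalent C L (mod_cat A) mod_lin"


section \<open>Monoidal categories and finite tensor categories\<close>

text \<open>Constraints: \<open>As X Y Z : (X \<otimes> Y) \<otimes> Z \<rightarrow> X \<otimes> (Y \<otimes> Z)\<close>, \<open>Lu X : 1 \<otimes> X \<rightarrow> X\<close>, \<open>Ru X : X \<otimes> 1 \<rightarrow> X\<close>.\<close>

record ('o, 'a) moncat = "('o, 'a) cat" +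
  TO :: "'o \<Rightarrow> 'o \<Rightarrow> 'o"  (infixr \<open>\<otimes>\<^sub>o\<index>\<close> 70)
  TA :: "'a \<Rightarrow> 'a \<Rightarrow> 'a"  (infixr \<open>\<otimes>\<^sub>a\<index>\<close> 70)
  Unt :: 'o
  As :: "'o \<Rightarrow> 'o \<Rightarrow> 'o \<Rightarrow> 'a"
  Lu :: "'o \<Rightarrow> 'a"
  Ru :: "'o \<Rightarrow> 'a"

locale monoidal_category = category C for C :: "('o, 'a, 'z) moncat_scheme" (structure) +
  assumes TO_obj: "\<lbrakk>X \<in> Obj C; Y \<in> Obj C\<rbrakk> \<Longrightarrow> X \<otimes>\<^sub>o Y \<in> Obj C"
    and TA_hom: "\<lbrakk>f \<in> Hom C X X'; g \<in> Hom C Y Y'\<rbrakk> \<Longrightarrow> f \<otimes>\<^sub>a g \<in> Hom C (X \<otimes>\<^sub>o Y) (X' \<otimes>\<^sub>o Y')"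
    and TA_Ide: "\<lbrakk>X \<in> Obj C; Y \<in> Obj C\<rbrakk> \<Longrightarrow> Ide C X \<otimes>\<^sub>a Ide C Y = Ide C (X \<otimes>\<^sub>o Y)"
    and TA_Cmp: "\<lbrakk>f \<in> Hom C X X'; f' \<in> Hom C X' X''; g \<in> Hom C Y Y'; g' \<in> Hom C Y' Y''\<rbrakk>
          \<Longrightarrow> (f' \<cdot> f) \<otimes>\<^sub>a (g' \<cdot> g) = (f' \<otimes>\<^sub>a g') \<cdot> (f \<otimes>\<^sub>a g)"
    and Unt_obj: "Unt C \<in> Obj C"
    and As_hom: "\<lbrakk>X \<in> Obj C; Y \<in> Obj C; Z \<in> Obj C\<rbrakk>
          \<Longrightarrow> As C X Y Z \<in> Hom C ((X \<otimes>\<^sub>o Y) \<otimes>\<^sub>o Z) (X \<otimes>\<^sub>o (Y \<otimes>\<^sub>o Z))"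
    and As_iso: "\<lbrakk>X \<in> Obj C; Y \<in> Obj C; Z \<in> Obj C\<rbrakk> \<Longrightarrow> is_iso C (As C X Y Z)"
    and As_natural: "\<lbrakk>f \<in> Hom C X X'; g \<in> Hom C Y Y'; h \<in> Hom C Z Z'\<rbrakk>
          \<Longrightarrow> As C X' Y' Z' \<cdot> ((f \<otimes>\<^sub>a g) \<otimes>\<^sub>a h) = (f \<otimes>\<^sub>a (g \<otimes>\<^sub>a h)) \<cdot> As C X Y Z"
    and Lu_hom: "X \<in> Obj C \<Longrightarrow> Lu C X \<in> Hom C (Unt C \<otimes>\<^sub>o X) X"
    and Lu_iso: "X \<in> Obj C \<Longrightarrow> is_iso C (Lu C X)"
    and Lu_natural: "f \<in> Hom C X Y \<Longrightarrow> Lu C Y \<cdot> (Ide C (Unt C) \<otimes>\<^sub>a f) = f \<cdot> Lu C X"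
    and Ru_hom: "X \<in> Obj C \<Longrightarrow> Ru C X \<in> Hom C (X \<otimes>\<^sub>o Unt C) X"
    and Ru_iso: "X \<in> Obj C \<Longrightarrow> is_iso C (Ru C X)"
    and Ru_natural: "f \<in> Hom C X Y \<Longrightarrow> Ru C Y \<cdot> (f \<otimes>\<^sub>a Ide C (Unt C)) = f \<cdot> Ru C X"
    and pentagon: "\<lbrakk>W \<in> Obj C; X \<in> Obj C; Y \<in> Obj C; Z \<in> Obj C\<rbrakk>
          \<Longrightarrow> As C W X (Y \<otimes>\<^sub>o Z) \<cdot> As C (W \<otimes>\<^sub>o X) Y Z
            = (Ide C W \<otimes>\<^sub>a As C X Y Z) \<cdot> As C W (X \<otimes>\<^sub>o Y) Z \<cdot> (As C W X Y \<otimes>\<^sub>a Ide C Z)"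
    and triangle: "\<lbrakk>X \<in> Obj C; Y \<in> Obj C\<rbrakk>
          \<Longrightarrow> (Ide C X \<otimes>\<^sub>a Lu C Y) \<cdot> As C X (Unt C) Y = Ru C X \<otimes>\<^sub>a Ide C Y"

text \<open>\<open>Y\<close> is left dual to \<open>X\<close> (and \<open>X\<close> right dual to \<open>Y\<close>) via \<open>ev : Y \<otimes> X \<rightarrow> 1\<close> and \<open>cv : 1 \<rightarrow> X \<otimes> Y\<close>.\<close>

definition is_duality :: "('o, 'a, 'z) moncat_scheme \<Rightarrow> 'o \<Rightarrow> 'o \<Rightarrow> 'a \<Rightarrow> 'a \<Rightarrow> bool" where
  "is_duality C Y X ev cv \<longleftrightarrow> X \<in> Obj C \<and> Y \<in> Obj C \<and>
     ev \<in> Hom C (Y \<otimes>\<^sub>o\<^bsub>C\<^esub> X) (Unt C) \<and> cv \<in> Hom C (Unt C) (X \<otimes>\<^sub>o\<^bsub>C\<^esub> Y) \<and>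
     Ru C X \<cdot>\<^bsub>C\<^esub> (Ide C X \<otimes>\<^sub>a\<^bsub>C\<^esub> ev) \<cdot>\<^bsub>C\<^esub> As C X Y X \<cdot>\<^bsub>C\<^esub> (cv \<otimes>\<^sub>a\<^bsub>C\<^esub> Ide C X) = Lu C X \<and>
     Lu C Y \<cdot>\<^bsub>C\<^esub> (ev \<otimes>\<^sub>a\<^bsub>C\<^esub> Ide C Y) \<cdot>\<^bsub>C\<^esub> inv_arr C (As C Y X Y) \<cdot>\<^bsub>C\<^esub> (Ide C Y \<otimes>\<^sub>a\<^bsub>C\<^esub> cv) = Ru C Y"

locale rigid_monoidal_category = monoidal_category +
  assumes left_dual: "X \<in> Obj C \<Longrightarrow> \<exists>Y ev cv. is_duality C Y X ev cv"
    and right_dual: "X \<in> Obj C \<Longrightarrow> \<exists>Y ev cv. is_duality C X Y ev cv"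

locale finite_tensor_category = rigid_monoidal_category C + finite_abelian C L
  for C :: "('o, 'a, 'z) moncat_scheme" (structure) and L :: "('k::field, 'o, 'a) lin" +
  assumes TO_linear_left: "Y \<in> Obj C \<Longrightarrow>
      linear_functor C L C L \<lparr>FO = \<lambda>X. X \<otimes>\<^sub>o Y, FA = \<lambda>f. f \<otimes>\<^sub>a Ide C Y\<rparr>"
    and TO_linear_right: "X \<in> Obj C \<Longrightarrow>
      linear_functor C L C L \<lparr>FO = \<lambda>Y. X \<otimes>\<^sub>o Y, FA = \<lambda>f. Ide C X \<otimes>\<^sub>a f\<rparr>"
    and Unt_simple: "is_simple C L (Unt C)"

text \<open>The reversed monoidal category.\<close>

definition rev_moncat :: "('o, 'a, 'z) moncat_scheme \<Rightarrow> ('o, 'a, 'z) moncat_scheme" where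
  "rev_moncat D = D\<lparr>
     TO := (\<lambda>X Y. Y \<otimes>\<^sub>o\<^bsub>D\<^esub> X),
     TA := (\<lambda>f g. g \<otimes>\<^sub>a\<^bsub>D\<^esub> f),
     As := (\<lambda>X Y Z. inv_arr D (As D Z Y X)),
     Lu := Ru D,
     Ru := Lu D\<rparr>"


section \<open>The Drinfeld center\<close>

text \<open>Half-braidings \<open>\<sigma> X : V \<otimes> X \<rightarrow> X \<otimes> V\<close>.\<close>

definition half_braiding :: "('o, 'a, 'z) moncat_scheme \<Rightarrow> 'o \<Rightarrow> ('o \<Rightarrow> 'a) \<Rightarrow> bool" where
  "half_braiding D V \<sigma> \<longleftrightarrow> V \<in> Obj D \<and> \<sigma> \<in> extensional (Obj D) \<and>
     (\<forall>X\<in>Obj D. \<sigma> X \<in> Hom D (V \<otimes>\<^sub>o\<^bsub>D\<^esub> X) (X \<otimes>\<^sub>o\<^bsub>D\<^esub> V) \<and> is_iso D (\<sigma> X)) \<and>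
     (\<forall>X Y f. f \<in> Hom D X Y \<longrightarrow>
        \<sigma> Y \<cdot>\<^bsub>D\<^esub> (Ide D V \<otimes>\<^sub>a\<^bsub>D\<^esub> f) = (f \<otimes>\<^sub>a\<^bsub>D\<^esub> Ide D V) \<cdot>\<^bsub>D\<^esub> \<sigma> X) \<and>
     Lu D V \<cdot>\<^bsub>D\<^esub> \<sigma> (Unt D) = Ru D V \<and>
     (\<forall>X\<in>Obj D. \<forall>Y\<in>Obj D.
        As D X Y V \<cdot>\<^bsub>D\<^esub> \<sigma> (X \<otimes>\<^sub>o\<^bsub>D\<^esub> Y) \<cdot>\<^bsub>D\<^esub> As D V X Y =
        (Ide D X \<otimes>\<^sub>a\<^bsub>D\<^esub> \<sigma> Y) \<cdot>\<^bsub>D\<^esub> As D X V Y \<cdot>\<^bsub>D\<^esub> (\<sigma> X \<otimes>\<^sub>a\<^bsub>D\<^esub> Ide D Y))"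

type_synonym ('o, 'a) cobj = "'o \<times> ('o \<Rightarrow> 'a)"
type_synonym ('o, 'a) carr = "('o, 'a) cobj \<times> ('o, 'a) cobj \<times> 'a"

definition center :: "('o, 'a, 'z) moncat_scheme \<Rightarrow> (('o, 'a) cobj, ('o, 'a) carr) cat" where
  "center D = \<lparr>
     Obj = {(V, \<sigma>). half_braiding D V \<sigma>},
     Arr = {((V, \<sigma>), (W, \<tau>), f). half_braiding D V \<sigma> \<and> half_braiding D W \<tau> \<and> f \<in> Hom D V W \<and>
              (\<forall>X\<in>Obj D. (Ide D X \<otimes>\<^sub>a\<^bsub>D\<^esub> f) \<cdot>\<^bsub>D\<^esub> \<sigma> X = \<tau> X \<cdot>\<^bsub>D\<^esub> (f \<otimes>\<^sub>a\<^bsub>D\<^esub> Ide D X))},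
     Dom = (\<lambda>(V, W, f). V),
     Cod = (\<lambda>(V, W, f). W),
     Ide = (\<lambda>V. (V, V, Ide D (fst V))),
     Cmp = (\<lambda>(W', X, g) (V, W, f). (V, X, g \<cdot>\<^bsub>D\<^esub> f))\<rparr>"

text \<open>The forgetful functor out of the center.\<close>

definition forget :: "(('o, 'a) cobj, ('o, 'a) carr, 'o, 'a) func" where
  "forget = \<lparr>FO = (\<lambda>(V, \<sigma>). V), FA = (\<lambda>(V, W, f). f)\<rparr>"


section \<open>Module categories and module functors\<close>

text \<open>
  A left module category over a monoidal category with objects \<open>'c\<close> and arrows \<open>'f\<close>. Constraints:
  \<open>Mas X Y P : (X \<otimes> Y) \<rhd> P \<rightarrow> X \<rhd> (Y \<rhd> P)\<close> and \<open>Mun P : 1 \<rhd> P \<rightarrow> P\<close>.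
\<close>

record ('c, 'f, 'o, 'a) modcat = "('o, 'a) cat" +
  AO :: "'c \<Rightarrow> 'o \<Rightarrow> 'o"  (infixr \<open>\<rhd>\<^sub>o\<index>\<close> 70)
  AA :: "'f \<Rightarrow> 'a \<Rightarrow> 'a"  (infixr \<open>\<rhd>\<^sub>a\<index>\<close> 70)
  Mas :: "'c \<Rightarrow> 'c \<Rightarrow> 'o \<Rightarrow> 'a"
  Mun :: "'o \<Rightarrow> 'a"

locale module_category = C: monoidal_category C + M: category M
  for C :: "('c, 'f, 'y) moncat_scheme" and M :: "('c, 'f, 'o, 'a, 'z) modcat_scheme" (structure) +
  assumes AO_obj: "\<lbrakk>X \<in> Obj C; P \<in> Obj M\<rbrakk> \<Longrightarrow> X \<rhd>\<^sub>o P \<in> Obj M"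
    and AA_hom: "\<lbrakk>f \<in> Hom C X X'; u \<in> Hom M P P'\<rbrakk> \<Longrightarrow> f \<rhd>\<^sub>a u \<in> Hom M (X \<rhd>\<^sub>o P) (X' \<rhd>\<^sub>o P')"
    and AA_Ide: "\<lbrakk>X \<in> Obj C; P \<in> Obj M\<rbrakk> \<Longrightarrow> Ide C X \<rhd>\<^sub>a Ide M P = Ide M (X \<rhd>\<^sub>o P)"
    and AA_Cmp: "\<lbrakk>f \<in> Hom C X X'; f' \<in> Hom C X' X''; u \<in> Hom M P P'; u' \<in> Hom M P' P''\<rbrakk>
          \<Longrightarrow> (f' \<cdot>\<^bsub>C\<^esub> f) \<rhd>\<^sub>a (u' \<cdot> u) = (f' \<rhd>\<^sub>a u') \<cdot> (f \<rhd>\<^sub>a u)"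
    and Mas_hom: "\<lbrakk>X \<in> Obj C; Y \<in> Obj C; P \<in> Obj M\<rbrakk>
          \<Longrightarrow> Mas M X Y P \<in> Hom M ((X \<otimes>\<^sub>o\<^bsub>C\<^esub> Y) \<rhd>\<^sub>o P) (X \<rhd>\<^sub>o (Y \<rhd>\<^sub>o P))"
    and Mas_iso: "\<lbrakk>X \<in> Obj C; Y \<in> Obj C; P \<in> Obj M\<rbrakk> \<Longrightarrow> is_iso M (Mas M X Y P)"
    and Mas_natural: "\<lbrakk>f \<in> Hom C X X'; g \<in> Hom C Y Y'; u \<in> Hom M P P'\<rbrakk>
          \<Longrightarrow> Mas M X' Y' P' \<cdot> ((f \<otimes>\<^sub>a\<^bsub>C\<^esub> g) \<rhd>\<^sub>a u) = (f \<rhd>\<^sub>a (g \<rhd>\<^sub>a u)) \<cdot> Mas M X Y P"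
    and Mun_hom: "P \<in> Obj M \<Longrightarrow> Mun M P \<in> Hom M (Unt C \<rhd>\<^sub>o P) P"
    and Mun_iso: "P \<in> Obj M \<Longrightarrow> is_iso M (Mun M P)"
    and Mun_natural: "u \<in> Hom M P Q \<Longrightarrow> Mun M Q \<cdot> (Ide C (Unt C) \<rhd>\<^sub>a u) = u \<cdot> Mun M P"
    and Mas_pentagon: "\<lbrakk>X \<in> Obj C; Y \<in> Obj C; Z \<in> Obj C; P \<in> Obj M\<rbrakk>
          \<Longrightarrow> Mas M X Y (Z \<rhd>\<^sub>o P) \<cdot> Mas M (X \<otimes>\<^sub>o\<^bsub>C\<^esub> Y) Z P
            = (Ide C X \<rhd>\<^sub>a Mas M Y Z P) \<cdot> Mas M X (Y \<otimes>\<^sub>o\<^bsub>C\<^esub> Z) P \<cdot> (As C X Y Z \<rhd>\<^sub>a Ide M P)"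
    and Mas_triangle: "\<lbrakk>X \<in> Obj C; P \<in> Obj M\<rbrakk>
          \<Longrightarrow> (Ide C X \<rhd>\<^sub>a Mun M P) \<cdot> Mas M X (Unt C) P = Ru C X \<rhd>\<^sub>a Ide M P"

definition act_functor :: "('c, 'f, 'y) moncat_scheme \<Rightarrow> ('c, 'f, 'o, 'a, 'z) modcat_scheme \<Rightarrow>
    'c \<Rightarrow> ('o, 'a, 'o, 'a) func" where
  "act_functor C M X =
     \<lparr>FO = (\<lambda>P\<in>Obj M. X \<rhd>\<^sub>o\<^bsub>M\<^esub> P), FA = (\<lambda>u\<in>Arr M. Ide C X \<rhd>\<^sub>a\<^bsub>M\<^esub> u)\<rparr>"

locale finite_module_category = module_category C M + M: finite_abelian M LM
  for C :: "('c, 'f, 'y) moncat_scheme" and LC :: "('k::field, 'c, 'f) lin"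
    and M :: "('c, 'f, 'o, 'a, 'z) modcat_scheme" (structure) and LM :: "('k, 'o, 'a) lin" +
  assumes act_right_exact_left: "P \<in> Obj M \<Longrightarrow>
      right_exact C LC M LM \<lparr>FO = \<lambda>X. X \<rhd>\<^sub>o P, FA = \<lambda>f. f \<rhd>\<^sub>a Ide M P\<rparr>"
    and act_right_exact_right: "X \<in> Obj C \<Longrightarrow> right_exact M LM M LM (act_functor C M X)"

text \<open>Module functor structures \<open>s (X, P) : X \<rhd> F P \<rightarrow> F (X \<rhd> P)\<close>.\<close>

locale module_functor = cat_functor P Q F
  for C :: "('c, 'f, 'y) moncat_scheme" and P :: "('c, 'f, 'o, 'a, 'v) modcat_scheme"
    and Q :: "('c, 'f, 'p, 'b, 'w) modcat_scheme" and F :: "('o, 'a, 'p, 'b, 'u) func_scheme" +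
  fixes s :: "'c \<times> 'o \<Rightarrow> 'b"
  assumes s_hom: "\<lbrakk>X \<in> Obj C; A \<in> Obj P\<rbrakk> \<Longrightarrow> s (X, A) \<in> Hom Q (X \<rhd>\<^sub>o\<^bsub>Q\<^esub> FO F A) (FO F (X \<rhd>\<^sub>o\<^bsub>P\<^esub> A))"
    and s_iso: "\<lbrakk>X \<in> Obj C; A \<in> Obj P\<rbrakk> \<Longrightarrow> is_iso Q (s (X, A))"
    and s_natural: "\<lbrakk>f \<in> Hom C X Y; u \<in> Hom P A B\<rbrakk>
          \<Longrightarrow> s (Y, B) \<cdot>\<^bsub>Q\<^esub> (f \<rhd>\<^sub>a\<^bsub>Q\<^esub> FA F u) = FA F (f \<rhd>\<^sub>a\<^bsub>P\<^esub> u) \<cdot>\<^bsub>Q\<^esub> s (X, A)"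
    and s_assoc: "\<lbrakk>X \<in> Obj C; Y \<in> Obj C; A \<in> Obj P\<rbrakk>
          \<Longrightarrow> FA F (Mas P X Y A) \<cdot>\<^bsub>Q\<^esub> s (X \<otimes>\<^sub>o\<^bsub>C\<^esub> Y, A)
            = s (X, Y \<rhd>\<^sub>o\<^bsub>P\<^esub> A) \<cdot>\<^bsub>Q\<^esub> (Ide C X \<rhd>\<^sub>a\<^bsub>Q\<^esub> s (Y, A)) \<cdot>\<^bsub>Q\<^esub> Mas Q X Y (FO F A)"
    and s_unit: "A \<in> Obj P \<Longrightarrow> FA F (Mun P A) \<cdot>\<^bsub>Q\<^esub> s (Unt C, A) = Mun Q (FO F A)"

definition module_trans :: "('c, 'f, 'y) moncat_scheme \<Rightarrow> ('c, 'f, 'o, 'a, 'v) modcat_scheme \<Rightarrow>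
    ('c, 'f, 'p, 'b, 'w) modcat_scheme \<Rightarrow> ('c \<times> 'o \<Rightarrow> 'b) \<Rightarrow> ('c \<times> 'o \<Rightarrow> 'b) \<Rightarrow> ('o \<Rightarrow> 'b) \<Rightarrow> bool" where
  "module_trans C P Q s t \<eta> \<longleftrightarrow> (\<forall>X\<in>Obj C. \<forall>A\<in>Obj P.
     t (X, A) \<cdot>\<^bsub>Q\<^esub> (Ide C X \<rhd>\<^sub>a\<^bsub>Q\<^esub> \<eta> A) = \<eta> (X \<rhd>\<^sub>o\<^bsub>P\<^esub> A) \<cdot>\<^bsub>Q\<^esub> s (X, A))"


section \<open>\<open>Rex(M)\<close>, \<open>Rex\<^sub>C(M)\<close> and the dual category\<close>

type_synonym ('o, 'a) endo = "('o, 'a, 'o, 'a) func"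
type_synonym ('o, 'a) endo_arr = "('o, 'a) endo \<times> ('o, 'a) endo \<times> ('o \<Rightarrow> 'a)"

definition Rex :: "('o, 'a, 'z) cat_scheme \<Rightarrow> ('k::field, 'o, 'a) lin \<Rightarrow>
    (('o, 'a) endo, ('o, 'a) endo_arr) cat" where
  "Rex M LM = (let
     E = {F. right_exact M LM M LM F \<and> FO F \<in> extensional (Obj M) \<and> FA F \<in> extensional (Arr M)}
   in \<lparr>
     Obj = E,
     Arr = {(F, G, \<eta>). F \<in> E \<and> G \<in> E \<and> nat_trans M M F G \<eta> \<and> \<eta> \<in> extensional (Obj M)},
     Dom = (\<lambda>(F, G, \<eta>). F),
     Cod = (\<lambda>(F, G, \<eta>). G),
     Ide = (\<lambda>F. (F, F, \<lambda>P\<in>Obj M. Ide M (FO F P))),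
     Cmp = (\<lambda>(G', H, \<beta>) (F, G, \<alpha>). (F, H, \<lambda>P\<in>Obj M. \<beta> P \<cdot>\<^bsub>M\<^esub> \<alpha> P))\<rparr>)"

text \<open>Endofunctors with module structure, and their composition \<open>(F, s) \<circ> (G, t)\<close>.\<close>

type_synonym ('c, 'o, 'a) mendo = "('o, 'a) endo \<times> ('c \<times> 'o \<Rightarrow> 'a)"
type_synonym ('c, 'o, 'a) mendo_arr =
  "('c, 'o, 'a) mendo \<times> ('c, 'o, 'a) mendo \<times> ('o \<Rightarrow> 'a)"

definition mcomp :: "('c, 'f, 'y) moncat_scheme \<Rightarrow> ('c, 'f, 'o, 'a, 'z) modcat_scheme \<Rightarrow>
    ('c, 'o, 'a) mendo \<Rightarrow> ('c, 'o, 'a) mendo \<Rightarrow> ('c, 'o, 'a) mendo" where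
  "mcomp C M = (\<lambda>(F, s) (G, t).
     (fcomp M F G, \<lambda>(X, P) \<in> Obj C \<times> Obj M. FA F (t (X, P)) \<cdot>\<^bsub>M\<^esub> s (X, FO G P)))"

definition mid :: "('c, 'f, 'y) moncat_scheme \<Rightarrow> ('c, 'f, 'o, 'a, 'z) modcat_scheme \<Rightarrow>
    ('c, 'o, 'a) mendo" where
  "mid C M = (fid M, \<lambda>(X, P) \<in> Obj C \<times> Obj M. Ide M (X \<rhd>\<^sub>o\<^bsub>M\<^esub> P))"

text \<open>
  \<open>Rex_mod C M LM\<close> is \<open>Rex\<^sub>C(M)\<close> with composition as tensor product. Composition of (extensional)
  functors is strictly associative and unital, so the constraints are identities.
\<close>

definition Rex_mod :: "('c, 'f, 'y) moncat_scheme \<Rightarrow> ('c, 'f, 'o, 'a, 'z) modcat_scheme \<Rightarrow>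
    ('k::field, 'o, 'a) lin \<Rightarrow> (('c, 'o, 'a) mendo, ('c, 'o, 'a) mendo_arr) moncat" where
  "Rex_mod C M LM = (let
     E = {(F, s). F \<in> Obj (Rex M LM) \<and> module_functor C M M F s \<and> s \<in> extensional (Obj C \<times> Obj M)};
     idt = (\<lambda>F. (F, F, \<lambda>P\<in>Obj M. Ide M (FO (fst F) P)))
   in \<lparr>
     Obj = E,
     Arr = {(F, G, \<eta>). F \<in> E \<and> G \<in> E \<and> (fst F, fst G, \<eta>) \<in> Arr (Rex M LM) \<and>
              module_trans C M M (snd F) (snd G) \<eta>},
     Dom = (\<lambda>(F, G, \<eta>). F),
     Cod = (\<lambda>(F, G, \<eta>). G),
     Ide = idt,
     Cmp = (\<lambda>(G', H, \<beta>) (F, G, \<alpha>). (F, H, \<lambda>P\<in>Obj M. \<beta> P \<cdot>\<^bsub>M\<^esub> \<alpha> P)),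
     TO = mcomp C M,
     TA = (\<lambda>(F, F', \<alpha>) (G, G', \<beta>). (mcomp C M F G, mcomp C M F' G',
            \<lambda>P\<in>Obj M. \<alpha> (FO (fst G') P) \<cdot>\<^bsub>M\<^esub> FA (fst F) (\<beta> P))),
     Unt = mid C M,
     As = (\<lambda>F G H. idt (mcomp C M (mcomp C M F G) H)),
     Lu = idt,
     Ru = idt\<rparr>)"

definition dual_cat :: "('c, 'f, 'y) moncat_scheme \<Rightarrow> ('c, 'f, 'o, 'a, 'z) modcat_scheme \<Rightarrow>
    ('k::field, 'o, 'a) lin \<Rightarrow> (('c, 'o, 'a) mendo, ('c, 'o, 'a) mendo_arr) moncat" where
  "dual_cat C M LM = rev_moncat (Rex_mod C M LM)"


section \<open>Schauenburg's functor\<close>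

text \<open>The functor \<open>V \<rhd> -\<close> with module structure \<open>X \<rhd> (V \<rhd> P) \<rightarrow> V \<rhd> (X \<rhd> P)\<close> induced by \<open>\<sigma>\<^sub>X\<^sup>-\<^sup>1\<close>.\<close>

definition theta_obj :: "('c, 'f, 'y) moncat_scheme \<Rightarrow> ('c, 'f, 'o, 'a, 'z) modcat_scheme \<Rightarrow>
    ('c, 'f) cobj \<Rightarrow> ('c, 'o, 'a) mendo" where
  "theta_obj C M = (\<lambda>(V, \<sigma>). (act_functor C M V,
     \<lambda>(X, P) \<in> Obj C \<times> Obj M.
       Mas M V X P \<cdot>\<^bsub>M\<^esub> (inv_arr C (\<sigma> X) \<rhd>\<^sub>a\<^bsub>M\<^esub> Ide M P) \<cdot>\<^bsub>M\<^esub> inv_arr M (Mas M X V P)))"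

text \<open>
  The half-braiding at \<open>(F, s)\<close> has to go from \<open>\<theta> V \<otimes> F\<close> to \<open>F \<otimes> \<theta> V\<close>. As the tensor product of the
  dual category is reversed composition, these are \<open>P \<mapsto> F (V \<rhd> P)\<close> and \<open>P \<mapsto> V \<rhd> F P\<close>, so its
  components are the inverses of \<open>s (V, P) : V \<rhd> F P \<rightarrow> F (V \<rhd> P)\<close>.
\<close>

definition theta_braiding :: "('c, 'f, 'y) moncat_scheme \<Rightarrow> ('c, 'f, 'o, 'a, 'z) modcat_scheme \<Rightarrow>
    ('k::field, 'o, 'a) lin \<Rightarrow> ('c, 'f) cobj \<Rightarrow> ('c, 'o, 'a) mendo \<Rightarrow> ('c, 'o, 'a) mendo_arr" where
  "theta_braiding C M LM V = (\<lambda>F \<in> Obj (dual_cat C M LM).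
     (theta_obj C M V \<otimes>\<^sub>o\<^bsub>dual_cat C M LM\<^esub> F, F \<otimes>\<^sub>o\<^bsub>dual_cat C M LM\<^esub> theta_obj C M V,
      \<lambda>P\<in>Obj M. inv_arr M (snd F (fst V, P))))"

definition theta :: "('c, 'f, 'y) moncat_scheme \<Rightarrow> ('c, 'f, 'o, 'a, 'z) modcat_scheme \<Rightarrow>
    ('k::field, 'o, 'a) lin \<Rightarrow> (('c, 'f) cobj, ('c, 'f) carr,
      (('c, 'o, 'a) mendo, ('c, 'o, 'a) mendo_arr) cobj,
      (('c, 'o, 'a) mendo, ('c, 'o, 'a) mendo_arr) carr) func" where
  "theta C M LM = (let T = (\<lambda>V. (theta_obj C M V, theta_braiding C M LM V)) in \<lparr>
     FO = T,
     FA = (\<lambda>(V, W, f). (T V, T W,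
            (theta_obj C M V, theta_obj C M W, \<lambda>P\<in>Obj M. f \<rhd>\<^sub>a\<^bsub>M\<^esub> Ide M P)))\<rparr>)"


section \<open>Bimodule categories and bimodule functors\<close>

text \<open>
  Further constraints: \<open>Ras P X Y : (P \<lhd> X) \<lhd> Y \<rightarrow> P \<lhd> (X \<otimes> Y)\<close>, \<open>Run P : P \<lhd> 1 \<rightarrow> P\<close> and
  \<open>Mdl X P Y : (X \<rhd> P) \<lhd> Y \<rightarrow> X \<rhd> (P \<lhd> Y)\<close>. Only the structure is recorded here; the bimodule
  categories below are concrete.
\<close>

record ('c, 'f, 'o, 'a) bimodcat = "('c, 'f, 'o, 'a) modcat" +
  RO :: "'o \<Rightarrow> 'c \<Rightarrow> 'o"  (infixl \<open>\<lhd>\<^sub>o\<index>\<close> 70)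
  RA :: "'a \<Rightarrow> 'f \<Rightarrow> 'a"  (infixl \<open>\<lhd>\<^sub>a\<index>\<close> 70)
  Ras :: "'o \<Rightarrow> 'c \<Rightarrow> 'c \<Rightarrow> 'a"
  Run :: "'o \<Rightarrow> 'a"
  Mdl :: "'c \<Rightarrow> 'o \<Rightarrow> 'c \<Rightarrow> 'a"

text \<open>Bimodule functors: \<open>LS (X, P) : X \<rhd> F P \<rightarrow> F (X \<rhd> P)\<close> and \<open>RS (P, X) : F P \<lhd> X \<rightarrow> F (P \<lhd> X)\<close>.\<close>

record ('c, 'o, 'a, 'p, 'b) bifunc = "('o, 'a, 'p, 'b) func" +
  LS :: "'c \<times> 'o \<Rightarrow> 'b"
  RS :: "'o \<times> 'c \<Rightarrow> 'b"

locale bimodule_functor = module_functor C P Q F "LS F"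
  for C :: "('c, 'f, 'y) moncat_scheme" and P :: "('c, 'f, 'o, 'a, 'v) bimodcat_scheme"
    and Q :: "('c, 'f, 'p, 'b, 'w) bimodcat_scheme" and F :: "('c, 'o, 'a, 'p, 'b) bifunc" +
  assumes RS_hom: "\<lbrakk>X \<in> Obj C; A \<in> Obj P\<rbrakk>
          \<Longrightarrow> RS F (A, X) \<in> Hom Q (FO F A \<lhd>\<^sub>o\<^bsub>Q\<^esub> X) (FO F (A \<lhd>\<^sub>o\<^bsub>P\<^esub> X))"
    and RS_iso: "\<lbrakk>X \<in> Obj C; A \<in> Obj P\<rbrakk> \<Longrightarrow> is_iso Q (RS F (A, X))"
    and RS_natural: "\<lbrakk>f \<in> Hom C X Y; u \<in> Hom P A B\<rbrakk>
          \<Longrightarrow> RS F (B, Y) \<cdot>\<^bsub>Q\<^esub> (FA F u \<lhd>\<^sub>a\<^bsub>Q\<^esub> f) = FA F (u \<lhd>\<^sub>a\<^bsub>P\<^esub> f) \<cdot>\<^bsub>Q\<^esub> RS F (A, X)"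
    and RS_assoc: "\<lbrakk>X \<in> Obj C; Y \<in> Obj C; A \<in> Obj P\<rbrakk>
          \<Longrightarrow> FA F (Ras P A X Y) \<cdot>\<^bsub>Q\<^esub> RS F (A \<lhd>\<^sub>o\<^bsub>P\<^esub> X, Y) \<cdot>\<^bsub>Q\<^esub> (RS F (A, X) \<lhd>\<^sub>a\<^bsub>Q\<^esub> Ide C Y)
            = RS F (A, X \<otimes>\<^sub>o\<^bsub>C\<^esub> Y) \<cdot>\<^bsub>Q\<^esub> Ras Q (FO F A) X Y"
    and RS_unit: "A \<in> Obj P \<Longrightarrow> FA F (Run P A) \<cdot>\<^bsub>Q\<^esub> RS F (A, Unt C) = Run Q (FO F A)"
    and LS_RS: "\<lbrakk>X \<in> Obj C; Y \<in> Obj C; A \<in> Obj P\<rbrakk>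
          \<Longrightarrow> FA F (Mdl P X A Y) \<cdot>\<^bsub>Q\<^esub> RS F (X \<rhd>\<^sub>o\<^bsub>P\<^esub> A, Y) \<cdot>\<^bsub>Q\<^esub> (LS F (X, A) \<lhd>\<^sub>a\<^bsub>Q\<^esub> Ide C Y)
            = LS F (X, A \<lhd>\<^sub>o\<^bsub>P\<^esub> Y) \<cdot>\<^bsub>Q\<^esub> (Ide C X \<rhd>\<^sub>a\<^bsub>Q\<^esub> RS F (A, Y)) \<cdot>\<^bsub>Q\<^esub> Mdl Q X (FO F A) Y"

definition bifid :: "('c, 'f, 'y) moncat_scheme \<Rightarrow> ('c, 'f, 'o, 'a, 'v) bimodcat_scheme \<Rightarrow>
    ('c, 'o, 'a, 'o, 'a) bifunc" where
  "bifid C P = \<lparr>FO = FO (fid P), FA = FA (fid P),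
     LS = (\<lambda>(X, A) \<in> Obj C \<times> Obj P. Ide P (X \<rhd>\<^sub>o\<^bsub>P\<^esub> A)),
     RS = (\<lambda>(A, X) \<in> Obj P \<times> Obj C. Ide P (A \<lhd>\<^sub>o\<^bsub>P\<^esub> X))\<rparr>"

definition bifcomp :: "('c, 'f, 'y) moncat_scheme \<Rightarrow> ('c, 'f, 'o, 'a, 'v) bimodcat_scheme \<Rightarrow>
    ('c, 'f, 'q, 'd, 'w) bimodcat_scheme \<Rightarrow>
    ('c, 'p, 'b, 'q, 'd) bifunc \<Rightarrow> ('c, 'o, 'a, 'p, 'b) bifunc \<Rightarrow> ('c, 'o, 'a, 'q, 'd) bifunc" where
  "bifcomp C P Q G F = \<lparr>FO = FO (fcomp P G F), FA = FA (fcomp P G F),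
     LS = (\<lambda>(X, A) \<in> Obj C \<times> Obj P. FA G (LS F (X, A)) \<cdot>\<^bsub>Q\<^esub> LS G (X, FO F A)),
     RS = (\<lambda>(A, X) \<in> Obj P \<times> Obj C. FA G (RS F (A, X)) \<cdot>\<^bsub>Q\<^esub> RS G (FO F A, X))\<rparr>"

definition bimodule_trans :: "('c, 'f, 'y) moncat_scheme \<Rightarrow> ('c, 'f, 'o, 'a, 'v) bimodcat_scheme \<Rightarrow>
    ('c, 'f, 'p, 'b, 'w) bimodcat_scheme \<Rightarrow> ('c, 'o, 'a, 'p, 'b) bifunc \<Rightarrow> ('c, 'o, 'a, 'p, 'b) bifunc \<Rightarrow>
    ('o \<Rightarrow> 'b) \<Rightarrow> bool" where
  "bimodule_trans C P Q F G \<eta> \<longleftrightarrow> nat_trans P Q F G \<eta> \<and> module_trans C P Q (LS F) (LS G) \<eta> \<and>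
     (\<forall>X\<in>Obj C. \<forall>A\<in>Obj P.
        RS G (A, X) \<cdot>\<^bsub>Q\<^esub> (\<eta> A \<lhd>\<^sub>a\<^bsub>Q\<^esub> Ide C X) = \<eta> (A \<lhd>\<^sub>o\<^bsub>P\<^esub> X) \<cdot>\<^bsub>Q\<^esub> RS F (A, X))"

text \<open>A monoidal category as a bimodule category over itself.\<close>

definition regular_bimod :: "('c, 'f, 'y) moncat_scheme \<Rightarrow> ('c, 'f, 'c, 'f) bimodcat" where
  "regular_bimod C = \<lparr>
     Obj = Obj C, Arr = Arr C, Dom = Dom C, Cod = Cod C, Ide = Ide C, Cmp = Cmp C,
     AO = TO C, AA = TA C, Mas = As C, Mun = Lu C,
     RO = TO C, RA = TA C, Ras = As C, Run = Ru C, Mdl = As C\<rparr>"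

text \<open>
  \<open>Rex(M)\<close> as a bimodule category: \<open>(X \<rhd> F) P = X \<rhd> F P\<close> and \<open>(F \<lhd> X) P = F (X \<rhd> P)\<close>. As
  \<open>(F \<lhd> X) \<lhd> Y\<close> sends \<open>P\<close> to \<open>F (X \<rhd> (Y \<rhd> P))\<close>, the right associativity constraint involves the
  inverse of \<open>Mas M\<close>. Both sides of \<open>Mdl\<close> are the same functor.
\<close>

definition Rex_bimod :: "('c, 'f, 'y) moncat_scheme \<Rightarrow> ('c, 'f, 'o, 'a, 'z) modcat_scheme \<Rightarrow>
    ('k::field, 'o, 'a) lin \<Rightarrow> ('c, 'f, ('o, 'a) endo, ('o, 'a) endo_arr) bimodcat" where
  "Rex_bimod C M LM = (let
     R = Rex M LM;
     lact = (\<lambda>X F. fcomp M (act_functor C M X) F);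
     ract = (\<lambda>F X. fcomp M F (act_functor C M X))
   in \<lparr>
     Obj = Obj R, Arr = Arr R, Dom = Dom R, Cod = Cod R, Ide = Ide R, Cmp = Cmp R,
     AO = lact,
     AA = (\<lambda>f (F, G, \<eta>). (lact (Dom C f) F, lact (Cod C f) G, \<lambda>P\<in>Obj M. f \<rhd>\<^sub>a\<^bsub>M\<^esub> \<eta> P)),
     Mas = (\<lambda>X Y F. (lact (X \<otimes>\<^sub>o\<^bsub>C\<^esub> Y) F, lact X (lact Y F), \<lambda>P\<in>Obj M. Mas M X Y (FO F P))),
     Mun = (\<lambda>F. (lact (Unt C) F, F, \<lambda>P\<in>Obj M. Mun M (FO F P))),
     RO = ract,
     RA = (\<lambda>(F, G, \<eta>) f. (ract F (Dom C f), ract G (Cod C f),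
            \<lambda>P\<in>Obj M. FA G (f \<rhd>\<^sub>a\<^bsub>M\<^esub> Ide M P) \<cdot>\<^bsub>M\<^esub> \<eta> (Dom C f \<rhd>\<^sub>o\<^bsub>M\<^esub> P))),
     Ras = (\<lambda>F X Y. (ract (ract F X) Y, ract F (X \<otimes>\<^sub>o\<^bsub>C\<^esub> Y),
            \<lambda>P\<in>Obj M. FA F (inv_arr M (Mas M X Y P)))),
     Run = (\<lambda>F. (ract F (Unt C), F, \<lambda>P\<in>Obj M. FA F (Mun M P))),
     Mdl = (\<lambda>X F Y. (ract (lact X F) Y, lact X (ract F Y),
            \<lambda>P\<in>Obj M. Ide M (X \<rhd>\<^sub>o\<^bsub>M\<^esub> FO F (Y \<rhd>\<^sub>o\<^bsub>M\<^esub> P))))\<rparr>)"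

text \<open>
  The action functor \<open>\<rho> : C \<rightarrow> Rex(M)\<close>. Its bimodule structures \<open>X \<rhd> \<rho> Y \<rightarrow> \<rho> (X \<otimes> Y)\<close> and
  \<open>\<rho> Y \<lhd> X \<rightarrow> \<rho> (Y \<otimes> X)\<close> are given by the inverse associativity constraint of \<open>M\<close>.
\<close>

definition rho :: "('c, 'f, 'y) moncat_scheme \<Rightarrow> ('c, 'f, 'o, 'a, 'z) modcat_scheme \<Rightarrow>
    ('k::field, 'o, 'a) lin \<Rightarrow> ('c, 'c, 'f, ('o, 'a) endo, ('o, 'a) endo_arr) bifunc" where
  "rho C M LM = (let B = Rex_bimod C M LM; r = act_functor C M in \<lparr>
     FO = r,
     FA = (\<lambda>f. (r (Dom C f), r (Cod C f), \<lambda>P\<in>Obj M. f \<rhd>\<^sub>a\<^bsub>M\<^esub> Ide M P)),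
     LS = (\<lambda>(X, Y). (X \<rhd>\<^sub>o\<^bsub>B\<^esub> r Y, r (X \<otimes>\<^sub>o\<^bsub>C\<^esub> Y), \<lambda>P\<in>Obj M. inv_arr M (Mas M X Y P))),
     RS = (\<lambda>(Y, X). (r Y \<lhd>\<^sub>o\<^bsub>B\<^esub> X, r (Y \<otimes>\<^sub>o\<^bsub>C\<^esub> X), \<lambda>P\<in>Obj M. inv_arr M (Mas M Y X P)))\<rparr>)"

text \<open>
  \<open>R\<close> with unit \<open>\<eta>\<close> and counit \<open>\<epsilon>\<close> is a right adjoint of the action functor, equipped with the
  bimodule structure \<open>\<xi>\<^sup>(\<^sup>l\<^sup>) = LS R\<close>, \<open>\<xi>\<^sup>(\<^sup>r\<^sup>) = RS R\<close> for which \<open>\<eta>\<close> and \<open>\<epsilon>\<close> are bimodule transformations.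
\<close>

locale rho_right_adjoint =
  adjunction C "Rex M LM" "rho C M LM" R \<eta> \<epsilon> +
  bimodule_functor C "Rex_bimod C M LM" "regular_bimod C" R
  for C :: "('c, 'f, 'y) moncat_scheme" and M :: "('c, 'f, 'o, 'a, 'z) modcat_scheme"
    and LM :: "('k::field, 'o, 'a) lin"
    and R :: "('c, ('o, 'a) endo, ('o, 'a) endo_arr, 'c, 'f) bifunc"
    and \<eta> :: "'c \<Rightarrow> 'f" and \<epsilon> :: "('o, 'a) endo \<Rightarrow> ('o, 'a) endo_arr" +
  assumes unit_bimodule: "bimodule_trans C (regular_bimod C) (regular_bimod C)
        (bifid C (regular_bimod C))
        (bifcomp C (regular_bimod C) (regular_bimod C) R (rho C M LM)) \<eta>"
    and counit_bimodule: "bimodule_trans C (Rex_bimod C M LM) (Rex_bimod C M LM)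
        (bifcomp C (Rex_bimod C M LM) (Rex_bimod C M LM) (rho C M LM) R)
        (bifid C (Rex_bimod C M LM)) \<epsilon>"


section \<open>The functor \<open>Z(\<rho>\<^sup>r\<^sup>a)\<close>\<close>

text \<open>\<open>\<sigma>\<^sub>X = (\<xi>\<^sup>(\<^sup>l\<^sup>))\<^sup>-\<^sup>1 \<cdot> R (s\<^sub>X\<^sup>-\<^sup>1) \<cdot> \<xi>\<^sup>(\<^sup>r\<^sup>)\<close>, where \<open>s\<^sub>X\<^sup>-\<^sup>1 : F \<lhd> X \<rightarrow> X \<rhd> F\<close> is an arrow of \<open>Rex(M)\<close>.\<close>

definition Z_ra_obj :: "('c, 'f, 'y) moncat_scheme \<Rightarrow> ('c, 'f, 'o, 'a, 'z) modcat_scheme \<Rightarrow>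
    ('k::field, 'o, 'a) lin \<Rightarrow> ('c, ('o, 'a) endo, ('o, 'a) endo_arr, 'c, 'f) bifunc \<Rightarrow>
    ('c, 'o, 'a) mendo \<Rightarrow> ('c, 'f) cobj" where
  "Z_ra_obj C M LM R = (\<lambda>(F, s). (let B = Rex_bimod C M LM in
     (FO R F, \<lambda>X\<in>Obj C.
        inv_arr C (LS R (X, F)) \<cdot>\<^bsub>C\<^esub>
        FA R (F \<lhd>\<^sub>o\<^bsub>B\<^esub> X, X \<rhd>\<^sub>o\<^bsub>B\<^esub> F, \<lambda>P\<in>Obj M. inv_arr M (s (X, P))) \<cdot>\<^bsub>C\<^esub>
        RS R (F, X))))"

definition Z_ra :: "('c, 'f, 'y) moncat_scheme \<Rightarrow> ('c, 'f, 'o, 'a, 'z) modcat_scheme \<Rightarrow>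
    ('k::field, 'o, 'a) lin \<Rightarrow> ('c, ('o, 'a) endo, ('o, 'a) endo_arr, 'c, 'f) bifunc \<Rightarrow>
    (('c, 'o, 'a) mendo, ('c, 'o, 'a) mendo_arr, ('c, 'f) cobj, ('c, 'f) carr) func" where
  "Z_ra C M LM R = \<lparr>
     FO = Z_ra_obj C M LM R,
     FA = (\<lambda>(F, G, \<eta>). (Z_ra_obj C M LM R F, Z_ra_obj C M LM R G, FA R (fst F, fst G, \<eta>)))\<rparr>"

end

theory Submission
  imports Defs
begin

text \<open>
  On underlying objects and arrows, Schauenburg's functor followed by the forgetful functor is the
  action functor \<open>\<rho>\<close>, and \<open>Z(\<rho>\<^sup>r\<^sup>a)\<close> is its right adjoint \<open>R = \<rho>\<^sup>r\<^sup>a\<close>. The adjunction is therefore the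
  given one, with unit \<open>\<eta>\<close> and counit \<open>\<epsilon>\<close>, as soon as these respect the additional structure: \<open>\<eta>\<^sub>V\<close>
  has to commute with half-braidings (\<open>unit_central\<close>) and \<open>\<epsilon>\<^sub>F\<close> has to be a module transformation
  (\<open>counit_module_trans\<close>). Both hold because \<open>\<eta>\<close> and \<open>\<epsilon>\<close> are bimodule transformations.

  To see this, write \<open>\<xi>\<^sup>l\<close> and \<open>\<xi>\<^sup>r\<close> for the left and right bimodule structures of \<open>R\<close>, write \<open>\<rho>\<^sup>l\<close> and
  \<open>\<rho>\<^sup>r\<close> for those of \<open>\<rho>\<close>, and read a module structure \<open>s\<close> on \<open>F\<close> as a family of isomorphisms
  \<open>s\<^sub>X : X \<rhd> F \<rightarrow> F \<lhd> X\<close> of the bimodule category \<open>Rex(M)\<close>. The half-braiding \<open>\<sigma>\<close> that \<open>Z(\<rho>\<^sup>r\<^sup>a)\<close> puts on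
  \<open>R F\<close> is determined by \<open>\<xi>\<^sup>l \<cdot> \<sigma>\<^sub>X = R (s\<^sub>X\<^sup>-\<^sup>1) \<cdot> \<xi>\<^sup>r\<close>, and the module structure \<open>s\<close> that Schauenburg's
  functor puts on \<open>\<rho> V\<close> by \<open>\<rho>\<^sup>l \<cdot> s\<^sub>X\<^sup>-\<^sup>1 = \<rho> \<sigma>\<^sub>X \<cdot> \<rho>\<^sup>r\<close>. For the unit,
  \<open>R \<rho>\<^sup>l \<cdot> \<xi>\<^sup>l \<cdot> (1 \<otimes> \<eta>\<^sub>V) \<cdot> \<sigma>\<^sub>X = \<eta> \<cdot> \<sigma>\<^sub>X = R (\<rho> \<sigma>\<^sub>X) \<cdot> \<eta> = R (\<rho> \<sigma>\<^sub>X) \<cdot> R \<rho>\<^sup>r \<cdot> \<xi>\<^sup>r \<cdot> (\<eta>\<^sub>V \<otimes> 1)\<close>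
  and the right-hand side is \<open>R \<rho>\<^sup>l \<cdot> R (s\<^sub>X\<^sup>-\<^sup>1) \<cdot> \<xi>\<^sup>r \<cdot> (\<eta>\<^sub>V \<otimes> 1)\<close>; cancelling \<open>R \<rho>\<^sup>l \<cdot> \<xi>\<^sup>l\<close> gives the
  claim. The counit is treated in the same way in \<open>Rex(M)\<close>.

  Beyond this, the two functors must exist. For Schauenburg's functor (\<open>cat_functor_theta\<close>) the axioms
  of a half-braiding on \<open>V\<close> become the axioms of a module functor \<open>V \<rhd> -\<close>, and the axioms of module
  functors and module transformations become those of a half-braiding on \<open>V \<rhd> -\<close>. For \<open>Z(\<rho>\<^sup>r\<^sup>a)\<close>
  (\<open>cat_functor_Z_ra\<close>) the axioms of a module functor amount to a hexagon in \<open>Rex(M)\<close>, which the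
  bimodule functor \<open>R\<close> carries to \<open>C\<close> (\<open>half_braiding_Z_ra\<close>).
\<close>

section \<open>Calculating in a category\<close>

context category
begin

lemma arr_Hom: "f \<in> Arr C \<Longrightarrow> f \<in> Hom C (Dom C f) (Cod C f)"
  by (simp add: Hom_def)

lemma Ide_arr [simp]:
  "X \<in> Obj C \<Longrightarrow> Ide C X \<in> Arr C"
  "X \<in> Obj C \<Longrightarrow> Dom C (Ide C X) = X"
  "X \<in> Obj C \<Longrightarrow> Cod C (Ide C X) = X"
  using Ide_hom by (auto simp: Hom_def)

lemma Dom_Cod_obj [simp]:
  "f \<in> Arr C \<Longrightarrow> Dom C f \<in> Obj C"
  "f \<in> Arr C \<Longrightarrow> Cod C f \<in> Obj C"
  by (rule Dom_obj Cod_obj; assumption)+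

lemma Cmp_arr [simp]:
  assumes "f \<in> Arr C" "g \<in> Arr C" "Dom C g = Cod C f"
  shows "g \<cdot> f \<in> Arr C" "Dom C (g \<cdot> f) = Dom C f" "Cod C (g \<cdot> f) = Cod C g"
  using Cmp_hom[of f "Dom C f" "Cod C f" g "Cod C g"] assms by (auto simp: Hom_def)

lemma Cmp_Ide [simp]:
  "\<lbrakk>f \<in> Arr C; Cod C f = Y\<rbrakk> \<Longrightarrow> Ide C Y \<cdot> f = f"
  "\<lbrakk>f \<in> Arr C; Dom C f = X\<rbrakk> \<Longrightarrow> f \<cdot> Ide C X = f"
  using Ide_left Ide_right by (auto simp: Hom_def)

lemma assoc [simp]:
  "\<lbrakk>f \<in> Arr C; g \<in> Arr C; h \<in> Arr C; Dom C g = Cod C f; Dom C h = Cod C g\<rbrakk>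
    \<Longrightarrow> (h \<cdot> g) \<cdot> f = h \<cdot> (g \<cdot> f)"
  by (rule Cmp_assoc) (auto simp: Hom_def)

text \<open>
  The simplifier nests composites to the right, and a law about \<open>g \<cdot> f\<close> then no longer matches inside
  a longer composite. Instances of this rule (and of its variant for three factors) make it match.
\<close>

lemma reassoc:
  "\<lbrakk>g \<cdot> f = h; f \<in> Arr C; g \<in> Arr C; Dom C g = Cod C f; k \<in> Arr C; Cod C k = Dom C f\<rbrakk>
    \<Longrightarrow> g \<cdot> (f \<cdot> k) = h \<cdot> k"
  using assoc[of k f g] by simp

lemma reassoc3:
  "\<lbrakk>g \<cdot> (f \<cdot> e) = h; e \<in> Arr C; f \<in> Arr C; g \<in> Arr C; Dom C g = Cod C f; Dom C f = Cod C e;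
    k \<in> Arr C; Cod C k = Dom C e\<rbrakk> \<Longrightarrow> g \<cdot> (f \<cdot> (e \<cdot> k)) = h \<cdot> k"
  using reassoc[of g "f \<cdot> e" h k] by simp

lemma inverse_arrows_unique: "\<lbrakk>inverse_arrows C f g; inverse_arrows C f h\<rbrakk> \<Longrightarrow> g = h"
  unfolding inverse_arrows_def Hom_def
  by (metis (mono_tags, lifting) Cmp_Ide assoc mem_Collect_eq)

lemma inv_arr_eqI: "inverse_arrows C f g \<Longrightarrow> inv_arr C f = g"
  unfolding inv_arr_def using inverse_arrows_unique by blast

lemma inverse_arrows_inv_arr: "is_iso C f \<Longrightarrow> inverse_arrows C f (inv_arr C f)"
  unfolding is_iso_def using inv_arr_eqI by blast

lemma inverse_arrowsI:
  "\<lbrakk>f \<in> Arr C; g \<in> Arr C; Dom C g = Cod C f; Cod C g = Dom C f;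
    g \<cdot> f = Ide C (Dom C f); f \<cdot> g = Ide C (Cod C f)\<rbrakk> \<Longrightarrow> inverse_arrows C f g"
  by (simp add: inverse_arrows_def Hom_def)

lemma is_iso_arr: "is_iso C f \<Longrightarrow> f \<in> Arr C"
  by (auto simp: is_iso_def inverse_arrows_def)

lemma inv_arr [simp]:
  assumes "is_iso C f"
  shows "inv_arr C f \<in> Arr C" "Dom C (inv_arr C f) = Cod C f" "Cod C (inv_arr C f) = Dom C f"
    "inv_arr C f \<cdot> f = Ide C (Dom C f)" "f \<cdot> inv_arr C f = Ide C (Cod C f)"
  using inverse_arrows_inv_arr[OF assms] by (auto simp: inverse_arrows_def Hom_def)

lemma inv_arr_cancel [simp]:
  assumes "is_iso C f" and "k \<in> Arr C"
  shows "Cod C k = Dom C f \<Longrightarrow> inv_arr C f \<cdot> (f \<cdot> k) = k"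
    and "Cod C k = Cod C f \<Longrightarrow> f \<cdot> (inv_arr C f \<cdot> k) = k"
  using assms is_iso_arr[OF assms(1)] by (simp_all flip: assoc)

lemma inverse_arrows_iso:
  "inverse_arrows C f g \<Longrightarrow> is_iso C f"
  "inverse_arrows C f g \<Longrightarrow> is_iso C g"
  by (auto simp: is_iso_def inverse_arrows_def Hom_def)

lemma is_iso_inv [simp]: "is_iso C f \<Longrightarrow> is_iso C (inv_arr C f)"
  using inverse_arrows_inv_arr inverse_arrows_iso(2) by blast

lemma inv_arr_inv [simp]: "is_iso C f \<Longrightarrow> inv_arr C (inv_arr C f) = f"
  by (rule inv_arr_eqI, rule inverse_arrowsI) (auto simp: is_iso_arr)

lemma inverse_arrows_Cmp:
  "\<lbrakk>is_iso C f; is_iso C g; Dom C g = Cod C f\<rbrakk>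
    \<Longrightarrow> inverse_arrows C (g \<cdot> f) (inv_arr C f \<cdot> inv_arr C g)"
  by (rule inverse_arrowsI) (simp_all add: is_iso_arr)

lemma iso_Cmp [simp]:
  "\<lbrakk>is_iso C f; is_iso C g; Dom C g = Cod C f\<rbrakk> \<Longrightarrow> is_iso C (g \<cdot> f)"
  "\<lbrakk>is_iso C f; is_iso C g; Dom C g = Cod C f\<rbrakk>
    \<Longrightarrow> inv_arr C (g \<cdot> f) = inv_arr C f \<cdot> inv_arr C g"
  using inverse_arrows_Cmp inverse_arrows_iso(1) inv_arr_eqI by blast+

lemma iso_Ide [simp]:
  assumes "X \<in> Obj C"
  shows "is_iso C (Ide C X)" "inv_arr C (Ide C X) = Ide C X"
proof -
  have "inverse_arrows C (Ide C X) (Ide C X)"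
    using assms by (intro inverse_arrowsI) auto
  then show "is_iso C (Ide C X)" "inv_arr C (Ide C X) = Ide C X"
    using inverse_arrows_iso inv_arr_eqI by blast+
qed

lemma iso_cancel_right:
  assumes "f \<cdot> e = g \<cdot> e" "is_iso C e" "f \<in> Arr C" "g \<in> Arr C" "Dom C f = Cod C e" "Dom C g = Cod C e"
  shows "f = g"
proof -
  have "(f \<cdot> e) \<cdot> inv_arr C e = (g \<cdot> e) \<cdot> inv_arr C e" using assms(1) by simp
  then show ?thesis using assms(2-) is_iso_arr[OF assms(2)] by simp
qed

lemma iso_cancel_left:
  assumes "e \<cdot> f = e \<cdot> g" "is_iso C e" "f \<in> Arr C" "g \<in> Arr C" "Cod C f = Dom C e" "Cod C g = Dom C e"
  shows "f = g"
  using assms by (metis inv_arr_cancel(1))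

text \<open>
  Half-braidings and module structures are isomorphisms that occur in both directions; their
  compatibility squares are passed from one direction to the other by this rule.
\<close>

lemma iso_square_inv:
  assumes "b \<cdot> f = g \<cdot> a" "is_iso C a" "is_iso C b" "f \<in> Arr C" "g \<in> Arr C"
    "Dom C f = Dom C a" "Cod C f = Dom C b" "Dom C g = Cod C a" "Cod C g = Cod C b"
  shows "f \<cdot> inv_arr C a = inv_arr C b \<cdot> g"
proof (rule iso_cancel_left[of b])
  show "b \<cdot> (f \<cdot> inv_arr C a) = b \<cdot> (inv_arr C b \<cdot> g)"
    using assms(2-) is_iso_arr[OF assms(2)] is_iso_arr[OF assms(3)] by (simp add: reassoc[OF assms(1)])
qed (use assms is_iso_arr[OF assms(2)] in auto)

end

context cat_functor
begin

lemma FO_in [simp]: "X \<in> Obj A \<Longrightarrow> FO F X \<in> Obj B"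
  by (rule FO_obj)

lemma FA_arr [simp]:
  assumes "f \<in> Arr A"
  shows "FA F f \<in> Arr B" "Dom B (FA F f) = FO F (Dom A f)" "Cod B (FA F f) = FO F (Cod A f)"
  using FA_hom[of f "Dom A f" "Cod A f"] assms by (auto simp: Hom_def)

lemma FA_Ide' [simp]: "X \<in> Obj A \<Longrightarrow> FA F (Ide A X) = Ide B (FO F X)"
  by (rule FA_Ide)

lemma FA_Cmp' [simp]:
  "\<lbrakk>f \<in> Arr A; g \<in> Arr A; Dom A g = Cod A f\<rbrakk> \<Longrightarrow> FA F (g \<cdot>\<^bsub>A\<^esub> f) = FA F g \<cdot>\<^bsub>B\<^esub> FA F f"
  by (rule FA_Cmp) (auto simp: Hom_def)

lemma FA_iso [simp]:
  assumes "is_iso A f"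
  shows "is_iso B (FA F f)" "inv_arr B (FA F f) = FA F (inv_arr A f)"
proof -
  have f: "f \<in> Arr A" by (rule A.is_iso_arr[OF assms])
  have "inverse_arrows B (FA F f) (FA F (inv_arr A f))"
  proof (rule B.inverse_arrowsI)
    have "FA F (inv_arr A f) \<cdot>\<^bsub>B\<^esub> FA F f = FA F (inv_arr A f \<cdot>\<^bsub>A\<^esub> f)"
      using f assms by (simp del: A.inv_arr(4))
    then show "FA F (inv_arr A f) \<cdot>\<^bsub>B\<^esub> FA F f = Ide B (Dom B (FA F f))" using f assms by simp
    have "FA F f \<cdot>\<^bsub>B\<^esub> FA F (inv_arr A f) = FA F (f \<cdot>\<^bsub>A\<^esub> inv_arr A f)"
      using f assms by (simp del: A.inv_arr(5))
    then show "FA F f \<cdot>\<^bsub>B\<^esub> FA F (inv_arr A f) = Ide B (Cod B (FA F f))" using f assms by simp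
  qed (use f assms in auto)
  then show "is_iso B (FA F f)" "inv_arr B (FA F f) = FA F (inv_arr A f)"
    using B.inverse_arrows_iso(1) B.inv_arr_eqI by blast+
qed

end

context nat_trans
begin

lemma component_arr [simp]:
  assumes "X \<in> Obj A"
  shows "\<eta> X \<in> Arr B" "Dom B (\<eta> X) = FO F X" "Cod B (\<eta> X) = FO G X"
  using component[OF assms] by (auto simp: Hom_def)

lemma natural':
  "\<lbrakk>f \<in> Arr A; Dom A f = X; Cod A f = Y\<rbrakk> \<Longrightarrow> \<eta> Y \<cdot>\<^bsub>B\<^esub> FA F f = FA G f \<cdot>\<^bsub>B\<^esub> \<eta> X"
  by (rule natural) (auto simp: Hom_def)

end

lemma fid_simps [simp]:
  "X \<in> Obj A \<Longrightarrow> FO (fid A) X = X" "f \<in> Arr A \<Longrightarrow> FA (fid A) f = f"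
  by (simp_all add: fid_def)

lemma fcomp_simps [simp]:
  "X \<in> Obj A \<Longrightarrow> FO (fcomp A G F) X = FO G (FO F X)"
  "f \<in> Arr A \<Longrightarrow> FA (fcomp A G F) f = FA G (FA F f)"
  by (simp_all add: fcomp_def)

lemma cat_functor_fid: "category A \<Longrightarrow> cat_functor A A (fid A)"
proof -
  assume "category A"
  then interpret category A .
  show ?thesis by unfold_locales (auto simp: Hom_def)
qed

lemma cat_functor_fcomp:
  assumes "cat_functor A B F" "cat_functor B D G"
  shows "cat_functor A D (fcomp A G F)"
proof -
  interpret F: cat_functor A B F by fact
  interpret G: cat_functor B D G by fact
  show ?thesis by unfold_locales (auto simp: Hom_def)
qed

section \<open>Categories with a tensor product functor\<close>

text \<open>
  Central arrows compose because the tensor product is functorial. This locale isolates that part of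
  the structure; monoidal categories and the dual category share it.
\<close>

locale tensor_category = category D for D :: "('o, 'a, 'z) moncat_scheme" (structure) +
  assumes tensor_obj [simp]: "\<lbrakk>X \<in> Obj D; Y \<in> Obj D\<rbrakk> \<Longrightarrow> X \<otimes>\<^sub>o Y \<in> Obj D"
    and tensor_hom: "\<lbrakk>f \<in> Hom D X X'; g \<in> Hom D Y Y'\<rbrakk> \<Longrightarrow> f \<otimes>\<^sub>a g \<in> Hom D (X \<otimes>\<^sub>o Y) (X' \<otimes>\<^sub>o Y')"
    and tensor_Ide [simp]: "\<lbrakk>X \<in> Obj D; Y \<in> Obj D\<rbrakk> \<Longrightarrow> Ide D X \<otimes>\<^sub>a Ide D Y = Ide D (X \<otimes>\<^sub>o Y)"
    and tensor_Cmp: "\<lbrakk>f \<in> Hom D X X'; f' \<in> Hom D X' X''; g \<in> Hom D Y Y'; g' \<in> Hom D Y' Y''\<rbrakk>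
          \<Longrightarrow> (f' \<cdot> f) \<otimes>\<^sub>a (g' \<cdot> g) = (f' \<otimes>\<^sub>a g') \<cdot> (f \<otimes>\<^sub>a g)"
begin

lemma tensor_arr [simp]:
  assumes "f \<in> Arr D" "g \<in> Arr D"
  shows "f \<otimes>\<^sub>a g \<in> Arr D" "Dom D (f \<otimes>\<^sub>a g) = Dom D f \<otimes>\<^sub>o Dom D g"
    "Cod D (f \<otimes>\<^sub>a g) = Cod D f \<otimes>\<^sub>o Cod D g"
  using tensor_hom[OF arr_Hom[OF assms(1)] arr_Hom[OF assms(2)]] by (auto simp: Hom_def)

lemma tensor_merge:
  "\<lbrakk>f \<in> Arr D; f' \<in> Arr D; g \<in> Arr D; g' \<in> Arr D; Dom D f' = Cod D f; Dom D g' = Cod D g\<rbrakk>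
    \<Longrightarrow> (f' \<otimes>\<^sub>a g') \<cdot> (f \<otimes>\<^sub>a g) = (f' \<cdot> f) \<otimes>\<^sub>a (g' \<cdot> g)"
  by (rule tensor_Cmp[symmetric]) (auto simp: Hom_def)

lemma tensor_merge_assoc:
  "\<lbrakk>f \<in> Arr D; f' \<in> Arr D; g \<in> Arr D; g' \<in> Arr D; Dom D f' = Cod D f; Dom D g' = Cod D g;
    k \<in> Arr D; Cod D k = Dom D f \<otimes>\<^sub>o Dom D g\<rbrakk>
    \<Longrightarrow> (f' \<otimes>\<^sub>a g') \<cdot> ((f \<otimes>\<^sub>a g) \<cdot> k) = ((f' \<cdot> f) \<otimes>\<^sub>a (g' \<cdot> g)) \<cdot> k"
  by (rule reassoc[OF tensor_merge]) auto

lemma tensor_iso [simp]: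
  assumes "is_iso D f" "is_iso D g"
  shows "is_iso D (f \<otimes>\<^sub>a g)" "inv_arr D (f \<otimes>\<^sub>a g) = inv_arr D f \<otimes>\<^sub>a inv_arr D g"
proof -
  have "inverse_arrows D (f \<otimes>\<^sub>a g) (inv_arr D f \<otimes>\<^sub>a inv_arr D g)"
    using assms is_iso_arr[OF assms(1)] is_iso_arr[OF assms(2)]
    by (intro inverse_arrowsI) (simp_all add: tensor_merge)
  then show "is_iso D (f \<otimes>\<^sub>a g)" "inv_arr D (f \<otimes>\<^sub>a g) = inv_arr D f \<otimes>\<^sub>a inv_arr D g"
    using inverse_arrows_iso(1) inv_arr_eqI by blast+
qed

end

sublocale monoidal_category \<subseteq> tensor_category C
  by unfold_locales (fact TO_obj TA_hom TA_Ide TA_Cmp)+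

context monoidal_category
begin

lemma Unt_in [simp]: "Unt C \<in> Obj C"
  by (rule Unt_obj)

lemma As_arr [simp]:
  assumes "X \<in> Obj C" "Y \<in> Obj C" "Z \<in> Obj C"
  shows "As C X Y Z \<in> Arr C" "Dom C (As C X Y Z) = (X \<otimes>\<^sub>o Y) \<otimes>\<^sub>o Z"
    "Cod C (As C X Y Z) = X \<otimes>\<^sub>o (Y \<otimes>\<^sub>o Z)" "is_iso C (As C X Y Z)"
  using As_hom[OF assms] As_iso[OF assms] by (auto simp: Hom_def)

lemma unitor_arr [simp]:
  assumes "X \<in> Obj C"
  shows "Lu C X \<in> Arr C" "Dom C (Lu C X) = Unt C \<otimes>\<^sub>o X" "Cod C (Lu C X) = X" "is_iso C (Lu C X)"
    "Ru C X \<in> Arr C" "Dom C (Ru C X) = X \<otimes>\<^sub>o Unt C" "Cod C (Ru C X) = X" "is_iso C (Ru C X)"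
  using Lu_hom[OF assms] Ru_hom[OF assms] Lu_iso[OF assms] Ru_iso[OF assms] by (auto simp: Hom_def)

end

section \<open>The Drinfeld center\<close>

lemma center_simps [simp]:
  "Dom (center D) t = fst t" "Cod (center D) t = fst (snd t)"
  "Ide (center D) A = (A, A, Ide D (fst A))"
  "Cmp (center D) (B', E, g) (A, B, f) = (A, E, g \<cdot>\<^bsub>D\<^esub> f)"
  "(V, \<sigma>) \<in> Obj (center D) \<longleftrightarrow> half_braiding D V \<sigma>"
  by (auto simp: center_def split: prod.splits)

lemma center_arr_iff:
  "((V, \<sigma>), (W, \<tau>), f) \<in> Arr (center D) \<longleftrightarrow>
     half_braiding D V \<sigma> \<and> half_braiding D W \<tau> \<and> f \<in> Hom D V W \<and>
       (\<forall>X\<in>Obj D. (Ide D X \<otimes>\<^sub>a\<^bsub>D\<^esub> f) \<cdot>\<^bsub>D\<^esub> \<sigma> X = \<tau> X \<cdot>\<^bsub>D\<^esub> (f \<otimes>\<^sub>a\<^bsub>D\<^esub> Ide D X))"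
  by (auto simp: center_def)

lemma half_braidingD:
  assumes "half_braiding D V \<sigma>"
  shows "f \<in> Hom D X Y \<Longrightarrow> \<sigma> Y \<cdot>\<^bsub>D\<^esub> (Ide D V \<otimes>\<^sub>a\<^bsub>D\<^esub> f) = (f \<otimes>\<^sub>a\<^bsub>D\<^esub> Ide D V) \<cdot>\<^bsub>D\<^esub> \<sigma> X"
    and "Lu D V \<cdot>\<^bsub>D\<^esub> \<sigma> (Unt D) = Ru D V"
    and "\<lbrakk>X \<in> Obj D; Y \<in> Obj D\<rbrakk> \<Longrightarrow>
        As D X Y V \<cdot>\<^bsub>D\<^esub> \<sigma> (X \<otimes>\<^sub>o\<^bsub>D\<^esub> Y) \<cdot>\<^bsub>D\<^esub> As D V X Y =
        (Ide D X \<otimes>\<^sub>a\<^bsub>D\<^esub> \<sigma> Y) \<cdot>\<^bsub>D\<^esub> As D X V Y \<cdot>\<^bsub>D\<^esub> (\<sigma> X \<otimes>\<^sub>a\<^bsub>D\<^esub> Ide D Y)"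
  using assms by (auto simp: half_braiding_def)

context tensor_category
begin

lemma half_braiding_arr:
  assumes "half_braiding D V \<sigma>"
  shows "V \<in> Obj D"
    and "X \<in> Obj D \<Longrightarrow> \<sigma> X \<in> Arr D" "X \<in> Obj D \<Longrightarrow> Dom D (\<sigma> X) = V \<otimes>\<^sub>o X"
    "X \<in> Obj D \<Longrightarrow> Cod D (\<sigma> X) = X \<otimes>\<^sub>o V" "X \<in> Obj D \<Longrightarrow> is_iso D (\<sigma> X)"
  using assms by (auto simp: half_braiding_def Hom_def)

lemma center_arr_Cmp:
  assumes f: "((V, \<sigma>), (W, \<tau>), f) \<in> Arr (center D)"
    and g: "((W, \<tau>), (U, \<upsilon>), g) \<in> Arr (center D)"
  shows "((V, \<sigma>), (U, \<upsilon>), g \<cdot> f) \<in> Arr (center D)"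
proof -
  have hb: "half_braiding D V \<sigma>" "half_braiding D W \<tau>" "half_braiding D U \<upsilon>"
    using f g by (auto simp: center_arr_iff)
  note [simp] = hb[THEN half_braiding_arr(1)] hb[THEN half_braiding_arr(2)]
    hb[THEN half_braiding_arr(3)] hb[THEN half_braiding_arr(4)]
  have [simp]: "f \<in> Arr D" "Dom D f = V" "Cod D f = W" "g \<in> Arr D" "Dom D g = W" "Cod D g = U"
    using f g by (auto simp: center_arr_iff Hom_def)
  have "(Ide D X \<otimes>\<^sub>a (g \<cdot> f)) \<cdot> \<sigma> X = \<upsilon> X \<cdot> ((g \<cdot> f) \<otimes>\<^sub>a Ide D X)" if [simp]: "X \<in> Obj D" for X
  proof -
    have f': "(Ide D X \<otimes>\<^sub>a f) \<cdot> \<sigma> X = \<tau> X \<cdot> (f \<otimes>\<^sub>a Ide D X)"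
      and g': "(Ide D X \<otimes>\<^sub>a g) \<cdot> \<tau> X = \<upsilon> X \<cdot> (g \<otimes>\<^sub>a Ide D X)"
      using f g by (auto simp: center_arr_iff)
    have "(Ide D X \<otimes>\<^sub>a (g \<cdot> f)) \<cdot> \<sigma> X = (Ide D X \<otimes>\<^sub>a g) \<cdot> (Ide D X \<otimes>\<^sub>a f) \<cdot> \<sigma> X"
      by (simp add: tensor_merge_assoc)
    also have "\<dots> = \<upsilon> X \<cdot> (g \<otimes>\<^sub>a Ide D X) \<cdot> (f \<otimes>\<^sub>a Ide D X)"
      by (simp add: f' reassoc[OF g'])
    finally show ?thesis by (simp add: tensor_merge)
  qed
  then show ?thesis using hb by (simp add: center_arr_iff Hom_def)
qed

lemma category_center: "category (center D)"
proof
  show "Dom (center D) f \<in> Obj (center D)" "Cod (center D) f \<in> Obj (center D)"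
    if "f \<in> Arr (center D)" for f
    using that by (auto simp: center_def)
next
  fix X assume "X \<in> Obj (center D)"
  then obtain V \<sigma> where X: "X = (V, \<sigma>)" and hb: "half_braiding D V \<sigma>" by (cases X) auto
  note [simp] = half_braiding_arr[OF hb]
  show "Ide (center D) X \<in> Hom (center D) X X"
    using hb by (simp add: X Hom_def center_arr_iff)
next
  fix f g X Y Z assume f: "f \<in> Hom (center D) X Y" and g: "g \<in> Hom (center D) Y Z"
  then show "Cmp (center D) g f \<in> Hom (center D) X Z"
    by (cases X; cases Y; cases Z; cases f; cases g) (auto simp: Hom_def intro: center_arr_Cmp)
next
  fix f X Y assume "f \<in> Hom (center D) X Y"
  then show "Cmp (center D) (Ide (center D) Y) f = f" "Cmp (center D) f (Ide (center D) X) = f"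
    by (cases X; cases Y; cases f; simp add: Hom_def center_arr_iff; auto)+
next
  fix f g h W X Y Z
  assume "f \<in> Hom (center D) W X" "g \<in> Hom (center D) X Y" "h \<in> Hom (center D) Y Z"
  then show "Cmp (center D) (Cmp (center D) h g) f = Cmp (center D) h (Cmp (center D) g f)"
    by (cases W; cases X; cases Y; cases Z; cases f; cases g; cases h)
      (auto simp: Hom_def center_arr_iff)
qed

lemma cat_functor_forget: "cat_functor (center D) D forget"
proof -
  interpret Z: category "center D" by (rule category_center)
  show ?thesis
  proof
    show "FO forget A \<in> Obj D" if "A \<in> Obj (center D)" for A
      using that half_braiding_arr(1) by (cases A) (auto simp: forget_def)
    show "FA forget f \<in> Hom D (FO forget A) (FO forget B)" if "f \<in> Hom (center D) A B" for f A B
      using that by (cases A; cases B; cases f) (auto simp: forget_def Hom_def center_arr_iff)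
    show "FA forget (Ide (center D) A) = Ide D (FO forget A)" if "A \<in> Obj (center D)" for A
      by (cases A) (simp add: forget_def)
    show "FA forget (Cmp (center D) g f) = FA forget g \<cdot> FA forget f" for f g A B E
      by (cases f; cases g) (simp add: forget_def)
  qed
qed

end

section \<open>Module categories and module functors\<close>

context module_category
begin

lemma AO_in [simp]: "\<lbrakk>X \<in> Obj C; P \<in> Obj M\<rbrakk> \<Longrightarrow> X \<rhd>\<^sub>o P \<in> Obj M"
  by (rule AO_obj)

lemma AA_arr [simp]:
  assumes "f \<in> Arr C" "u \<in> Arr M"
  shows "f \<rhd>\<^sub>a u \<in> Arr M" "Dom M (f \<rhd>\<^sub>a u) = Dom C f \<rhd>\<^sub>o Dom M u"
    "Cod M (f \<rhd>\<^sub>a u) = Cod C f \<rhd>\<^sub>o Cod M u"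
  using AA_hom[OF C.arr_Hom[OF assms(1)] M.arr_Hom[OF assms(2)]] by (auto simp: Hom_def)

lemma AA_Ide' [simp]: "\<lbrakk>X \<in> Obj C; P \<in> Obj M\<rbrakk> \<Longrightarrow> Ide C X \<rhd>\<^sub>a Ide M P = Ide M (X \<rhd>\<^sub>o P)"
  by (rule AA_Ide)

lemma AA_merge:
  "\<lbrakk>f \<in> Arr C; f' \<in> Arr C; u \<in> Arr M; u' \<in> Arr M; Dom C f' = Cod C f; Dom M u' = Cod M u\<rbrakk>
    \<Longrightarrow> (f' \<rhd>\<^sub>a u') \<cdot> (f \<rhd>\<^sub>a u) = (f' \<cdot>\<^bsub>C\<^esub> f) \<rhd>\<^sub>a (u' \<cdot> u)"
  by (rule AA_Cmp[symmetric]) (auto simp: Hom_def)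

lemma AA_whisker:
  "\<lbrakk>X \<in> Obj C; u \<in> Arr M; u' \<in> Arr M; Dom M u' = Cod M u\<rbrakk>
    \<Longrightarrow> Ide C X \<rhd>\<^sub>a (u' \<cdot> u) = (Ide C X \<rhd>\<^sub>a u') \<cdot> (Ide C X \<rhd>\<^sub>a u)"
  by (simp add: AA_merge)

lemma AA_iso [simp]:
  assumes "is_iso C f" "is_iso M u"
  shows "is_iso M (f \<rhd>\<^sub>a u)" "inv_arr M (f \<rhd>\<^sub>a u) = inv_arr C f \<rhd>\<^sub>a inv_arr M u"
proof -
  have "inverse_arrows M (f \<rhd>\<^sub>a u) (inv_arr C f \<rhd>\<^sub>a inv_arr M u)"
    using assms C.is_iso_arr[OF assms(1)] M.is_iso_arr[OF assms(2)]
    by (intro M.inverse_arrowsI) (simp_all add: AA_merge)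
  then show "is_iso M (f \<rhd>\<^sub>a u)" "inv_arr M (f \<rhd>\<^sub>a u) = inv_arr C f \<rhd>\<^sub>a inv_arr M u"
    using M.inverse_arrows_iso(1) M.inv_arr_eqI by blast+
qed

lemma Mas_arr [simp]:
  assumes "X \<in> Obj C" "Y \<in> Obj C" "P \<in> Obj M"
  shows "Mas M X Y P \<in> Arr M" "Dom M (Mas M X Y P) = (X \<otimes>\<^sub>o\<^bsub>C\<^esub> Y) \<rhd>\<^sub>o P"
    "Cod M (Mas M X Y P) = X \<rhd>\<^sub>o (Y \<rhd>\<^sub>o P)" "is_iso M (Mas M X Y P)"
  using Mas_hom[OF assms] Mas_iso[OF assms] by (auto simp: Hom_def)

lemma Mas_natural':
  "\<lbrakk>f \<in> Arr C; g \<in> Arr C; u \<in> Arr M; X' = Cod C f; Y' = Cod C g; P' = Cod M u\<rbrakk>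
    \<Longrightarrow> Mas M X' Y' P' \<cdot> ((f \<otimes>\<^sub>a\<^bsub>C\<^esub> g) \<rhd>\<^sub>a u)
      = (f \<rhd>\<^sub>a (g \<rhd>\<^sub>a u)) \<cdot> Mas M (Dom C f) (Dom C g) (Dom M u)"
  by (rule Mas_natural) (auto simp: Hom_def)

lemma Mun_arr [simp]:
  assumes "P \<in> Obj M"
  shows "Mun M P \<in> Arr M" "Dom M (Mun M P) = Unt C \<rhd>\<^sub>o P" "Cod M (Mun M P) = P" "is_iso M (Mun M P)"
  using Mun_hom[OF assms] Mun_iso[OF assms] by (auto simp: Hom_def)

lemma Mun_natural':
  "\<lbrakk>u \<in> Arr M; Cod M u = Q\<rbrakk> \<Longrightarrow> Mun M Q \<cdot> (Ide C (Unt C) \<rhd>\<^sub>a u) = u \<cdot> Mun M (Dom M u)"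
  by (rule Mun_natural) (auto simp: Hom_def)

text \<open>
  Acting by the unit object is naturally isomorphic to the identity functor.
\<close>

lemma Unt_act_faithful:
  assumes "Ide C (Unt C) \<rhd>\<^sub>a u = Ide C (Unt C) \<rhd>\<^sub>a v" "u \<in> Arr M" "v \<in> Arr M"
    "Dom M u = Dom M v" "Cod M u = Cod M v"
  shows "u = v"
proof -
  have "u \<cdot> Mun M (Dom M u) = Mun M (Cod M u) \<cdot> (Ide C (Unt C) \<rhd>\<^sub>a u)"
    by (rule Mun_natural'[OF assms(2) refl, symmetric])
  also have "\<dots> = v \<cdot> Mun M (Dom M u)"
    unfolding assms(1,4,5) by (rule Mun_natural'[OF assms(3) refl])
  finally show ?thesis
    by (rule M.iso_cancel_right) (simp_all add: assms(2-5))
qed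

text \<open>
  Only one of the two triangle identities is an axiom. The other one follows by Kelly's argument:
  after acting by the unit object both sides can be compared by means of the pentagon for
  \<open>1, 1, X, P\<close>. The identity is what makes the module structure on \<open>V \<rhd> -\<close> unital.
\<close>

lemma Lu_act:
  assumes [simp]: "X \<in> Obj C" "P \<in> Obj M"
  shows "Lu C X \<rhd>\<^sub>a Ide M P = Mun M (X \<rhd>\<^sub>o P) \<cdot> Mas M (Unt C) X P"
proof (rule Unt_act_faithful)
  let ?I = "Unt C"
  let ?e = "Mas M ?I (?I \<otimes>\<^sub>o\<^bsub>C\<^esub> X) P \<cdot> (As C ?I ?I X \<rhd>\<^sub>a Ide M P)"
  have pent: "(Ide C ?I \<rhd>\<^sub>a Mas M ?I X P) \<cdot> ?e = Mas M ?I ?I (X \<rhd>\<^sub>o P) \<cdot> Mas M (?I \<otimes>\<^sub>o\<^bsub>C\<^esub> ?I) X P"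
    by (simp add: Mas_pentagon)
  have "(Ide C ?I \<rhd>\<^sub>a (Mun M (X \<rhd>\<^sub>o P) \<cdot> Mas M ?I X P)) \<cdot> ?e
      = (Ide C ?I \<rhd>\<^sub>a Mun M (X \<rhd>\<^sub>o P)) \<cdot> Mas M ?I ?I (X \<rhd>\<^sub>o P) \<cdot> Mas M (?I \<otimes>\<^sub>o\<^bsub>C\<^esub> ?I) X P"
    by (simp add: AA_whisker flip: pent)
  also have "\<dots> = (Ru C ?I \<rhd>\<^sub>a Ide M (X \<rhd>\<^sub>o P)) \<cdot> Mas M (?I \<otimes>\<^sub>o\<^bsub>C\<^esub> ?I) X P"
    by (simp add: M.reassoc[OF Mas_triangle])
  also have "\<dots> = Mas M ?I X P \<cdot> ((Ru C ?I \<otimes>\<^sub>a\<^bsub>C\<^esub> Ide C X) \<rhd>\<^sub>a Ide M P)"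
    by (simp add: Mas_natural')
  also have "\<dots> = Mas M ?I X P \<cdot> ((Ide C ?I \<otimes>\<^sub>a\<^bsub>C\<^esub> Lu C X) \<rhd>\<^sub>a Ide M P) \<cdot> (As C ?I ?I X \<rhd>\<^sub>a Ide M P)"
    by (simp add: AA_merge C.triangle)
  also have "\<dots> = (Ide C ?I \<rhd>\<^sub>a (Lu C X \<rhd>\<^sub>a Ide M P)) \<cdot> ?e"
    by (simp add: M.reassoc[OF Mas_natural'])
  finally have eq: "(Ide C ?I \<rhd>\<^sub>a (Lu C X \<rhd>\<^sub>a Ide M P)) \<cdot> ?e
      = (Ide C ?I \<rhd>\<^sub>a (Mun M (X \<rhd>\<^sub>o P) \<cdot> Mas M ?I X P)) \<cdot> ?e" ..
  show "Ide C ?I \<rhd>\<^sub>a (Lu C X \<rhd>\<^sub>a Ide M P) = Ide C ?I \<rhd>\<^sub>a (Mun M (X \<rhd>\<^sub>o P) \<cdot> Mas M ?I X P)"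
    by (rule M.iso_cancel_right[OF eq]) simp_all
qed simp_all

lemma act_simps [simp]:
  "P \<in> Obj M \<Longrightarrow> FO (act_functor C M X) P = X \<rhd>\<^sub>o P"
  "u \<in> Arr M \<Longrightarrow> FA (act_functor C M X) u = Ide C X \<rhd>\<^sub>a u"
  by (simp_all add: act_functor_def)

end

context module_functor
begin

lemma s_arr [simp]:
  assumes "X \<in> Obj C" "A \<in> Obj P"
  shows "s (X, A) \<in> Arr Q" "Dom Q (s (X, A)) = X \<rhd>\<^sub>o\<^bsub>Q\<^esub> FO F A"
    "Cod Q (s (X, A)) = FO F (X \<rhd>\<^sub>o\<^bsub>P\<^esub> A)" "is_iso Q (s (X, A))"
  using s_hom[OF assms] s_iso[OF assms] by (auto simp: Hom_def)

lemma s_natural':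
  "\<lbrakk>f \<in> Arr C; u \<in> Arr P; Y = Cod C f; B = Cod P u\<rbrakk>
    \<Longrightarrow> s (Y, B) \<cdot>\<^bsub>Q\<^esub> (f \<rhd>\<^sub>a\<^bsub>Q\<^esub> FA F u) = FA F (f \<rhd>\<^sub>a\<^bsub>P\<^esub> u) \<cdot>\<^bsub>Q\<^esub> s (Dom C f, Dom P u)"
  by (rule s_natural) (auto simp: Hom_def)

end

section \<open>Right exact endofunctors\<close>

lemma right_exact_fcomp:
  assumes "right_exact A LA B LB F" "right_exact B LB E LE G"
  shows "right_exact A LA E LE (fcomp A G F)"
proof -
  interpret F: right_exact A LA B LB F by fact
  interpret G: right_exact B LB E LE G by fact
  interpret GF: cat_functor A E "fcomp A G F"
    by (rule cat_functor_fcomp) unfold_locales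
  show ?thesis
  proof
    fix f g :: 'b and X Y c assume f: "f \<in> Hom A X Y"
    note [simp] = F.FA_hom[OF f] F.A.Scl_hom[OF f]
    have [simp]: "f \<in> Arr A" "Scl LA c f \<in> Arr A"
      using f F.A.Scl_hom[OF f] by (auto simp: Hom_def)
    show "FA (fcomp A G F) (Scl LA c f) = Scl LE c (FA (fcomp A G F) f)"
      using F.FA_Scl[OF f] G.FA_Scl[OF F.FA_hom[OF f]] by simp
    assume g: "g \<in> Hom A X Y"
    have [simp]: "g \<in> Arr A" "Add LA f g \<in> Arr A"
      using g F.A.Add_hom[OF f g] by (auto simp: Hom_def)
    show "FA (fcomp A G F) (Add LA f g) = Add LE (FA (fcomp A G F) f) (FA (fcomp A G F) g)"
      using F.FA_Add[OF f g] G.FA_Add[OF F.FA_hom[OF f] F.FA_hom[OF g]] by simp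
  next
    fix f q assume cok: "is_cokernel A LA f q"
    then have "f \<in> Arr A" "q \<in> Arr A" by (auto simp: is_cokernel_def)
    then show "is_cokernel E LE (FA (fcomp A G F) f) (FA (fcomp A G F) q)"
      using G.preserves_cokernels[OF F.preserves_cokernels[OF cok]] by simp
  qed
qed

lemma Rex_obj_iff:
  "F \<in> Obj (Rex M LM) \<longleftrightarrow>
     right_exact M LM M LM F \<and> FO F \<in> extensional (Obj M) \<and> FA F \<in> extensional (Arr M)"
  by (simp add: Rex_def)

lemma Rex_simps [simp]:
  "Dom (Rex M LM) t = fst t" "Cod (Rex M LM) t = fst (snd t)"
  "Ide (Rex M LM) F = (F, F, \<lambda>P\<in>Obj M. Ide M (FO F P))"
  "Cmp (Rex M LM) (G', H, \<beta>) (F, G, \<alpha>) = (F, H, \<lambda>P\<in>Obj M. \<beta> P \<cdot>\<^bsub>M\<^esub> \<alpha> P)"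
  by (auto simp: Rex_def Let_def split: prod.splits)

lemma Rex_arr_iff:
  "(F, G, \<alpha>) \<in> Arr (Rex M LM) \<longleftrightarrow>
     F \<in> Obj (Rex M LM) \<and> G \<in> Obj (Rex M LM) \<and> nat_trans M M F G \<alpha> \<and> \<alpha> \<in> extensional (Obj M)"
  by (auto simp: Rex_def)

lemma Rex_obj_functor: "F \<in> Obj (Rex M LM) \<Longrightarrow> cat_functor M M F"
  by (simp add: Rex_obj_iff right_exact_def linear_functor_def)

lemma fcomp_extensional:
  "FO (fcomp A G F) \<in> extensional (Obj A)" "FA (fcomp A G F) \<in> extensional (Arr A)"
  by (simp_all add: fcomp_def)

context linear_category
begin

lemma fid_Rex [simp]: "fid C \<in> Obj (Rex C L)"
proof -
  interpret I: cat_functor C C "fid C" by (rule cat_functor_fid) unfold_locales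
  have "right_exact C L C L (fid C)"
  proof
    fix f g X Y c assume f: "f \<in> Hom C X Y"
    then show "FA (fid C) (Scl L c f) = Scl L c (FA (fid C) f)"
      using Scl_hom[OF f, of c] by (simp add: Hom_def)
    assume g: "g \<in> Hom C X Y"
    then show "FA (fid C) (Add L f g) = Add L (FA (fid C) f) (FA (fid C) g)"
      using Add_hom[OF f g] f by (simp add: Hom_def)
  next
    fix f q assume cok: "is_cokernel C L f q"
    then have "f \<in> Arr C" "q \<in> Arr C" by (auto simp: is_cokernel_def)
    then show "is_cokernel C L (FA (fid C) f) (FA (fid C) q)" using cok by simp
  qed
  then show ?thesis by (simp add: Rex_obj_iff) (simp add: fid_def)
qed

lemma fcomp_Rex [simp]:
  "\<lbrakk>F \<in> Obj (Rex C L); G \<in> Obj (Rex C L)\<rbrakk> \<Longrightarrow> fcomp C F G \<in> Obj (Rex C L)"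
  using right_exact_fcomp[of C L C L G C L F] by (simp add: Rex_obj_iff fcomp_extensional)

lemma Rex_arrI:
  assumes "F \<in> Obj (Rex C L)" "G \<in> Obj (Rex C L)"
    and "\<And>P. P \<in> Obj C \<Longrightarrow> \<alpha> P \<in> Arr C" "\<And>P. P \<in> Obj C \<Longrightarrow> Dom C (\<alpha> P) = FO F P"
      "\<And>P. P \<in> Obj C \<Longrightarrow> Cod C (\<alpha> P) = FO G P"
    and "\<And>u. u \<in> Arr C \<Longrightarrow> \<alpha> (Cod C u) \<cdot> FA F u = FA G u \<cdot> \<alpha> (Dom C u)"
  shows "(F, G, \<lambda>P\<in>Obj C. \<alpha> P) \<in> Arr (Rex C L)"
proof -
  interpret F: cat_functor C C F by (rule Rex_obj_functor) fact
  interpret G: cat_functor C C G by (rule Rex_obj_functor) fact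
  have "nat_trans C C F G (\<lambda>P\<in>Obj C. \<alpha> P)"
    by unfold_locales (auto simp: Hom_def assms)
  then show ?thesis using assms by (simp add: Rex_arr_iff)
qed

lemma Rex_arrD:
  assumes "(F, G, \<alpha>) \<in> Arr (Rex C L)"
  shows "F \<in> Obj (Rex C L)" "G \<in> Obj (Rex C L)"
    "P \<in> Obj C \<Longrightarrow> \<alpha> P \<in> Arr C" "P \<in> Obj C \<Longrightarrow> Dom C (\<alpha> P) = FO F P"
    "P \<in> Obj C \<Longrightarrow> Cod C (\<alpha> P) = FO G P"
    "\<alpha> \<in> extensional (Obj C)"
    "\<lbrakk>u \<in> Arr C; Cod C u = Q\<rbrakk> \<Longrightarrow> \<alpha> Q \<cdot> FA F u = FA G u \<cdot> \<alpha> (Dom C u)"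
proof -
  interpret \<alpha>: nat_trans C C F G \<alpha> using assms by (simp add: Rex_arr_iff)
  show "F \<in> Obj (Rex C L)" "G \<in> Obj (Rex C L)" "\<alpha> \<in> extensional (Obj C)"
    using assms by (auto simp: Rex_arr_iff)
  show "P \<in> Obj C \<Longrightarrow> \<alpha> P \<in> Arr C" "P \<in> Obj C \<Longrightarrow> Dom C (\<alpha> P) = FO F P"
    "P \<in> Obj C \<Longrightarrow> Cod C (\<alpha> P) = FO G P"
    by simp_all
  show "\<lbrakk>u \<in> Arr C; Cod C u = Q\<rbrakk> \<Longrightarrow> \<alpha> Q \<cdot> FA F u = FA G u \<cdot> \<alpha> (Dom C u)"
    by (rule \<alpha>.natural') auto
qed

text \<open>
  Most transformations below are given by their components, as functions restricted to the objects.
  For these the typing rules can speak about the components themselves.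
\<close>

lemma Rex_restrict_arrD:
  assumes "(F, G, \<lambda>P\<in>Obj C. \<alpha> P) \<in> Arr (Rex C L)"
  shows "F \<in> Obj (Rex C L)" "G \<in> Obj (Rex C L)"
    "P \<in> Obj C \<Longrightarrow> \<alpha> P \<in> Arr C" "P \<in> Obj C \<Longrightarrow> Dom C (\<alpha> P) = FO F P"
    "P \<in> Obj C \<Longrightarrow> Cod C (\<alpha> P) = FO G P"
    "\<lbrakk>u \<in> Arr C; Cod C u = Q\<rbrakk> \<Longrightarrow> \<alpha> Q \<cdot> FA F u = FA G u \<cdot> \<alpha> (Dom C u)"
  using Rex_arrD(1-2)[OF assms] Rex_arrD(3-5)[OF assms, of P] Rex_arrD(7)[OF assms, of u Q]
  by auto

lemma Rex_Ide_arr: "F \<in> Obj (Rex C L) \<Longrightarrow> (F, F, \<lambda>P\<in>Obj C. Ide C (FO F P)) \<in> Arr (Rex C L)"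
proof (rule Rex_arrI)
  assume "F \<in> Obj (Rex C L)"
  then interpret F: cat_functor C C F by (rule Rex_obj_functor)
  show "\<And>u. u \<in> Arr C \<Longrightarrow> Ide C (FO F (Cod C u)) \<cdot> FA F u = FA F u \<cdot> Ide C (FO F (Dom C u))"
    by simp
qed (auto dest: Rex_obj_functor simp: cat_functor.FO_in)

lemma Rex_Cmp_arr:
  assumes \<alpha>: "(F, G, \<alpha>) \<in> Arr (Rex C L)" and \<beta>: "(G, H, \<beta>) \<in> Arr (Rex C L)"
  shows "(F, H, \<lambda>P\<in>Obj C. \<beta> P \<cdot> \<alpha> P) \<in> Arr (Rex C L)"
proof (rule Rex_arrI)
  interpret F: cat_functor C C F by (rule Rex_obj_functor[OF Rex_arrD(1)[OF \<alpha>]])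
  interpret G: cat_functor C C G by (rule Rex_obj_functor[OF Rex_arrD(2)[OF \<alpha>]])
  interpret H: cat_functor C C H by (rule Rex_obj_functor[OF Rex_arrD(2)[OF \<beta>]])
  note [simp] = Rex_arrD(3-5)[OF \<alpha>] Rex_arrD(3-5)[OF \<beta>]
  show "(\<beta> (Cod C u) \<cdot> \<alpha> (Cod C u)) \<cdot> FA F u = FA H u \<cdot> (\<beta> (Dom C u) \<cdot> \<alpha> (Dom C u))"
    if "u \<in> Arr C" for u
    using that by (simp add: Rex_arrD(7)[OF \<alpha>] reassoc[OF Rex_arrD(7)[OF \<beta>]])
qed (use Rex_arrD[OF \<alpha>] Rex_arrD[OF \<beta>] in auto)

lemma category_Rex: "category (Rex C L)"
proof
  show "Dom (Rex C L) f \<in> Obj (Rex C L)" "Cod (Rex C L) f \<in> Obj (Rex C L)"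
    if "f \<in> Arr (Rex C L)" for f
    using that by (cases f, simp add: Rex_arr_iff)+
next
  show "Ide (Rex C L) F \<in> Hom (Rex C L) F F" if "F \<in> Obj (Rex C L)" for F
    using that by (simp add: Hom_def Rex_Ide_arr)
next
  fix f g F G H assume "f \<in> Hom (Rex C L) F G" "g \<in> Hom (Rex C L) G H"
  then show "Cmp (Rex C L) g f \<in> Hom (Rex C L) F H"
    by (cases f; cases g) (auto simp: Hom_def intro: Rex_Cmp_arr)
next
  fix f F G assume "f \<in> Hom (Rex C L) F G"
  then obtain \<alpha> where f: "f = (F, G, \<alpha>)" "(F, G, \<alpha>) \<in> Arr (Rex C L)"
    by (cases f) (auto simp: Hom_def)
  note [simp] = Rex_arrD(3-5)[OF f(2)]
  have "(\<lambda>P\<in>Obj C. Ide C (FO G P) \<cdot> \<alpha> P) = \<alpha>" "(\<lambda>P\<in>Obj C. \<alpha> P \<cdot> Ide C (FO F P)) = \<alpha>"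
    by (rule extensionalityI[OF restrict_extensional Rex_arrD(6)[OF f(2)]]; simp)+
  moreover have "(\<lambda>P\<in>Obj C. (\<lambda>P\<in>Obj C. Ide C (FO G P)) P \<cdot> \<alpha> P) = (\<lambda>P\<in>Obj C. Ide C (FO G P) \<cdot> \<alpha> P)"
    "(\<lambda>P\<in>Obj C. \<alpha> P \<cdot> (\<lambda>P\<in>Obj C. Ide C (FO F P)) P) = (\<lambda>P\<in>Obj C. \<alpha> P \<cdot> Ide C (FO F P))"
    by (auto intro: restrict_ext)
  ultimately show "Cmp (Rex C L) (Ide (Rex C L) G) f = f" "Cmp (Rex C L) f (Ide (Rex C L) F) = f"
    by (simp_all add: f(1))
next
  fix f g h E F G H
  assume "f \<in> Hom (Rex C L) E F" "g \<in> Hom (Rex C L) F G" "h \<in> Hom (Rex C L) G H"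
  then obtain \<alpha> \<beta> \<gamma> where f: "f = (E, F, \<alpha>)" "(E, F, \<alpha>) \<in> Arr (Rex C L)"
    and g: "g = (F, G, \<beta>)" "(F, G, \<beta>) \<in> Arr (Rex C L)"
    and h: "h = (G, H, \<gamma>)" "(G, H, \<gamma>) \<in> Arr (Rex C L)"
    by (cases f; cases g; cases h) (auto simp: Hom_def)
  show "Cmp (Rex C L) (Cmp (Rex C L) h g) f = Cmp (Rex C L) h (Cmp (Rex C L) g f)"
    using Rex_arrD(3-5)[OF f(2)] Rex_arrD(3-5)[OF g(2)] Rex_arrD(3-5)[OF h(2)]
    by (auto simp: f(1) g(1) h(1) intro!: restrict_ext)
qed

lemma Rex_inverse_arrows:
  assumes \<alpha>: "(F, G, \<alpha>) \<in> Arr (Rex C L)" and [simp]: "\<And>P. P \<in> Obj C \<Longrightarrow> is_iso C (\<alpha> P)"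
  shows "inverse_arrows (Rex C L) (F, G, \<alpha>) (G, F, \<lambda>P\<in>Obj C. inv_arr C (\<alpha> P))"
proof -
  interpret R: category "Rex C L" by (rule category_Rex)
  interpret F: cat_functor C C F by (rule Rex_obj_functor[OF Rex_arrD(1)[OF \<alpha>]])
  interpret G: cat_functor C C G by (rule Rex_obj_functor[OF Rex_arrD(2)[OF \<alpha>]])
  note [simp] = Rex_arrD(3-5)[OF \<alpha>]
  have inv: "(G, F, \<lambda>P\<in>Obj C. inv_arr C (\<alpha> P)) \<in> Arr (Rex C L)"
  proof (rule Rex_arrI)
    show "inv_arr C (\<alpha> (Cod C u)) \<cdot> FA G u = FA F u \<cdot> inv_arr C (\<alpha> (Dom C u))"
      if "u \<in> Arr C" for u
      using that iso_square_inv[OF Rex_arrD(7)[OF \<alpha> that refl], symmetric] by simp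
  qed (use Rex_arrD[OF \<alpha>] in auto)
  show ?thesis
    using \<alpha> inv by (intro R.inverse_arrowsI) (auto intro!: restrict_ext)
qed

end

sublocale linear_category \<subseteq> Rex: category "Rex C L"
  by (rule category_Rex)

section \<open>The dual category\<close>

text \<open>
  Schauenburg's functor sends an object \<open>V\<close> of the center to \<open>V \<rhd> -\<close>, which must be right exact to
  be an object of the dual category.
\<close>

locale right_exact_action = module_category C M + M: linear_category M LM
  for C :: "('c, 'f, 'y) moncat_scheme" and M :: "('c, 'f, 'o, 'a, 'z) modcat_scheme" (structure)
    and LM :: "('k::field, 'o, 'a) lin" +
  assumes act_right_exact: "X \<in> Obj C \<Longrightarrow> right_exact M LM M LM (act_functor C M X)"

lemma inv_arr_rev_moncat: "inv_arr (rev_moncat D) = inv_arr D"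
proof -
  have "inverse_arrows (rev_moncat D) = inverse_arrows D"
    by (simp add: fun_eq_iff inverse_arrows_def rev_moncat_def Hom_def)
  then show ?thesis by (simp add: fun_eq_iff inv_arr_def)
qed

lemma dual_simps [simp]:
  "Dom (dual_cat C M LM) t = fst t" "Cod (dual_cat C M LM) t = fst (snd t)"
  "Ide (dual_cat C M LM) A = (A, A, \<lambda>P\<in>Obj M. Ide M (FO (fst A) P))"
  "Cmp (dual_cat C M LM) (A', B, \<beta>) (A, B', \<alpha>) = (A, B, \<lambda>P\<in>Obj M. \<beta> P \<cdot>\<^bsub>M\<^esub> \<alpha> P)"
  "TO (dual_cat C M LM) A B = mcomp C M B A"
  "TA (dual_cat C M LM) (A, A', \<alpha>) (B, B', \<beta>) = (mcomp C M B A, mcomp C M B' A',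
     \<lambda>P\<in>Obj M. \<beta> (FO (fst A') P) \<cdot>\<^bsub>M\<^esub> FA (fst B) (\<alpha> P))"
  "Unt (dual_cat C M LM) = mid C M"
  "Lu (dual_cat C M LM) A = Ide (dual_cat C M LM) A"
  "Ru (dual_cat C M LM) A = Ide (dual_cat C M LM) A"
  "As (dual_cat C M LM) A B E
     = inv_arr (dual_cat C M LM) (Ide (dual_cat C M LM) (mcomp C M (mcomp C M E B) A))"
  by (simp_all add: dual_cat_def Rex_mod_def Let_def inv_arr_rev_moncat)
    (simp_all add: rev_moncat_def split: prod.splits)

lemma dual_obj_iff:
  "A \<in> Obj (dual_cat C M LM) \<longleftrightarrow> fst A \<in> Obj (Rex M LM) \<and>
     module_functor C M M (fst A) (snd A) \<and> snd A \<in> extensional (Obj C \<times> Obj M)"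
  by (simp add: dual_cat_def Rex_mod_def rev_moncat_def Let_def split: prod.splits)

lemma dual_arr_iff:
  "(A, B, \<alpha>) \<in> Arr (dual_cat C M LM) \<longleftrightarrow>
     A \<in> Obj (dual_cat C M LM) \<and> B \<in> Obj (dual_cat C M LM) \<and>
     (fst A, fst B, \<alpha>) \<in> Arr (Rex M LM) \<and> module_trans C M M (snd A) (snd B) \<alpha>"
  by (simp add: dual_cat_def Rex_mod_def rev_moncat_def Let_def split: prod.splits)

lemma mcomp_simps [simp]:
  "fst (mcomp C M A B) = fcomp M (fst A) (fst B)"
  "\<lbrakk>X \<in> Obj C; P \<in> Obj M\<rbrakk>
    \<Longrightarrow> snd (mcomp C M A B) (X, P) = FA (fst A) (snd B (X, P)) \<cdot>\<^bsub>M\<^esub> snd A (X, FO (fst B) P)"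
  by (simp_all add: mcomp_def split: prod.splits)

lemma mcomp_extensional: "snd (mcomp C M A B) \<in> extensional (Obj C \<times> Obj M)"
  by (simp add: mcomp_def split: prod.splits)

lemma mid_simps [simp]:
  "fst (mid C M) = fid M"
  "\<lbrakk>X \<in> Obj C; P \<in> Obj M\<rbrakk> \<Longrightarrow> snd (mid C M) (X, P) = Ide M (X \<rhd>\<^sub>o\<^bsub>M\<^esub> P)"
  by (simp_all add: mid_def)

context module_category
begin

lemma module_functor_fid: "module_functor C M M (fid M) (snd (mid C M))"
proof -
  interpret I: cat_functor M M "fid M" by (rule cat_functor_fid) unfold_locales
  show ?thesis
    by unfold_locales (auto simp: Hom_def)
qed

lemma module_functor_fcomp:
  assumes "module_functor C M M F s" "module_functor C M M G t"
  shows "module_functor C M M (fcomp M F G) (snd (mcomp C M (F, s) (G, t)))"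
proof -
  interpret F: module_functor C M M F s by fact
  interpret G: module_functor C M M G t by fact
  interpret FG: cat_functor M M "fcomp M F G"
    by (rule cat_functor_fcomp) unfold_locales
  show ?thesis
  proof
    fix X P assume [simp]: "X \<in> Obj C" "P \<in> Obj M"
    show "snd (mcomp C M (F, s) (G, t)) (X, P)
        \<in> Hom M (X \<rhd>\<^sub>o FO (fcomp M F G) P) (FO (fcomp M F G) (X \<rhd>\<^sub>o P))"
      by (simp add: Hom_def)
    show "is_iso M (snd (mcomp C M (F, s) (G, t)) (X, P))" by simp
  next
    fix f X Y u P Q assume "f \<in> Hom C X Y" "u \<in> Hom M P Q"
    then have [simp]: "f \<in> Arr C" "u \<in> Arr M" and
      XY: "X = Dom C f" "Y = Cod C f" "P = Dom M u" "Q = Cod M u"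
      by (auto simp: Hom_def)
    have t: "FA F (t (Y, Q)) \<cdot> FA F (f \<rhd>\<^sub>a FA G u) = FA F (FA G (f \<rhd>\<^sub>a u)) \<cdot> FA F (t (X, P))"
      using arg_cong[OF G.s_natural'[of f u Y Q], of "FA F"] by (simp add: XY)
    show "snd (mcomp C M (F, s) (G, t)) (Y, Q) \<cdot> (f \<rhd>\<^sub>a FA (fcomp M F G) u)
        = FA (fcomp M F G) (f \<rhd>\<^sub>a u) \<cdot> snd (mcomp C M (F, s) (G, t)) (X, P)"
      by (simp add: XY F.s_natural' M.reassoc[OF t[unfolded XY]])
  next
    fix X Y P assume [simp]: "X \<in> Obj C" "Y \<in> Obj C" "P \<in> Obj M"
    have t: "FA F (FA G (Mas M X Y P)) \<cdot> FA F (t (X \<otimes>\<^sub>o\<^bsub>C\<^esub> Y, P))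
      = FA F (t (X, Y \<rhd>\<^sub>o P)) \<cdot> FA F (Ide C X \<rhd>\<^sub>a t (Y, P)) \<cdot> FA F (Mas M X Y (FO G P))"
      using arg_cong[OF G.s_assoc[of X Y P], of "FA F"] by simp
    show "FA (fcomp M F G) (Mas M X Y P) \<cdot> snd (mcomp C M (F, s) (G, t)) (X \<otimes>\<^sub>o\<^bsub>C\<^esub> Y, P)
        = snd (mcomp C M (F, s) (G, t)) (X, Y \<rhd>\<^sub>o P) \<cdot>
          (Ide C X \<rhd>\<^sub>a snd (mcomp C M (F, s) (G, t)) (Y, P)) \<cdot> Mas M X Y (FO (fcomp M F G) P)"
      by (simp add: M.reassoc[OF t] F.s_assoc M.reassoc[OF F.s_natural'] AA_whisker)
  next
    fix P assume [simp]: "P \<in> Obj M"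
    have t: "FA F (FA G (Mun M P)) \<cdot> FA F (t (Unt C, P)) = FA F (Mun M (FO G P))"
      using arg_cong[OF G.s_unit[of P], of "FA F"] by simp
    show "FA (fcomp M F G) (Mun M P) \<cdot> snd (mcomp C M (F, s) (G, t)) (Unt C, P)
        = Mun M (FO (fcomp M F G) P)"
      by (simp add: M.reassoc[OF t] F.s_unit)
  qed
qed

end

context right_exact_action
begin

abbreviation "D \<equiv> dual_cat C M LM"

lemma act_Rex [simp]: "X \<in> Obj C \<Longrightarrow> act_functor C M X \<in> Obj (Rex M LM)"
  using act_right_exact[of X] by (simp add: Rex_obj_iff) (simp add: act_functor_def)

lemma dual_objD:
  assumes "A \<in> Obj D"
  shows "module_functor C M M (fst A) (snd A)" "fst A \<in> Obj (Rex M LM)"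
  using assms by (auto simp: dual_obj_iff)

lemma mcomp_obj [simp]: "\<lbrakk>A \<in> Obj D; B \<in> Obj D\<rbrakk> \<Longrightarrow> mcomp C M A B \<in> Obj D"
  using module_functor_fcomp[of "fst A" "snd A" "fst B" "snd B"]
  by (simp add: dual_obj_iff mcomp_extensional)

lemma mid_obj [simp]: "mid C M \<in> Obj D"
  using module_functor_fid by (simp add: dual_obj_iff) (simp add: mid_def)

lemma dual_obj_eqI:
  assumes "A \<in> Obj D" "B \<in> Obj D"
    and "\<And>P. P \<in> Obj M \<Longrightarrow> FO (fst A) P = FO (fst B) P"
    and "\<And>u. u \<in> Arr M \<Longrightarrow> FA (fst A) u = FA (fst B) u"
    and "\<And>X P. X \<in> Obj C \<Longrightarrow> P \<in> Obj M \<Longrightarrow> snd A (X, P) = snd B (X, P)"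
  shows "A = B"
proof (rule prod_eqI)
  have ext: "FO (fst A) \<in> extensional (Obj M)" "FA (fst A) \<in> extensional (Arr M)"
    "FO (fst B) \<in> extensional (Obj M)" "FA (fst B) \<in> extensional (Arr M)"
    "snd A \<in> extensional (Obj C \<times> Obj M)" "snd B \<in> extensional (Obj C \<times> Obj M)"
    using assms(1,2) by (auto simp: dual_obj_iff Rex_obj_iff)
  show "fst A = fst B"
    using extensionalityI[OF ext(1,3) assms(3)] extensionalityI[OF ext(2,4) assms(4)]
    by (intro func.equality) auto
  show "snd A = snd B"
    by (rule extensionalityI[OF ext(5,6)]) (use assms(5) in auto)
qed

lemma mcomp_assoc [simp]:
  assumes "A \<in> Obj D" "B \<in> Obj D" "E \<in> Obj D"
  shows "mcomp C M (mcomp C M A B) E = mcomp C M A (mcomp C M B E)"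
proof -
  interpret A: module_functor C M M "fst A" "snd A" by (rule dual_objD) fact
  interpret B: module_functor C M M "fst B" "snd B" by (rule dual_objD) fact
  interpret E: module_functor C M M "fst E" "snd E" by (rule dual_objD) fact
  show ?thesis by (rule dual_obj_eqI) (use assms in auto)
qed

lemma mcomp_mid [simp]:
  assumes "A \<in> Obj D"
  shows "mcomp C M A (mid C M) = A" "mcomp C M (mid C M) A = A"
proof -
  interpret A: module_functor C M M "fst A" "snd A" by (rule dual_objD) fact
  show "mcomp C M A (mid C M) = A" "mcomp C M (mid C M) A = A"
    by (rule dual_obj_eqI; use assms in auto)+
qed

lemma dual_arrI:
  assumes "A \<in> Obj D" "B \<in> Obj D"
    and "\<And>P. P \<in> Obj M \<Longrightarrow> \<alpha> P \<in> Arr M" "\<And>P. P \<in> Obj M \<Longrightarrow> Dom M (\<alpha> P) = FO (fst A) P"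
      "\<And>P. P \<in> Obj M \<Longrightarrow> Cod M (\<alpha> P) = FO (fst B) P"
    and "\<And>u. u \<in> Arr M \<Longrightarrow> \<alpha> (Cod M u) \<cdot> FA (fst A) u = FA (fst B) u \<cdot> \<alpha> (Dom M u)"
    and "\<And>X P. X \<in> Obj C \<Longrightarrow> P \<in> Obj M
      \<Longrightarrow> snd B (X, P) \<cdot> (Ide C X \<rhd>\<^sub>a \<alpha> P) = \<alpha> (X \<rhd>\<^sub>o P) \<cdot> snd A (X, P)"
  shows "(A, B, \<lambda>P\<in>Obj M. \<alpha> P) \<in> Arr D"
  using assms M.Rex_arrI[of "fst A" "fst B" \<alpha>]
  by (simp add: dual_arr_iff module_trans_def dual_objD)

lemma dual_arrD:
  assumes "(A, B, \<alpha>) \<in> Arr D"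
  shows "A \<in> Obj D" "B \<in> Obj D"
    and "P \<in> Obj M \<Longrightarrow> \<alpha> P \<in> Arr M" "P \<in> Obj M \<Longrightarrow> Dom M (\<alpha> P) = FO (fst A) P"
      "P \<in> Obj M \<Longrightarrow> Cod M (\<alpha> P) = FO (fst B) P"
    and "\<alpha> \<in> extensional (Obj M)"
    and "\<lbrakk>u \<in> Arr M; Cod M u = Q\<rbrakk> \<Longrightarrow> \<alpha> Q \<cdot> FA (fst A) u = FA (fst B) u \<cdot> \<alpha> (Dom M u)"
    and "\<lbrakk>X \<in> Obj C; P \<in> Obj M\<rbrakk>
      \<Longrightarrow> snd B (X, P) \<cdot> (Ide C X \<rhd>\<^sub>a \<alpha> P) = \<alpha> (X \<rhd>\<^sub>o P) \<cdot> snd A (X, P)"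
  using assms M.Rex_arrD[of "fst A" "fst B" \<alpha>]
  by (auto simp: dual_arr_iff module_trans_def)

lemma dual_Ide_arr: 
  assumes "A \<in> Obj D"
  shows "(A, A, \<lambda>P\<in>Obj M. Ide M (FO (fst A) P)) \<in> Arr D"
proof -
  interpret A: module_functor C M M "fst A" "snd A" by (rule dual_objD) fact
  show ?thesis using assms by (intro dual_arrI) auto
qed

lemma dual_Cmp_arr:
  assumes \<alpha>: "(A, B, \<alpha>) \<in> Arr D" and \<beta>: "(B, E, \<beta>) \<in> Arr D"
  shows "(A, E, \<lambda>P\<in>Obj M. \<beta> P \<cdot> \<alpha> P) \<in> Arr D"
proof -
  interpret A: module_functor C M M "fst A" "snd A" by (rule dual_objD[OF dual_arrD(1)[OF \<alpha>]])
  interpret B: module_functor C M M "fst B" "snd B" by (rule dual_objD[OF dual_arrD(2)[OF \<alpha>]])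
  interpret E: module_functor C M M "fst E" "snd E" by (rule dual_objD[OF dual_arrD(2)[OF \<beta>]])
  note [simp] = dual_arrD(3-5)[OF \<alpha>] dual_arrD(3-5)[OF \<beta>]
  show ?thesis
  proof (rule dual_arrI)
    show "(\<beta> (Cod M u) \<cdot> \<alpha> (Cod M u)) \<cdot> FA (fst A) u = FA (fst E) u \<cdot> (\<beta> (Dom M u) \<cdot> \<alpha> (Dom M u))"
      if "u \<in> Arr M" for u
      using that by (simp add: dual_arrD(7)[OF \<alpha>] M.reassoc[OF dual_arrD(7)[OF \<beta>]])
    show "snd E (X, P) \<cdot> (Ide C X \<rhd>\<^sub>a (\<beta> P \<cdot> \<alpha> P)) = (\<beta> (X \<rhd>\<^sub>o P) \<cdot> \<alpha> (X \<rhd>\<^sub>o P)) \<cdot> snd A (X, P)"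
      if "X \<in> Obj C" "P \<in> Obj M" for X P
      using that
      by (simp add: AA_whisker M.reassoc[OF dual_arrD(8)[OF \<beta>]] flip: dual_arrD(8)[OF \<alpha>])
  qed (use dual_arrD[OF \<alpha>] dual_arrD[OF \<beta>] in auto)
qed

lemma category_dual: "category D"
proof
  show "Dom D f \<in> Obj D" "Cod D f \<in> Obj D" if "f \<in> Arr D" for f
    using that by (cases f, simp add: dual_arr_iff)+
next
  show "Ide D A \<in> Hom D A A" if "A \<in> Obj D" for A
    using that by (simp add: Hom_def dual_Ide_arr)
next
  fix f g A B E assume "f \<in> Hom D A B" "g \<in> Hom D B E"
  then show "Cmp D g f \<in> Hom D A E"
    by (cases f; cases g) (auto simp: Hom_def intro: dual_Cmp_arr)
next
  fix f A B assume "f \<in> Hom D A B"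
  then obtain \<alpha> where f: "f = (A, B, \<alpha>)" "(A, B, \<alpha>) \<in> Arr D"
    by (cases f) (auto simp: Hom_def)
  note [simp] = dual_arrD(1-5)[OF f(2)]
  have "Cmp D (Ide D B) f = (A, B, \<lambda>P\<in>Obj M. Ide M (FO (fst B) P) \<cdot> \<alpha> P)"
    "Cmp D f (Ide D A) = (A, B, \<lambda>P\<in>Obj M. \<alpha> P \<cdot> Ide M (FO (fst A) P))"
    by (auto simp: f(1) intro!: restrict_ext)
  moreover have "(\<lambda>P\<in>Obj M. Ide M (FO (fst B) P) \<cdot> \<alpha> P) = \<alpha>"
    "(\<lambda>P\<in>Obj M. \<alpha> P \<cdot> Ide M (FO (fst A) P)) = \<alpha>"
    by (rule extensionalityI[OF restrict_extensional dual_arrD(6)[OF f(2)]]; simp)+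
  ultimately show "Cmp D (Ide D B) f = f" "Cmp D f (Ide D A) = f"
    by (simp_all add: f(1))
next
  fix f g h A B E F
  assume "f \<in> Hom D A B" "g \<in> Hom D B E" "h \<in> Hom D E F"
  then obtain \<alpha> \<beta> \<gamma> where f: "f = (A, B, \<alpha>)" "(A, B, \<alpha>) \<in> Arr D"
    and g: "g = (B, E, \<beta>)" "(B, E, \<beta>) \<in> Arr D"
    and h: "h = (E, F, \<gamma>)" "(E, F, \<gamma>) \<in> Arr D"
    by (cases f; cases g; cases h) (auto simp: Hom_def)
  show "Cmp D (Cmp D h g) f = Cmp D h (Cmp D g f)"
    using dual_arrD(3-5)[OF f(2)] dual_arrD(3-5)[OF g(2)] dual_arrD(3-5)[OF h(2)]
    by (auto simp: f(1) g(1) h(1) intro!: restrict_ext)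
qed

text \<open>
  Naturality squares and module compatibility squares can be reversed along the components, so the
  pointwise inverse is again an arrow of the dual category.
\<close>

lemma dual_inverse_arrows:
  assumes \<alpha>: "(A, B, \<alpha>) \<in> Arr D" and [simp]: "\<And>P. P \<in> Obj M \<Longrightarrow> is_iso M (\<alpha> P)"
  shows "inverse_arrows D (A, B, \<alpha>) (B, A, \<lambda>P\<in>Obj M. inv_arr M (\<alpha> P))"
proof -
  interpret D: category D by (rule category_dual)
  interpret A: module_functor C M M "fst A" "snd A" by (rule dual_objD[OF dual_arrD(1)[OF \<alpha>]])
  interpret B: module_functor C M M "fst B" "snd B" by (rule dual_objD[OF dual_arrD(2)[OF \<alpha>]])
  note [simp] = dual_arrD(3-5)[OF \<alpha>]
  have inv: "(B, A, \<lambda>P\<in>Obj M. inv_arr M (\<alpha> P)) \<in> Arr D"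
  proof (rule dual_arrI)
    show "inv_arr M (\<alpha> (Cod M u)) \<cdot> FA (fst B) u = FA (fst A) u \<cdot> inv_arr M (\<alpha> (Dom M u))"
      if "u \<in> Arr M" for u
      using that M.iso_square_inv[OF dual_arrD(7)[OF \<alpha> that refl], symmetric] by simp
    show "snd A (X, P) \<cdot> (Ide C X \<rhd>\<^sub>a inv_arr M (\<alpha> P)) = inv_arr M (\<alpha> (X \<rhd>\<^sub>o P)) \<cdot> snd B (X, P)"
      if "X \<in> Obj C" "P \<in> Obj M" for X P
      using that M.iso_square_inv[OF dual_arrD(8)[OF \<alpha> that, symmetric]] by simp
  qed (use dual_arrD[OF \<alpha>] in auto)
  show ?thesis
    using \<alpha> inv by (intro D.inverse_arrowsI) (auto intro!: restrict_ext)
qed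

lemma dual_tensor_arr:
  assumes \<alpha>: "(A, A', \<alpha>) \<in> Arr D" and \<beta>: "(B, B', \<beta>) \<in> Arr D"
  shows "(mcomp C M B A, mcomp C M B' A', \<lambda>P\<in>Obj M. \<beta> (FO (fst A') P) \<cdot> FA (fst B) (\<alpha> P)) \<in> Arr D"
proof -
  interpret A: module_functor C M M "fst A" "snd A" by (rule dual_objD[OF dual_arrD(1)[OF \<alpha>]])
  interpret A': module_functor C M M "fst A'" "snd A'" by (rule dual_objD[OF dual_arrD(2)[OF \<alpha>]])
  interpret B: module_functor C M M "fst B" "snd B" by (rule dual_objD[OF dual_arrD(1)[OF \<beta>]])
  interpret B': module_functor C M M "fst B'" "snd B'" by (rule dual_objD[OF dual_arrD(2)[OF \<beta>]])
  note [simp] = dual_arrD(1-5)[OF \<alpha>] dual_arrD(1-5)[OF \<beta>]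
  show ?thesis
  proof (rule dual_arrI)
    fix u assume [simp]: "u \<in> Arr M"
    have \<alpha>u: "FA (fst B) (\<alpha> (Cod M u)) \<cdot> FA (fst B) (FA (fst A) u)
        = FA (fst B) (FA (fst A') u) \<cdot> FA (fst B) (\<alpha> (Dom M u))"
      using arg_cong[OF dual_arrD(7)[OF \<alpha>, of u "Cod M u"], of "FA (fst B)"] by simp
    show "(\<beta> (FO (fst A') (Cod M u)) \<cdot> FA (fst B) (\<alpha> (Cod M u))) \<cdot> FA (fst (mcomp C M B A)) u
        = FA (fst (mcomp C M B' A')) u \<cdot> (\<beta> (FO (fst A') (Dom M u)) \<cdot> FA (fst B) (\<alpha> (Dom M u)))"
      by (simp add: \<alpha>u M.reassoc[OF dual_arrD(7)[OF \<beta>]])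
  next
    fix X P assume [simp]: "X \<in> Obj C" "P \<in> Obj M"
    have \<alpha>X: "FA (fst B) (\<alpha> (X \<rhd>\<^sub>o P)) \<cdot> FA (fst B) (snd A (X, P))
        = FA (fst B) (snd A' (X, P)) \<cdot> FA (fst B) (Ide C X \<rhd>\<^sub>a \<alpha> P)"
      using arg_cong[OF dual_arrD(8)[OF \<alpha>, of X P], of "FA (fst B)"] by simp
    have \<beta>X: "snd B' (X, FO (fst A') P) \<cdot> (Ide C X \<rhd>\<^sub>a \<beta> (FO (fst A') P))
        = \<beta> (X \<rhd>\<^sub>o FO (fst A') P) \<cdot> snd B (X, FO (fst A') P)"
      by (rule dual_arrD(8)[OF \<beta>]) auto
    have \<beta>s: "FA (fst B') (snd A' (X, P)) \<cdot> \<beta> (X \<rhd>\<^sub>o FO (fst A') P)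
        = \<beta> (FO (fst A') (X \<rhd>\<^sub>o P)) \<cdot> FA (fst B) (snd A' (X, P))"
      using dual_arrD(7)[OF \<beta>, of "snd A' (X, P)"] by simp
    show "snd (mcomp C M B' A') (X, P) \<cdot> (Ide C X \<rhd>\<^sub>a (\<beta> (FO (fst A') P) \<cdot> FA (fst B) (\<alpha> P)))
        = (\<beta> (FO (fst A') (X \<rhd>\<^sub>o P)) \<cdot> FA (fst B) (\<alpha> (X \<rhd>\<^sub>o P))) \<cdot> snd (mcomp C M B A) (X, P)"
      by (simp add: AA_whisker M.reassoc[OF \<beta>X] B.s_natural' M.reassoc[OF \<alpha>X] M.reassoc[OF \<beta>s])
  qed auto
qed

lemma tensor_category_dual: "tensor_category D"
proof -
  interpret D: category D by (rule category_dual)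
  show ?thesis
  proof
    show "TO D A B \<in> Obj D" if "A \<in> Obj D" "B \<in> Obj D" for A B
      using that by simp
  next
    fix f A A' g B B' assume "f \<in> Hom D A A'" "g \<in> Hom D B B'"
    then show "TA D f g \<in> Hom D (TO D A B) (TO D A' B')"
      by (cases f; cases g) (auto simp: Hom_def intro: dual_tensor_arr)
  next
    fix A B assume A: "A \<in> Obj D" and B: "B \<in> Obj D"
    interpret A: module_functor C M M "fst A" "snd A" by (rule dual_objD) fact
    interpret B: module_functor C M M "fst B" "snd B" by (rule dual_objD) fact
    show "TA D (Ide D A) (Ide D B) = Ide D (TO D A B)"
      by (auto intro!: restrict_ext)
  next
    fix f A A' f' A'' g B B' g' B''
    assume "f \<in> Hom D A A'" "f' \<in> Hom D A' A''" "g \<in> Hom D B B'" "g' \<in> Hom D B' B''"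
    then obtain \<alpha> \<alpha>' \<beta> \<beta>' where f: "f = (A, A', \<alpha>)" "(A, A', \<alpha>) \<in> Arr D"
      and f': "f' = (A', A'', \<alpha>')" "(A', A'', \<alpha>') \<in> Arr D"
      and g: "g = (B, B', \<beta>)" "(B, B', \<beta>) \<in> Arr D"
      and g': "g' = (B', B'', \<beta>')" "(B', B'', \<beta>') \<in> Arr D"
      by (cases f; cases g; cases f'; cases g') (auto simp: Hom_def)
    note objects = dual_arrD(1,2)[OF f(2)] dual_arrD(1,2)[OF g(2)] dual_arrD(2)[OF f'(2)]
    interpret A: module_functor C M M "fst A" "snd A" by (rule dual_objD) fact
    interpret A': module_functor C M M "fst A'" "snd A'" by (rule dual_objD) fact
    interpret A'': module_functor C M M "fst A''" "snd A''" by (rule dual_objD) fact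
    interpret B: module_functor C M M "fst B" "snd B" by (rule dual_objD) fact
    interpret B': module_functor C M M "fst B'" "snd B'" by (rule dual_objD) fact
    note [simp] = dual_arrD(3-5)[OF f(2)] dual_arrD(3-5)[OF g(2)]
      dual_arrD(3-5)[OF f'(2)] dual_arrD(3-5)[OF g'(2)]
    have "(\<beta>' (FO (fst A'') P) \<cdot> \<beta> (FO (fst A'') P)) \<cdot> FA (fst B) (\<alpha>' P \<cdot> \<alpha> P)
      = (\<beta>' (FO (fst A'') P) \<cdot> FA (fst B') (\<alpha>' P)) \<cdot> (\<beta> (FO (fst A') P) \<cdot> FA (fst B) (\<alpha> P))"
      if [simp]: "P \<in> Obj M" for P
      by (simp add: M.reassoc[OF dual_arrD(7)[OF g(2)]])
    then show "TA D (Cmp D f' f) (Cmp D g' g) = Cmp D (TA D f' g') (TA D f g)"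
      by (auto simp: f(1) g(1) f'(1) g'(1) intro!: restrict_ext)
  qed
qed

end

sublocale right_exact_action \<subseteq> D: tensor_category D
  by (rule tensor_category_dual)

section \<open>Schauenburg's functor\<close>

context module_category
begin

lemma inv_Mas_natural:
  assumes [simp]: "f \<in> Arr C" "g \<in> Arr C" "u \<in> Arr M" and "X' = Cod C f" "Y' = Cod C g" "P' = Cod M u"
  shows "inv_arr M (Mas M X' Y' P') \<cdot> (f \<rhd>\<^sub>a (g \<rhd>\<^sub>a u))
    = ((f \<otimes>\<^sub>a\<^bsub>C\<^esub> g) \<rhd>\<^sub>a u) \<cdot> inv_arr M (Mas M (Dom C f) (Dom C g) (Dom M u))"
  using M.iso_square_inv[OF Mas_natural'[of f g u X' Y' P']] assms by simp

text \<open>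
  The pentagon, solved for each of the composites that meet the hexagon identity when the latter is
  transported from \<open>C\<close> to \<open>M\<close>.
\<close>

lemma Mas_pentagon_variants:
  assumes [simp]: "X \<in> Obj C" "Y \<in> Obj C" "Z \<in> Obj C" "P \<in> Obj M"
  shows "(Ide C X \<rhd>\<^sub>a Mas M Y Z P) \<cdot> Mas M X (Y \<otimes>\<^sub>o\<^bsub>C\<^esub> Z) P
      = Mas M X Y (Z \<rhd>\<^sub>o P) \<cdot> Mas M (X \<otimes>\<^sub>o\<^bsub>C\<^esub> Y) Z P \<cdot> (inv_arr C (As C X Y Z) \<rhd>\<^sub>a Ide M P)"
    and "(As C X Y Z \<rhd>\<^sub>a Ide M P) \<cdot> inv_arr M (Mas M (X \<otimes>\<^sub>o\<^bsub>C\<^esub> Y) Z P)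
      = inv_arr M (Mas M X (Y \<otimes>\<^sub>o\<^bsub>C\<^esub> Z) P) \<cdot> (Ide C X \<rhd>\<^sub>a inv_arr M (Mas M Y Z P)) \<cdot>
        Mas M X Y (Z \<rhd>\<^sub>o P)"
    and "Mas M (X \<otimes>\<^sub>o\<^bsub>C\<^esub> Y) Z P \<cdot> (inv_arr C (As C X Y Z) \<rhd>\<^sub>a Ide M P)
      = inv_arr M (Mas M X Y (Z \<rhd>\<^sub>o P)) \<cdot> (Ide C X \<rhd>\<^sub>a Mas M Y Z P) \<cdot> Mas M X (Y \<otimes>\<^sub>o\<^bsub>C\<^esub> Z) P"
proof -
  let ?a = "As C X Y Z \<rhd>\<^sub>a Ide M P"
  let ?b = "Mas M X (Y \<otimes>\<^sub>o\<^bsub>C\<^esub> Z) P" and ?c = "Ide C X \<rhd>\<^sub>a Mas M Y Z P"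
  let ?d = "Mas M X Y (Z \<rhd>\<^sub>o P)" and ?e = "Mas M (X \<otimes>\<^sub>o\<^bsub>C\<^esub> Y) Z P"
  have a: "inv_arr C (As C X Y Z) \<rhd>\<^sub>a Ide M P = inv_arr M ?a" by simp
  have c: "Ide C X \<rhd>\<^sub>a inv_arr M (Mas M Y Z P) = inv_arr M ?c" by simp
  have pent: "?d \<cdot> ?e = ?c \<cdot> ?b \<cdot> ?a" by (rule Mas_pentagon) auto
  show 1: "?c \<cdot> ?b = ?d \<cdot> ?e \<cdot> (inv_arr C (As C X Y Z) \<rhd>\<^sub>a Ide M P)"
    unfolding a by (rule M.iso_cancel_right[of _ ?a]) (simp_all add: pent del: AA_iso(2))
  show "?e \<cdot> (inv_arr C (As C X Y Z) \<rhd>\<^sub>a Ide M P) = inv_arr M ?d \<cdot> ?c \<cdot> ?b"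
    by (simp add: 1)
  have "?a = inv_arr M ?b \<cdot> inv_arr M ?c \<cdot> ?d \<cdot> ?e"
    unfolding pent by (simp del: AA_iso(2))
  then show "?a \<cdot> inv_arr M ?e
      = inv_arr M ?b \<cdot> (Ide C X \<rhd>\<^sub>a inv_arr M (Mas M Y Z P)) \<cdot> ?d"
    unfolding c by (simp del: AA_iso(2))
qed

end

lemma theta_obj_simps [simp]:
  "fst (theta_obj C M V) = act_functor C M (fst V)"
  "\<lbrakk>X \<in> Obj C; P \<in> Obj M\<rbrakk> \<Longrightarrow> snd (theta_obj C M V) (X, P)
     = Mas M (fst V) X P \<cdot>\<^bsub>M\<^esub> (inv_arr C (snd V X) \<rhd>\<^sub>a\<^bsub>M\<^esub> Ide M P) \<cdot>\<^bsub>M\<^esub> inv_arr M (Mas M X (fst V) P)"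
  by (simp_all add: theta_obj_def split: prod.splits)

lemma theta_braiding_simps [simp]:
  "F \<in> Obj (dual_cat C M LM) \<Longrightarrow> theta_braiding C M LM V F =
     (mcomp C M F (theta_obj C M V), mcomp C M (theta_obj C M V) F,
      \<lambda>P\<in>Obj M. inv_arr M (snd F (fst V, P)))"
  by (simp add: theta_braiding_def)

context right_exact_action
begin

text \<open>
  Composition of functors is strictly associative, and so is composition of their module structures;
  both bracketings of three objects are equal and the associator is an identity.
\<close>

lemma dual_As:
  assumes "A \<in> Obj D" "B \<in> Obj D" "E \<in> Obj D"
  shows "As D A B E = Ide D (mcomp C M E (mcomp C M B A))"
  using assms D.iso_Ide(2)[of "mcomp C M E (mcomp C M B A)"] by (simp del: dual_simps(3))

text \<open>
  The module structure on \<open>V \<rhd> -\<close> is built from \<open>\<sigma>\<^sub>X\<^sup>-\<^sup>1\<close>, and each module functor axiom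
  is the image of a half-braiding axiom: naturality comes from naturality, associativity from the
  hexagon, and the unit law from the unit law.
\<close>

lemma theta_obj_dual:
  assumes hb: "half_braiding C V \<sigma>"
  shows "theta_obj C M (V, \<sigma>) \<in> Obj D"
proof -
  note [simp] = C.half_braiding_arr[OF hb]
  let ?s = "snd (theta_obj C M (V, \<sigma>))"
  interpret act: cat_functor M M "act_functor C M V" by (rule Rex_obj_functor[OF act_Rex]) simp
  have "module_functor C M M (act_functor C M V) ?s"
  proof
    fix X P assume [simp]: "X \<in> Obj C" "P \<in> Obj M"
    show "?s (X, P) \<in> Hom M (X \<rhd>\<^sub>o FO (act_functor C M V) P) (FO (act_functor C M V) (X \<rhd>\<^sub>o P))"
      by (simp add: Hom_def)
    show "is_iso M (?s (X, P))" by simp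
  next
    fix f X Y u P Q assume f: "f \<in> Hom C X Y" and "u \<in> Hom M P Q"
    then have [simp]: "f \<in> Arr C" "u \<in> Arr M" and
      XY: "X = Dom C f" "Y = Cod C f" "P = Dom M u" "Q = Cod M u"
      by (auto simp: Hom_def)
    have "inv_arr C (\<sigma> Y) \<cdot>\<^bsub>C\<^esub> (f \<otimes>\<^sub>a\<^bsub>C\<^esub> Ide C V) = (Ide C V \<otimes>\<^sub>a\<^bsub>C\<^esub> f) \<cdot>\<^bsub>C\<^esub> inv_arr C (\<sigma> X)"
      using C.iso_square_inv[OF half_braidingD(1)[OF hb f]] by (simp add: XY)
    then have \<sigma>: "(inv_arr C (\<sigma> Y) \<rhd>\<^sub>a Ide M Q) \<cdot> ((f \<otimes>\<^sub>a\<^bsub>C\<^esub> Ide C V) \<rhd>\<^sub>a u)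
        = ((Ide C V \<otimes>\<^sub>a\<^bsub>C\<^esub> f) \<rhd>\<^sub>a u) \<cdot> (inv_arr C (\<sigma> X) \<rhd>\<^sub>a Ide M P)"
      by (simp add: XY AA_merge)
    show "?s (Y, Q) \<cdot> (f \<rhd>\<^sub>a FA (act_functor C M V) u) = FA (act_functor C M V) (f \<rhd>\<^sub>a u) \<cdot> ?s (X, P)"
      by (simp add: XY inv_Mas_natural M.reassoc[OF \<sigma>[unfolded XY]] M.reassoc[OF Mas_natural'])
  next
    fix X Y P assume [simp]: "X \<in> Obj C" "Y \<in> Obj C" "P \<in> Obj M"
    let ?i = "\<lambda>f. inv_arr C f"
    have hex: "?i (As C V X Y) \<cdot>\<^bsub>C\<^esub> ?i (\<sigma> (X \<otimes>\<^sub>o\<^bsub>C\<^esub> Y))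
      = (?i (\<sigma> X) \<otimes>\<^sub>a\<^bsub>C\<^esub> Ide C Y) \<cdot>\<^bsub>C\<^esub> ?i (As C X V Y) \<cdot>\<^bsub>C\<^esub> (Ide C X \<otimes>\<^sub>a\<^bsub>C\<^esub> ?i (\<sigma> Y)) \<cdot>\<^bsub>C\<^esub> As C X Y V"
      using arg_cong[OF half_braidingD(3)[OF hb, of X Y], of "\<lambda>h. ?i h \<cdot>\<^bsub>C\<^esub> As C X Y V"] by simp
    have hexM: "(?i (As C V X Y) \<rhd>\<^sub>a Ide M P) \<cdot> (?i (\<sigma> (X \<otimes>\<^sub>o\<^bsub>C\<^esub> Y)) \<rhd>\<^sub>a Ide M P)
      = ((?i (\<sigma> X) \<otimes>\<^sub>a\<^bsub>C\<^esub> Ide C Y) \<rhd>\<^sub>a Ide M P) \<cdot> (?i (As C X V Y) \<rhd>\<^sub>a Ide M P) \<cdot>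
        ((Ide C X \<otimes>\<^sub>a\<^bsub>C\<^esub> ?i (\<sigma> Y)) \<rhd>\<^sub>a Ide M P) \<cdot> (As C X Y V \<rhd>\<^sub>a Ide M P)"
      by (simp add: AA_merge hex)
    \<comment> \<open>The three associators in the inverted hexagon are absorbed by one pentagon each, for the
      triples \<open>V, X, Y\<close>, \<open>X, V, Y\<close> and \<open>X, Y, V\<close>.\<close>
    show "FA (act_functor C M V) (Mas M X Y P) \<cdot> ?s (X \<otimes>\<^sub>o\<^bsub>C\<^esub> Y, P)
      = ?s (X, Y \<rhd>\<^sub>o P) \<cdot> (Ide C X \<rhd>\<^sub>a ?s (Y, P)) \<cdot> Mas M X Y (FO (act_functor C M V) P)"
      by (simp add: M.reassoc[OF Mas_pentagon_variants(1)] M.reassoc[OF hexM]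
          Mas_pentagon_variants(2) M.reassoc[OF Mas_natural'] AA_whisker
          M.reassoc[OF Mas_pentagon_variants(3)])
  next
    fix P assume [simp]: "P \<in> Obj M"
    have "Ru C V \<cdot>\<^bsub>C\<^esub> inv_arr C (\<sigma> (Unt C)) = Lu C V"
      unfolding half_braidingD(2)[OF hb, symmetric] by simp
    then have u: "(Ru C V \<rhd>\<^sub>a Ide M P) \<cdot> (inv_arr C (\<sigma> (Unt C)) \<rhd>\<^sub>a Ide M P) = Lu C V \<rhd>\<^sub>a Ide M P"
      by (simp add: AA_merge)
    show "FA (act_functor C M V) (Mun M P) \<cdot> ?s (Unt C, P) = Mun M (FO (act_functor C M V) P)"
      by (simp add: M.reassoc[OF Mas_triangle] M.reassoc[OF u] Lu_act)
  qed
  then show ?thesis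
    by (simp add: dual_obj_iff) (simp add: theta_obj_def)
qed

text \<open>
  That \<open>P \<mapsto> s (V, P)\<close> is a module transformation from \<open>V \<rhd> F\<close> to \<open>F (V \<rhd> -)\<close> compares two ways of
  moving \<open>X\<close> and \<open>V\<close> past \<open>F\<close> while exchanging them by \<open>\<sigma>\<^sub>X\<^sup>-\<^sup>1\<close>. Associativity of \<open>s\<close> rewrites them as
  \<open>s\<close> at \<open>X \<otimes> V\<close> and at \<open>V \<otimes> X\<close>, and naturality of \<open>s\<close> in its first argument, applied to
  \<open>\<sigma>\<^sub>X\<^sup>-\<^sup>1\<close>, identifies the two.
\<close>

lemma theta_braiding_inverse:
  assumes hb: "half_braiding C V \<sigma>" and F: "F \<in> Obj D"
  shows "inverse_arrows D
    (mcomp C M (theta_obj C M (V, \<sigma>)) F, mcomp C M F (theta_obj C M (V, \<sigma>)), \<lambda>P\<in>Obj M. snd F (V, P))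
    (theta_braiding C M LM (V, \<sigma>) F)"
proof -
  note [simp] = C.half_braiding_arr[OF hb] theta_obj_dual[OF hb]
  interpret F: module_functor C M M "fst F" "snd F" by (rule dual_objD) fact
  let ?s = "snd F"
  have "(mcomp C M (theta_obj C M (V, \<sigma>)) F, mcomp C M F (theta_obj C M (V, \<sigma>)),
      \<lambda>P\<in>Obj M. ?s (V, P)) \<in> Arr D"
  proof (rule dual_arrI)
    fix X P assume [simp]: "X \<in> Obj C" "P \<in> Obj M"
    have sV: "?s (X \<otimes>\<^sub>o\<^bsub>C\<^esub> V, P) \<cdot> inv_arr M (Mas M X V (FO (fst F) P))
      = FA (fst F) (inv_arr M (Mas M X V P)) \<cdot> ?s (X, V \<rhd>\<^sub>o P) \<cdot> (Ide C X \<rhd>\<^sub>a ?s (V, P))"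
    proof (rule M.iso_cancel_left[of "FA (fst F) (Mas M X V P)"])
      have inv: "FA (fst F) (Mas M X V P) \<cdot> FA (fst F) (inv_arr M (Mas M X V P))
          = Ide M (FO (fst F) (X \<rhd>\<^sub>o V \<rhd>\<^sub>o P))"
        using F.FA_Cmp'[of "inv_arr M (Mas M X V P)" "Mas M X V P"] by simp
      show "FA (fst F) (Mas M X V P) \<cdot> ?s (X \<otimes>\<^sub>o\<^bsub>C\<^esub> V, P) \<cdot> inv_arr M (Mas M X V (FO (fst F) P))
        = FA (fst F) (Mas M X V P) \<cdot> FA (fst F) (inv_arr M (Mas M X V P)) \<cdot>
          ?s (X, V \<rhd>\<^sub>o P) \<cdot> (Ide C X \<rhd>\<^sub>a ?s (V, P))"
        by (simp add: M.reassoc[OF F.s_assoc] M.reassoc[OF inv])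
    qed auto
    have \<sigma>: "?s (V \<otimes>\<^sub>o\<^bsub>C\<^esub> X, P) \<cdot> (inv_arr C (\<sigma> X) \<rhd>\<^sub>a Ide M (FO (fst F) P))
      = FA (fst F) (inv_arr C (\<sigma> X) \<rhd>\<^sub>a Ide M P) \<cdot> ?s (X \<otimes>\<^sub>o\<^bsub>C\<^esub> V, P)"
      using F.s_natural'[of "inv_arr C (\<sigma> X)" "Ide M P"] by simp
    show "snd (mcomp C M F (theta_obj C M (V, \<sigma>))) (X, P) \<cdot> (Ide C X \<rhd>\<^sub>a ?s (V, P))
      = ?s (V, X \<rhd>\<^sub>o P) \<cdot> snd (mcomp C M (theta_obj C M (V, \<sigma>)) F) (X, P)"
      by (simp add: M.reassoc3[OF F.s_assoc[symmetric]] M.reassoc[OF \<sigma>] sV)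
  qed (use F in \<open>auto simp: F.s_natural'\<close>)
  from dual_inverse_arrows[OF this] show ?thesis
    using F by (simp cong: restrict_cong)
qed

text \<open>
  Naturality of the half-braiding is the condition that arrows of the dual category are module
  transformations. The hexagon is the inverse of the formula for the module structure of a composite,
  and the unit law holds because the identity functor carries the identity structure.
\<close>

lemma half_braiding_theta:
  assumes hb: "half_braiding C V \<sigma>"
  shows "half_braiding D (theta_obj C M (V, \<sigma>)) (theta_braiding C M LM (V, \<sigma>))"
proof -
  note [simp] = C.half_braiding_arr[OF hb] theta_obj_dual[OF hb]
  let ?V = "theta_obj C M (V, \<sigma>)" and ?\<sigma> = "theta_braiding C M LM (V, \<sigma>)"
  have arr: "?\<sigma> F \<in> Hom D (TO D ?V F) (TO D F ?V)" if "F \<in> Obj D" for F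
    using theta_braiding_inverse[OF hb that] that by (simp add: inverse_arrows_def Hom_def)
  have iso: "is_iso D (?\<sigma> F)" if "F \<in> Obj D" for F
    using theta_braiding_inverse[OF hb that] D.inverse_arrows_iso(2) by blast
  have nat: "Cmp D (?\<sigma> G) (TA D (Ide D ?V) f) = Cmp D (TA D f (Ide D ?V)) (?\<sigma> F)"
    if fFG: "f \<in> Hom D F G" for f F G
  proof -
    obtain \<alpha> where f: "f = (F, G, \<alpha>)" and \<alpha>: "(F, G, \<alpha>) \<in> Arr D"
      using fFG by (cases f rule: prod_cases3) (simp add: Hom_def)
    note [simp] = dual_arrD(1-5)[OF \<alpha>]
    interpret F: module_functor C M M "fst F" "snd F" by (rule dual_objD) simp
    interpret G: module_functor C M M "fst G" "snd G" by (rule dual_objD) simp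
    have "inv_arr M (snd G (V, P)) \<cdot> \<alpha> (V \<rhd>\<^sub>o P) = (Ide C V \<rhd>\<^sub>a \<alpha> P) \<cdot> inv_arr M (snd F (V, P))"
      if [simp]: "P \<in> Obj M" for P
      using M.iso_square_inv[OF dual_arrD(8)[OF \<alpha>, of V P]] by simp
    then show ?thesis by (auto simp: f intro!: restrict_ext)
  qed
  have unit: "Cmp D (Lu D ?V) (?\<sigma> (Unt D)) = Ru D ?V"
    by (auto intro!: restrict_ext)
  have hex: "Cmp D (As D F G ?V) (Cmp D (?\<sigma> (TO D F G)) (As D ?V F G))
    = Cmp D (TA D (Ide D F) (?\<sigma> G)) (Cmp D (As D F ?V G) (TA D (?\<sigma> F) (Ide D G)))"
    if F: "F \<in> Obj D" and G: "G \<in> Obj D" for F G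
  proof -
    interpret F: module_functor C M M "fst F" "snd F" by (rule dual_objD) fact
    interpret G: module_functor C M M "fst G" "snd G" by (rule dual_objD) fact
    show ?thesis
      using F G by (auto simp: dual_As simp del: dual_simps(10) intro!: restrict_ext)
  qed
  show ?thesis
    unfolding half_braiding_def
    using arr iso nat unit hex by (auto simp: theta_braiding_def simp del: dual_simps)
qed

lemma theta_arr:
  assumes f: "((V, \<sigma>), (W, \<tau>), f) \<in> Arr (center C)"
  shows "(theta_obj C M (V, \<sigma>), theta_obj C M (W, \<tau>), \<lambda>P\<in>Obj M. f \<rhd>\<^sub>a Ide M P) \<in> Arr D"
proof -
  have hb: "half_braiding C V \<sigma>" "half_braiding C W \<tau>"
    and [simp]: "f \<in> Arr C" "Dom C f = V" "Cod C f = W"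
    using f by (auto simp: center_arr_iff Hom_def)
  note [simp] = hb[THEN C.half_braiding_arr(1)] hb[THEN C.half_braiding_arr(2)]
    hb[THEN C.half_braiding_arr(3)] hb[THEN C.half_braiding_arr(4)]
    hb[THEN C.half_braiding_arr(5)] hb[THEN theta_obj_dual]
  show ?thesis
  proof (rule dual_arrI)
    fix X P assume [simp]: "X \<in> Obj C" "P \<in> Obj M"
    have "(Ide C X \<otimes>\<^sub>a\<^bsub>C\<^esub> f) \<cdot>\<^bsub>C\<^esub> \<sigma> X = \<tau> X \<cdot>\<^bsub>C\<^esub> (f \<otimes>\<^sub>a\<^bsub>C\<^esub> Ide C X)"
      using f by (simp add: center_arr_iff)
    from C.iso_square_inv[OF this[symmetric]]
    have "inv_arr C (\<tau> X) \<cdot>\<^bsub>C\<^esub> (Ide C X \<otimes>\<^sub>a\<^bsub>C\<^esub> f) = (f \<otimes>\<^sub>a\<^bsub>C\<^esub> Ide C X) \<cdot>\<^bsub>C\<^esub> inv_arr C (\<sigma> X)"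
      by simp
    then have "(inv_arr C (\<tau> X) \<rhd>\<^sub>a Ide M P) \<cdot> ((Ide C X \<otimes>\<^sub>a\<^bsub>C\<^esub> f) \<rhd>\<^sub>a Ide M P)
      = ((f \<otimes>\<^sub>a\<^bsub>C\<^esub> Ide C X) \<rhd>\<^sub>a Ide M P) \<cdot> (inv_arr C (\<sigma> X) \<rhd>\<^sub>a Ide M P)"
      by (simp add: AA_merge)
    note \<sigma>\<tau> = M.reassoc[OF this]
    show "snd (theta_obj C M (W, \<tau>)) (X, P) \<cdot> (Ide C X \<rhd>\<^sub>a (f \<rhd>\<^sub>a Ide M P))
      = (f \<rhd>\<^sub>a Ide M (X \<rhd>\<^sub>o P)) \<cdot> snd (theta_obj C M (V, \<sigma>)) (X, P)"
      by (simp add: inv_Mas_natural \<sigma>\<tau> M.reassoc[OF Mas_natural'])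
  qed (auto simp: AA_merge)
qed

lemma cat_functor_theta: "cat_functor (center C) (center D) (theta C M LM)"
proof -
  interpret Z: category "center C" by (rule C.category_center)
  interpret ZD: category "center D" by (rule D.category_center)
  show ?thesis
  proof
    fix A assume "A \<in> Obj (center C)"
    then obtain V \<sigma> where A: "A = (V, \<sigma>)" and hb: "half_braiding C V \<sigma>" by (cases A) auto
    show "FO (theta C M LM) A \<in> Obj (center D)"
      using half_braiding_theta[OF hb] by (simp add: theta_def A)
    show "FA (theta C M LM) (Ide (center C) A) = Ide (center D) (FO (theta C M LM) A)"
      using C.half_braiding_arr(1)[OF hb] by (auto simp: theta_def A intro!: restrict_ext)
  next
    fix t A B assume "t \<in> Hom (center C) A B"
    then obtain V \<sigma> W \<tau> f where t: "t = ((V, \<sigma>), (W, \<tau>), f)" "A = (V, \<sigma>)" "B = (W, \<tau>)"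
      and f: "((V, \<sigma>), (W, \<tau>), f) \<in> Arr (center C)"
      by (cases A; cases B; cases t) (auto simp: Hom_def)
    have hb: "half_braiding C V \<sigma>" "half_braiding C W \<tau>"
      and [simp]: "f \<in> Arr C" "Dom C f = V" "Cod C f = W"
      using f by (auto simp: center_arr_iff Hom_def)
    note [simp] = hb[THEN C.half_braiding_arr(1)] hb[THEN theta_obj_dual]
    have "Cmp D (TA D (Ide D F) (theta_obj C M (V, \<sigma>), theta_obj C M (W, \<tau>), \<lambda>P\<in>Obj M. f \<rhd>\<^sub>a Ide M P))
        (theta_braiding C M LM (V, \<sigma>) F)
      = Cmp D (theta_braiding C M LM (W, \<tau>) F)
        (TA D (theta_obj C M (V, \<sigma>), theta_obj C M (W, \<tau>), \<lambda>P\<in>Obj M. f \<rhd>\<^sub>a Ide M P) (Ide D F))"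
      if F: "F \<in> Obj D" for F
    proof -
      interpret F: module_functor C M M "fst F" "snd F" by (rule dual_objD) fact
      have "(f \<rhd>\<^sub>a Ide M (FO (fst F) P)) \<cdot> inv_arr M (snd F (V, P))
        = inv_arr M (snd F (W, P)) \<cdot> FA (fst F) (f \<rhd>\<^sub>a Ide M P)" if [simp]: "P \<in> Obj M" for P
        using M.iso_square_inv[OF F.s_natural'[of f "Ide M P"]] by simp
      then show ?thesis using F by (auto simp: AA_merge intro!: restrict_ext)
    qed
    then show "FA (theta C M LM) t \<in> Hom (center D) (FO (theta C M LM) A) (FO (theta C M LM) B)"
      using hb[THEN half_braiding_theta] theta_arr[OF f]
      by (simp add: theta_def t Hom_def center_arr_iff del: dual_simps(3-10))
  next
    fix t t' A B E assume "t \<in> Hom (center C) A B" "t' \<in> Hom (center C) B E"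
    then obtain f f' where t: "t = (A, B, f)" "t' = (B, E, f')"
      and "f \<in> Hom C (fst A) (fst B)" "f' \<in> Hom C (fst B) (fst E)"
      by (cases A; cases B; cases E; cases t; cases t') (auto simp: Hom_def center_arr_iff)
    then show "FA (theta C M LM) (Cmp (center C) t' t)
      = Cmp (center D) (FA (theta C M LM) t') (FA (theta C M LM) t)"
      by (auto simp: theta_def t AA_merge Hom_def intro!: restrict_ext)
  qed
qed

end

section \<open>The right adjoint of the action functor\<close>

lemma regular_bimod_simps [simp]:
  "Obj (regular_bimod C) = Obj C" "Arr (regular_bimod C) = Arr C" "Dom (regular_bimod C) = Dom C"
  "Cod (regular_bimod C) = Cod C" "Ide (regular_bimod C) = Ide C" "Cmp (regular_bimod C) = Cmp C"
  "AO (regular_bimod C) = TO C" "AA (regular_bimod C) = TA C" "Mas (regular_bimod C) = As C"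
  "Mun (regular_bimod C) = Lu C" "RO (regular_bimod C) = TO C" "RA (regular_bimod C) = TA C"
  "Ras (regular_bimod C) = As C" "Run (regular_bimod C) = Ru C" "Mdl (regular_bimod C) = As C"
  "Hom (regular_bimod C) X Y = Hom C X Y" "is_iso (regular_bimod C) = is_iso C"
  by (simp_all add: regular_bimod_def Hom_def is_iso_def inverse_arrows_def fun_eq_iff)

lemma Rex_bimod_simps [simp]:
  "Obj (Rex_bimod C M LM) = Obj (Rex M LM)" "Arr (Rex_bimod C M LM) = Arr (Rex M LM)"
  "Dom (Rex_bimod C M LM) = Dom (Rex M LM)" "Cod (Rex_bimod C M LM) = Cod (Rex M LM)"
  "Ide (Rex_bimod C M LM) = Ide (Rex M LM)" "Cmp (Rex_bimod C M LM) = Cmp (Rex M LM)"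
  "AO (Rex_bimod C M LM) X F = fcomp M (act_functor C M X) F"
  "AA (Rex_bimod C M LM) f (F, G, \<alpha>) = (fcomp M (act_functor C M (Dom C f)) F,
     fcomp M (act_functor C M (Cod C f)) G, \<lambda>P\<in>Obj M. f \<rhd>\<^sub>a\<^bsub>M\<^esub> \<alpha> P)"
  "Mas (Rex_bimod C M LM) X Y F = (fcomp M (act_functor C M (X \<otimes>\<^sub>o\<^bsub>C\<^esub> Y)) F,
     fcomp M (act_functor C M X) (fcomp M (act_functor C M Y) F), \<lambda>P\<in>Obj M. Mas M X Y (FO F P))"
  "Mun (Rex_bimod C M LM) F = (fcomp M (act_functor C M (Unt C)) F, F, \<lambda>P\<in>Obj M. Mun M (FO F P))"
  "RO (Rex_bimod C M LM) F X = fcomp M F (act_functor C M X)"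
  "RA (Rex_bimod C M LM) (F, G, \<alpha>) f = (fcomp M F (act_functor C M (Dom C f)),
     fcomp M G (act_functor C M (Cod C f)),
     \<lambda>P\<in>Obj M. FA G (f \<rhd>\<^sub>a\<^bsub>M\<^esub> Ide M P) \<cdot>\<^bsub>M\<^esub> \<alpha> (Dom C f \<rhd>\<^sub>o\<^bsub>M\<^esub> P))"
  "Ras (Rex_bimod C M LM) F X Y = (fcomp M (fcomp M F (act_functor C M X)) (act_functor C M Y),
     fcomp M F (act_functor C M (X \<otimes>\<^sub>o\<^bsub>C\<^esub> Y)), \<lambda>P\<in>Obj M. FA F (inv_arr M (Mas M X Y P)))"
  "Run (Rex_bimod C M LM) F = (fcomp M F (act_functor C M (Unt C)), F, \<lambda>P\<in>Obj M. FA F (Mun M P))"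
  "Mdl (Rex_bimod C M LM) X F Y = (fcomp M (fcomp M (act_functor C M X) F) (act_functor C M Y),
     fcomp M (act_functor C M X) (fcomp M F (act_functor C M Y)),
     \<lambda>P\<in>Obj M. Ide M (X \<rhd>\<^sub>o\<^bsub>M\<^esub> FO F (Y \<rhd>\<^sub>o\<^bsub>M\<^esub> P)))"
  "Hom (Rex_bimod C M LM) F G = Hom (Rex M LM) F G"
  by (simp_all add: Rex_bimod_def Let_def Hom_def)

lemma rho_simps [simp]:
  "FO (rho C M LM) = act_functor C M"
  "FA (rho C M LM) f = (act_functor C M (Dom C f), act_functor C M (Cod C f),
     \<lambda>P\<in>Obj M. f \<rhd>\<^sub>a\<^bsub>M\<^esub> Ide M P)"
  "LS (rho C M LM) (X, Y) = (fcomp M (act_functor C M X) (act_functor C M Y),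
     act_functor C M (X \<otimes>\<^sub>o\<^bsub>C\<^esub> Y), \<lambda>P\<in>Obj M. inv_arr M (Mas M X Y P))"
  "RS (rho C M LM) (Y, X) = (fcomp M (act_functor C M Y) (act_functor C M X),
     act_functor C M (Y \<otimes>\<^sub>o\<^bsub>C\<^esub> X), \<lambda>P\<in>Obj M. inv_arr M (Mas M Y X P))"
  by (simp_all add: rho_def Let_def)

lemma bimodule_transD:
  assumes "bimodule_trans C P Q F G \<eta>" "X \<in> Obj C" "A \<in> Obj P"
  shows "LS G (X, A) \<cdot>\<^bsub>Q\<^esub> (Ide C X \<rhd>\<^sub>a\<^bsub>Q\<^esub> \<eta> A) = \<eta> (X \<rhd>\<^sub>o\<^bsub>P\<^esub> A) \<cdot>\<^bsub>Q\<^esub> LS F (X, A)"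
    and "RS G (A, X) \<cdot>\<^bsub>Q\<^esub> (\<eta> A \<lhd>\<^sub>a\<^bsub>Q\<^esub> Ide C X) = \<eta> (A \<lhd>\<^sub>o\<^bsub>P\<^esub> X) \<cdot>\<^bsub>Q\<^esub> RS F (A, X)"
  using assms by (auto simp: bimodule_trans_def module_trans_def)

context right_exact_action
begin

abbreviation lact where "lact X F \<equiv> fcomp M (act_functor C M X) F"
abbreviation ract where "ract F X \<equiv> fcomp M F (act_functor C M X)"

lemma Rex_obj_eqI:
  assumes "F \<in> Obj (Rex M LM)" "G \<in> Obj (Rex M LM)"
    and "\<And>P. P \<in> Obj M \<Longrightarrow> FO F P = FO G P" "\<And>u. u \<in> Arr M \<Longrightarrow> FA F u = FA G u"
  shows "F = G"
  using assms extensionalityI[of "FO F" "Obj M" "FO G"] extensionalityI[of "FA F" "Arr M" "FA G"]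
  by (intro func.equality) (auto simp: Rex_obj_iff)

lemma ract_lact:
  assumes [simp]: "X \<in> Obj C" "Y \<in> Obj C" "F \<in> Obj (Rex M LM)"
  shows "ract (lact X F) Y = lact X (ract F Y)"
proof -
  interpret F: cat_functor M M F by (rule Rex_obj_functor[OF assms(3)])
  show ?thesis by (rule Rex_obj_eqI) auto
qed

lemma lact_arr:
  assumes [simp]: "f \<in> Arr C" and \<alpha>: "(F, G, \<lambda>P\<in>Obj M. \<alpha> P) \<in> Arr (Rex M LM)" and "X = Dom C f" "Y = Cod C f"
  shows "(lact X F, lact Y G, \<lambda>P\<in>Obj M. f \<rhd>\<^sub>a \<alpha> P) \<in> Arr (Rex M LM)"
proof -
  note [simp] = M.Rex_restrict_arrD(1-5)[OF \<alpha>] assms(3,4)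
  interpret F: cat_functor M M F by (rule Rex_obj_functor[OF M.Rex_arrD(1)[OF \<alpha>]])
  interpret G: cat_functor M M G by (rule Rex_obj_functor[OF M.Rex_arrD(2)[OF \<alpha>]])
  show ?thesis
    by (rule M.Rex_arrI) (auto simp: AA_merge M.Rex_restrict_arrD(6)[OF \<alpha>])
qed

lemma ract_arr:
  assumes [simp]: "f \<in> Arr C" and \<alpha>: "(F, G, \<lambda>P\<in>Obj M. \<alpha> P) \<in> Arr (Rex M LM)" and "X = Dom C f" "Y = Cod C f"
  shows "(ract F X, ract G Y, \<lambda>P\<in>Obj M. FA G (f \<rhd>\<^sub>a Ide M P) \<cdot> \<alpha> (X \<rhd>\<^sub>o P)) \<in> Arr (Rex M LM)"
proof -
  note [simp] = M.Rex_restrict_arrD(1-5)[OF \<alpha>] assms(3,4)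
  interpret F: cat_functor M M F by (rule Rex_obj_functor[OF M.Rex_arrD(1)[OF \<alpha>]])
  interpret G: cat_functor M M G by (rule Rex_obj_functor[OF M.Rex_arrD(2)[OF \<alpha>]])
  show ?thesis
  proof (rule M.Rex_arrI)
    fix u assume [simp]: "u \<in> Arr M"
    have G: "FA G (f \<rhd>\<^sub>a Ide M (Cod M u)) \<cdot> FA G (Ide C X \<rhd>\<^sub>a u)
      = FA G (Ide C Y \<rhd>\<^sub>a u) \<cdot> FA G (f \<rhd>\<^sub>a Ide M (Dom M u))"
      by (simp add: AA_merge flip: G.FA_Cmp')
    show "(FA G (f \<rhd>\<^sub>a Ide M (Cod M u)) \<cdot> \<alpha> (X \<rhd>\<^sub>o Cod M u)) \<cdot> FA (ract F X) u
      = FA (ract G Y) u \<cdot> (FA G (f \<rhd>\<^sub>a Ide M (Dom M u)) \<cdot> \<alpha> (X \<rhd>\<^sub>o Dom M u))"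
      by (simp add: M.Rex_restrict_arrD(6)[OF \<alpha>] M.reassoc[OF G[unfolded assms(3,4)]])
  qed auto
qed

text \<open>
  For fixed \<open>X\<close>, a module structure \<open>s\<close> on \<open>F\<close> is an isomorphism from \<open>X \<rhd> F\<close> to \<open>F \<lhd> X\<close> in \<open>Rex(M)\<close>:
  a right exact module endofunctor is an object of \<open>Rex(M)\<close> with a kind of half-braiding. This is
  what the right adjoint transports to \<open>C\<close>.
\<close>

lemma structure_inverse:
  assumes A: "A \<in> Obj D" and [simp]: "X \<in> Obj C"
  shows "inverse_arrows (Rex M LM) (lact X (fst A), ract (fst A) X, \<lambda>P\<in>Obj M. snd A (X, P))
    (ract (fst A) X, lact X (fst A), \<lambda>P\<in>Obj M. inv_arr M (snd A (X, P)))"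
proof -
  interpret A: module_functor C M M "fst A" "snd A" by (rule dual_objD) fact
  note [simp] = dual_objD(2)[OF A]
  have "(lact X (fst A), ract (fst A) X, \<lambda>P\<in>Obj M. snd A (X, P)) \<in> Arr (Rex M LM)"
    by (rule M.Rex_arrI) (auto simp: A.s_natural')
  from M.Rex_inverse_arrows[OF this] show ?thesis by (simp cong: restrict_cong)
qed

lemma structure_arr:
  assumes "A \<in> Obj D" "X \<in> Obj C"
  shows "(lact X (fst A), ract (fst A) X, \<lambda>P\<in>Obj M. snd A (X, P)) \<in> Arr (Rex M LM)"
    and "(ract (fst A) X, lact X (fst A), \<lambda>P\<in>Obj M. inv_arr M (snd A (X, P))) \<in> Arr (Rex M LM)"
  using structure_inverse[OF assms] by (auto simp: inverse_arrows_def Hom_def)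

lemma rho_structure_inverse:
  assumes [simp]: "X \<in> Obj C" "Y \<in> Obj C"
  shows "inverse_arrows (Rex M LM)
    (act_functor C M (X \<otimes>\<^sub>o\<^bsub>C\<^esub> Y), lact X (act_functor C M Y), \<lambda>P\<in>Obj M. Mas M X Y P)
    (lact X (act_functor C M Y), act_functor C M (X \<otimes>\<^sub>o\<^bsub>C\<^esub> Y), \<lambda>P\<in>Obj M. inv_arr M (Mas M X Y P))"
proof -
  have "(act_functor C M (X \<otimes>\<^sub>o\<^bsub>C\<^esub> Y), lact X (act_functor C M Y), \<lambda>P\<in>Obj M. Mas M X Y P) \<in> Arr (Rex M LM)"
    using Mas_natural'[of "Ide C X" "Ide C Y"] by (intro M.Rex_arrI) auto
  from M.Rex_inverse_arrows[OF this] show ?thesis by (simp cong: restrict_cong)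
qed

lemma Rex_Mas_arr:
  assumes [simp]: "X \<in> Obj C" "Y \<in> Obj C" "F \<in> Obj (Rex M LM)"
  shows "(lact (X \<otimes>\<^sub>o\<^bsub>C\<^esub> Y) F, lact X (lact Y F), \<lambda>P\<in>Obj M. Mas M X Y (FO F P)) \<in> Arr (Rex M LM)"
    and "(ract (ract F X) Y, ract F (X \<otimes>\<^sub>o\<^bsub>C\<^esub> Y), \<lambda>P\<in>Obj M. FA F (inv_arr M (Mas M X Y P))) \<in> Arr (Rex M LM)"
    and "(lact (Unt C) F, F, \<lambda>P\<in>Obj M. Mun M (FO F P)) \<in> Arr (Rex M LM)"
    and "(ract F (Unt C), F, \<lambda>P\<in>Obj M. FA F (Mun M P)) \<in> Arr (Rex M LM)"
proof -
  interpret F: cat_functor M M F by (rule Rex_obj_functor[OF assms(3)])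
  have "Mas M X Y (FO F (Cod M u)) \<cdot> (Ide C (X \<otimes>\<^sub>o\<^bsub>C\<^esub> Y) \<rhd>\<^sub>a FA F u)
    = (Ide C X \<rhd>\<^sub>a (Ide C Y \<rhd>\<^sub>a FA F u)) \<cdot> Mas M X Y (FO F (Dom M u))" if "u \<in> Arr M" for u
    using that Mas_natural'[of "Ide C X" "Ide C Y" "FA F u" X Y "FO F (Cod M u)"] by simp
  then show "(lact (X \<otimes>\<^sub>o\<^bsub>C\<^esub> Y) F, lact X (lact Y F), \<lambda>P\<in>Obj M. Mas M X Y (FO F P)) \<in> Arr (Rex M LM)"
    by (intro M.Rex_arrI) auto
  have "FA F (inv_arr M (Mas M X Y (Cod M u))) \<cdot> FA F (Ide C X \<rhd>\<^sub>a (Ide C Y \<rhd>\<^sub>a u))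
    = FA F (Ide C (X \<otimes>\<^sub>o\<^bsub>C\<^esub> Y) \<rhd>\<^sub>a u) \<cdot> FA F (inv_arr M (Mas M X Y (Dom M u)))" if "u \<in> Arr M" for u
    using that inv_Mas_natural[of "Ide C X" "Ide C Y" u] by (simp flip: F.FA_Cmp')
  then show "(ract (ract F X) Y, ract F (X \<otimes>\<^sub>o\<^bsub>C\<^esub> Y), \<lambda>P\<in>Obj M. FA F (inv_arr M (Mas M X Y P))) \<in> Arr (Rex M LM)"
    by (intro M.Rex_arrI) auto
  show "(lact (Unt C) F, F, \<lambda>P\<in>Obj M. Mun M (FO F P)) \<in> Arr (Rex M LM)"
    by (intro M.Rex_arrI) (auto simp: Mun_natural')
  have "FA F (Mun M (Cod M u)) \<cdot> FA F (Ide C (Unt C) \<rhd>\<^sub>a u) = FA F u \<cdot> FA F (Mun M (Dom M u))"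
    if "u \<in> Arr M" for u
    using that by (simp add: Mun_natural' flip: F.FA_Cmp')
  then show "(ract F (Unt C), F, \<lambda>P\<in>Obj M. FA F (Mun M P)) \<in> Arr (Rex M LM)"
    by (intro M.Rex_arrI) auto
qed

end

locale action_right_adjoint = right_exact_action C M LM + adj: rho_right_adjoint C M LM R \<eta> \<epsilon>
  for C :: "('c, 'f, 'y) moncat_scheme" and M :: "('c, 'f, 'o, 'a, 'z) modcat_scheme" (structure)
    and LM :: "('k::field, 'o, 'a) lin"
    and R :: "('c, ('o, 'a) endo, ('o, 'a) endo_arr, 'c, 'f) bifunc"
    and \<eta> :: "'c \<Rightarrow> 'f" and \<epsilon> :: "('o, 'a) endo \<Rightarrow> ('o, 'a) endo_arr"
begin

text \<open>
  Equations in \<open>Rex(M)\<close> are checked at each object of \<open>M\<close>; by this rule they turn into equations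
  between arrows of \<open>C\<close>.
\<close>

lemma R_comp_eq:
  assumes "Cmp (Rex M LM) g f = Cmp (Rex M LM) k h"
    and "f \<in> Arr (Rex M LM)" "g \<in> Arr (Rex M LM)" "h \<in> Arr (Rex M LM)" "k \<in> Arr (Rex M LM)"
    and "Dom (Rex M LM) g = Cod (Rex M LM) f" "Dom (Rex M LM) k = Cod (Rex M LM) h"
  shows "FA R g \<cdot>\<^bsub>C\<^esub> FA R f = FA R k \<cdot>\<^bsub>C\<^esub> FA R h"
  using arg_cong[OF assms(1), of "FA R"] assms(2-) by (simp del: Rex_simps)

lemma R_arr [simp]:
  assumes "(F, G, \<alpha>) \<in> Arr (Rex M LM)"
  shows "FA R (F, G, \<alpha>) \<in> Arr C" "Dom C (FA R (F, G, \<alpha>)) = FO R F" "Cod C (FA R (F, G, \<alpha>)) = FO R G"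
  using adj.G.FA_arr[OF assms] by simp_all

lemma LS_arr [simp]:
  assumes "X \<in> Obj C" "F \<in> Obj (Rex M LM)"
  shows "LS R (X, F) \<in> Arr C" "Dom C (LS R (X, F)) = X \<otimes>\<^sub>o\<^bsub>C\<^esub> FO R F"
    "Cod C (LS R (X, F)) = FO R (lact X F)" "is_iso C (LS R (X, F))"
  using adj.s_hom[of X F] adj.s_iso[of X F] assms by (auto simp: Hom_def)

lemma RS_arr [simp]:
  assumes "X \<in> Obj C" "F \<in> Obj (Rex M LM)"
  shows "RS R (F, X) \<in> Arr C" "Dom C (RS R (F, X)) = FO R F \<otimes>\<^sub>o\<^bsub>C\<^esub> X"
    "Cod C (RS R (F, X)) = FO R (ract F X)" "is_iso C (RS R (F, X))"
  using adj.RS_hom[of X F] adj.RS_iso[of X F] assms by (auto simp: Hom_def)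

lemma LS_natural:
  assumes [simp]: "f \<in> Arr C" and \<alpha>: "(F, G, \<lambda>P\<in>Obj M. \<alpha> P) \<in> Arr (Rex M LM)" and "X = Dom C f" "Y = Cod C f"
  shows "LS R (Y, G) \<cdot>\<^bsub>C\<^esub> (f \<otimes>\<^sub>a\<^bsub>C\<^esub> FA R (F, G, \<lambda>P\<in>Obj M. \<alpha> P))
    = FA R (lact X F, lact Y G, \<lambda>P\<in>Obj M. f \<rhd>\<^sub>a \<alpha> P) \<cdot>\<^bsub>C\<^esub> LS R (X, F)"
  using adj.s_natural[of f X Y "(F, G, \<lambda>P\<in>Obj M. \<alpha> P)" F G] assms
  by (simp add: Hom_def cong: restrict_cong)

lemma RS_natural:
  assumes [simp]: "f \<in> Arr C" and \<alpha>: "(F, G, \<lambda>P\<in>Obj M. \<alpha> P) \<in> Arr (Rex M LM)" and "X = Dom C f" "Y = Cod C f"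
  shows "RS R (G, Y) \<cdot>\<^bsub>C\<^esub> (FA R (F, G, \<lambda>P\<in>Obj M. \<alpha> P) \<otimes>\<^sub>a\<^bsub>C\<^esub> f)
    = FA R (ract F X, ract G Y, \<lambda>P\<in>Obj M. FA G (f \<rhd>\<^sub>a Ide M P) \<cdot> \<alpha> (X \<rhd>\<^sub>o P)) \<cdot>\<^bsub>C\<^esub> RS R (F, X)"
  using adj.RS_natural[of f X Y "(F, G, \<lambda>P\<in>Obj M. \<alpha> P)" F G] assms
  by (simp add: Hom_def cong: restrict_cong)

lemma R_Ide [simp]:
  "F \<in> Obj (Rex M LM) \<Longrightarrow> FA R (F, F, \<lambda>P\<in>Obj M. Ide M (FO F P)) = Ide C (FO R F)"
  using adj.G.FA_Ide[of F] by simp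

text \<open>
  The constraint between left and right action on \<open>Rex(M)\<close> relates two equal functors and is an
  identity, so it disappears from the compatibility of the two structures of \<open>R\<close>.
\<close>

lemma LS_RS:
  assumes [simp]: "X \<in> Obj C" "Y \<in> Obj C" "F \<in> Obj (Rex M LM)"
  shows "RS R (lact X F, Y) \<cdot>\<^bsub>C\<^esub> (LS R (X, F) \<otimes>\<^sub>a\<^bsub>C\<^esub> Ide C Y)
    = LS R (X, ract F Y) \<cdot>\<^bsub>C\<^esub> (Ide C X \<otimes>\<^sub>a\<^bsub>C\<^esub> RS R (F, Y)) \<cdot>\<^bsub>C\<^esub> As C X (FO R F) Y"
proof -
  interpret F: cat_functor M M F by (rule Rex_obj_functor[OF assms(3)])
  have "(lact X (ract F Y), lact X (ract F Y), \<lambda>P\<in>Obj M. Ide M (X \<rhd>\<^sub>o FO F (Y \<rhd>\<^sub>o P)))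
    = (lact X (ract F Y), lact X (ract F Y), \<lambda>P\<in>Obj M. Ide M (FO (lact X (ract F Y)) P))"
    by (auto intro!: restrict_ext)
  then have "FA R (lact X (ract F Y), lact X (ract F Y), \<lambda>P\<in>Obj M. Ide M (X \<rhd>\<^sub>o FO F (Y \<rhd>\<^sub>o P)))
    = Ide C (FO R (lact X (ract F Y)))"
    by simp
  then show ?thesis
    using adj.LS_RS[of X Y F] by (simp add: ract_lact)
qed

end

section \<open>The functor \<open>Z(\<rho>\<^sup>r\<^sup>a)\<close>\<close>

context action_right_adjoint
begin

abbreviation Z_obj where "Z_obj \<equiv> Z_ra_obj C M LM R"
abbreviation inv_structure where
  "inv_structure A X \<equiv> (ract (fst A) X, lact X (fst A), \<lambda>P\<in>Obj M. inv_arr M (snd A (X, P)))"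

lemma Z_ra_obj_simps:
  "fst (Z_obj A) = FO R (fst A)"
  "X \<in> Obj C \<Longrightarrow> snd (Z_obj A) X
    = inv_arr C (LS R (X, fst A)) \<cdot>\<^bsub>C\<^esub> FA R (inv_structure A X) \<cdot>\<^bsub>C\<^esub> RS R (fst A, X)"
  by (simp_all add: Z_ra_obj_def split: prod.splits)

lemma R_inv_structure_iso:
  assumes "A \<in> Obj D" "X \<in> Obj C"
  shows "is_iso C (FA R (inv_structure A X))"
    and "inv_arr C (FA R (inv_structure A X)) = FA R (lact X (fst A), ract (fst A) X, \<lambda>P\<in>Obj M. snd A (X, P))"
proof -
  have inv: "inverse_arrows (Rex M LM) (lact X (fst A), ract (fst A) X, \<lambda>P\<in>Obj M. snd A (X, P)) (inv_structure A X)"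
    by (rule structure_inverse[OF assms])
  have iso: "is_iso (Rex M LM) (lact X (fst A), ract (fst A) X, \<lambda>P\<in>Obj M. snd A (X, P))"
    "is_iso (Rex M LM) (inv_structure A X)"
    using M.Rex.inverse_arrows_iso[OF inv] by auto
  have "inv_arr (Rex M LM) (inv_structure A X) = (lact X (fst A), ract (fst A) X, \<lambda>P\<in>Obj M. snd A (X, P))"
    using M.Rex.inv_arr_inv[OF iso(1)] M.Rex.inv_arr_eqI[OF inv] by simp
  then show "is_iso C (FA R (inv_structure A X))"
    "inv_arr C (FA R (inv_structure A X)) = FA R (lact X (fst A), ract (fst A) X, \<lambda>P\<in>Obj M. snd A (X, P))"
    using adj.G.FA_iso[OF iso(2)] by simp_all
qed

text \<open>
  The last equation is the definition of the half-braiding freed from the inverse of \<open>LS R\<close>; the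
  proofs below compute with the half-braiding through it.
\<close>

lemma Z_ra_braiding_arr:
  assumes A: "A \<in> Obj D" and X: "X \<in> Obj C"
  shows "snd (Z_obj A) X \<in> Arr C" "Dom C (snd (Z_obj A) X) = FO R (fst A) \<otimes>\<^sub>o\<^bsub>C\<^esub> X"
    "Cod C (snd (Z_obj A) X) = X \<otimes>\<^sub>o\<^bsub>C\<^esub> FO R (fst A)" "is_iso C (snd (Z_obj A) X)"
    "LS R (X, fst A) \<cdot>\<^bsub>C\<^esub> snd (Z_obj A) X = FA R (inv_structure A X) \<cdot>\<^bsub>C\<^esub> RS R (fst A, X)"
  using X dual_objD(2)[OF A] structure_arr[OF A X] R_inv_structure_iso[OF A X]
  by (simp_all add: Z_ra_obj_simps)

text \<open>
  Write \<open>t\<^sub>X : F \<lhd> X \<rightarrow> X \<rhd> F\<close> for the inverse of the module structure. The axioms of a module functor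
  say that \<open>t\<close> is natural, unital and satisfies a hexagon in the bimodule category \<open>Rex(M)\<close>. Applying
  \<open>R\<close>, and using that \<open>LS R\<close> and \<open>RS R\<close> are natural and compatible with the constraints and with each
  other, yields the corresponding axiom in \<open>C\<close>.
\<close>

lemma half_braiding_Z_ra:
  assumes A: "A \<in> Obj D"
  shows "half_braiding C (fst (Z_obj A)) (snd (Z_obj A))"
proof -
  let ?F = "fst A" and ?\<sigma> = "snd (Z_obj A)"
  interpret A: module_functor C M M ?F "snd A" by (rule dual_objD[OF A])
  have F [simp]: "?F \<in> Obj (Rex M LM)" by (rule dual_objD[OF A])
  note [simp] = Z_ra_braiding_arr(1-4)[OF A] structure_arr[OF A]
  note LS\<sigma> = Z_ra_braiding_arr(5)[OF A]
  have nat: "?\<sigma> Y \<cdot>\<^bsub>C\<^esub> (Ide C (FO R ?F) \<otimes>\<^sub>a\<^bsub>C\<^esub> f) = (f \<otimes>\<^sub>a\<^bsub>C\<^esub> Ide C (FO R ?F)) \<cdot>\<^bsub>C\<^esub> ?\<sigma> X"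
    if "f \<in> Hom C X Y" for f X Y
  proof -
    have [simp]: "f \<in> Arr C" "Dom C f = X" "Cod C f = Y" using that by (auto simp: Hom_def)
    have [simp]: "X \<in> Obj C" "Y \<in> Obj C"
      using C.Dom_obj[of f] C.Cod_obj[of f] by auto
    let ?l = "(lact X ?F, lact Y ?F, \<lambda>P\<in>Obj M. f \<rhd>\<^sub>a Ide M (FO ?F P))"
    let ?r = "(ract ?F X, ract ?F Y,
      \<lambda>P\<in>Obj M. FA ?F (f \<rhd>\<^sub>a Ide M P) \<cdot> Ide M (FO ?F (X \<rhd>\<^sub>o P)))"
    have [simp]: "?l \<in> Arr (Rex M LM)" "?r \<in> Arr (Rex M LM)"
      using lact_arr[OF _ M.Rex_Ide_arr[OF F], of f X Y] ract_arr[OF _ M.Rex_Ide_arr[OF F], of f X Y]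
      by simp_all
    have "FA R (inv_structure A Y) \<cdot>\<^bsub>C\<^esub> FA R ?r = FA R ?l \<cdot>\<^bsub>C\<^esub> FA R (inv_structure A X)"
    proof (rule R_comp_eq)
      have "inv_arr M (snd A (Y, P)) \<cdot> FA ?F (f \<rhd>\<^sub>a Ide M P)
        = (f \<rhd>\<^sub>a Ide M (FO ?F P)) \<cdot> inv_arr M (snd A (X, P))" if [simp]: "P \<in> Obj M" for P
        using M.iso_square_inv[OF A.s_natural'[of f "Ide M P"]] by simp
      then show "Cmp (Rex M LM) (inv_structure A Y) ?r = Cmp (Rex M LM) ?l (inv_structure A X)"
        by (auto intro!: restrict_ext)
    qed simp_all
    note s = this
    have l: "LS R (Y, ?F) \<cdot>\<^bsub>C\<^esub> (f \<otimes>\<^sub>a\<^bsub>C\<^esub> Ide C (FO R ?F)) = FA R ?l \<cdot>\<^bsub>C\<^esub> LS R (X, ?F)"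
      using LS_natural[OF _ M.Rex_Ide_arr[OF F], of f X Y] by simp
    have r: "RS R (?F, Y) \<cdot>\<^bsub>C\<^esub> (Ide C (FO R ?F) \<otimes>\<^sub>a\<^bsub>C\<^esub> f) = FA R ?r \<cdot>\<^bsub>C\<^esub> RS R (?F, X)"
      using RS_natural[OF _ M.Rex_Ide_arr[OF F], of f X Y] by simp
    show ?thesis
      by (rule C.iso_cancel_left[of "LS R (Y, ?F)"])
        (simp_all add: C.reassoc[OF LS\<sigma>] LS\<sigma> r C.reassoc[OF s] C.reassoc[OF l])
  qed
  have unit: "Lu C (FO R ?F) \<cdot>\<^bsub>C\<^esub> ?\<sigma> (Unt C) = Ru C (FO R ?F)"
  proof -
    note [simp] = Rex_Mas_arr(3,4)[OF C.Unt_in C.Unt_in F]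
    have "FA R (lact (Unt C) ?F, ?F, \<lambda>P\<in>Obj M. Mun M (FO ?F P)) \<cdot>\<^bsub>C\<^esub> FA R (inv_structure A (Unt C))
      = FA R (ract ?F (Unt C), ?F, \<lambda>P\<in>Obj M. FA ?F (Mun M P)) \<cdot>\<^bsub>C\<^esub>
        FA R (Ide (Rex M LM) (ract ?F (Unt C)))"
    proof (rule R_comp_eq)
      have "Mun M (FO ?F P) \<cdot> inv_arr M (snd A (Unt C, P)) = FA ?F (Mun M P)" if [simp]: "P \<in> Obj M" for P
        unfolding A.s_unit[OF that, symmetric] by simp
      then show "Cmp (Rex M LM) (lact (Unt C) ?F, ?F, \<lambda>P\<in>Obj M. Mun M (FO ?F P)) (inv_structure A (Unt C))
        = Cmp (Rex M LM) (ract ?F (Unt C), ?F, \<lambda>P\<in>Obj M. FA ?F (Mun M P)) (Ide (Rex M LM) (ract ?F (Unt C)))"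
        by (auto intro!: restrict_ext)
    qed (simp_all add: M.Rex_Ide_arr)
    then have s: "FA R (lact (Unt C) ?F, ?F, \<lambda>P\<in>Obj M. Mun M (FO ?F P)) \<cdot>\<^bsub>C\<^esub> FA R (inv_structure A (Unt C))
      = FA R (ract ?F (Unt C), ?F, \<lambda>P\<in>Obj M. FA ?F (Mun M P))"
      by simp
    have "Lu C (FO R ?F) = FA R (lact (Unt C) ?F, ?F, \<lambda>P\<in>Obj M. Mun M (FO ?F P)) \<cdot>\<^bsub>C\<^esub> LS R (Unt C, ?F)"
      and "Ru C (FO R ?F) = FA R (ract ?F (Unt C), ?F, \<lambda>P\<in>Obj M. FA ?F (Mun M P)) \<cdot>\<^bsub>C\<^esub> RS R (?F, Unt C)"
      using adj.s_unit[of ?F] adj.RS_unit[of ?F] by simp_all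
    then show ?thesis by (simp add: LS\<sigma> C.reassoc[OF s])
  qed
  have hex: "As C X Y (FO R ?F) \<cdot>\<^bsub>C\<^esub> ?\<sigma> (X \<otimes>\<^sub>o\<^bsub>C\<^esub> Y) \<cdot>\<^bsub>C\<^esub> As C (FO R ?F) X Y
    = (Ide C X \<otimes>\<^sub>a\<^bsub>C\<^esub> ?\<sigma> Y) \<cdot>\<^bsub>C\<^esub> As C X (FO R ?F) Y \<cdot>\<^bsub>C\<^esub> (?\<sigma> X \<otimes>\<^sub>a\<^bsub>C\<^esub> Ide C Y)"
    if [simp]: "X \<in> Obj C" "Y \<in> Obj C" for X Y
  proof -
    let ?M = "(lact (X \<otimes>\<^sub>o\<^bsub>C\<^esub> Y) ?F, lact X (lact Y ?F), \<lambda>P\<in>Obj M. Mas M X Y (FO ?F P))"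
    let ?N = "(ract (ract ?F X) Y, ract ?F (X \<otimes>\<^sub>o\<^bsub>C\<^esub> Y), \<lambda>P\<in>Obj M. FA ?F (inv_arr M (Mas M X Y P)))"
    let ?l = "(lact X (ract ?F Y), lact X (lact Y ?F),
      \<lambda>P\<in>Obj M. Ide C X \<rhd>\<^sub>a inv_arr M (snd A (Y, P)))"
    let ?r = "(ract (ract ?F X) Y, lact X (ract ?F Y),
      \<lambda>P\<in>Obj M. FA (lact X ?F) (Ide C Y \<rhd>\<^sub>a Ide M P) \<cdot> inv_arr M (snd A (X, Y \<rhd>\<^sub>o P)))"
    have [simp]: "?M \<in> Arr (Rex M LM)" "?N \<in> Arr (Rex M LM)"
      by (rule Rex_Mas_arr; simp)+
    have [simp]: "?l \<in> Arr (Rex M LM)"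
      by (rule lact_arr) simp_all
    have [simp]: "?r \<in> Arr (Rex M LM)"
      using ract_arr[of "Ide C Y", OF _ structure_arr(2)[OF A, of X]] by (simp add: ract_lact)
    have s: "FA R ?M \<cdot>\<^bsub>C\<^esub> FA R (inv_structure A (X \<otimes>\<^sub>o\<^bsub>C\<^esub> Y)) \<cdot>\<^bsub>C\<^esub> FA R ?N = FA R ?l \<cdot>\<^bsub>C\<^esub> FA R ?r"
    proof -
      have "FA R (inv_structure A (X \<otimes>\<^sub>o\<^bsub>C\<^esub> Y)) \<cdot>\<^bsub>C\<^esub> FA R ?N = FA R (Cmp (Rex M LM) (inv_structure A (X \<otimes>\<^sub>o\<^bsub>C\<^esub> Y)) ?N)"
        by (rule adj.G.FA_Cmp'[symmetric]) simp_all
      moreover have c: "Cmp (Rex M LM) (inv_structure A (X \<otimes>\<^sub>o\<^bsub>C\<^esub> Y)) ?N \<in> Arr (Rex M LM)"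
        by (rule M.Rex.Cmp_arr) simp_all
      moreover have "FA R ?M \<cdot>\<^bsub>C\<^esub> FA R (Cmp (Rex M LM) (inv_structure A (X \<otimes>\<^sub>o\<^bsub>C\<^esub> Y)) ?N) = FA R ?l \<cdot>\<^bsub>C\<^esub> FA R ?r"
      proof (rule R_comp_eq)
        have "Mas M X Y (FO ?F P) \<cdot> inv_arr M (snd A (X \<otimes>\<^sub>o\<^bsub>C\<^esub> Y, P)) \<cdot> FA ?F (inv_arr M (Mas M X Y P))
          = (Ide C X \<rhd>\<^sub>a inv_arr M (snd A (Y, P))) \<cdot> inv_arr M (snd A (X, Y \<rhd>\<^sub>o P))"
          if [simp]: "P \<in> Obj M" for P
          using arg_cong[OF A.s_assoc[of X Y P], of "\<lambda>h. Mas M X Y (FO ?F P) \<cdot> inv_arr M h"] by simp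
        then show "Cmp (Rex M LM) ?M (Cmp (Rex M LM) (inv_structure A (X \<otimes>\<^sub>o\<^bsub>C\<^esub> Y)) ?N) = Cmp (Rex M LM) ?l ?r"
          by (auto intro!: restrict_ext)
      qed (use c in simp_all)
      ultimately show ?thesis by simp
    qed
    have l: "LS R (X, lact Y ?F) \<cdot>\<^bsub>C\<^esub> (Ide C X \<otimes>\<^sub>a\<^bsub>C\<^esub> FA R (inv_structure A Y)) = FA R ?l \<cdot>\<^bsub>C\<^esub> LS R (X, ract ?F Y)"
      by (rule LS_natural) simp_all
    have r: "RS R (lact X ?F, Y) \<cdot>\<^bsub>C\<^esub> (FA R (inv_structure A X) \<otimes>\<^sub>a\<^bsub>C\<^esub> Ide C Y) = FA R ?r \<cdot>\<^bsub>C\<^esub> RS R (ract ?F X, Y)"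
      using RS_natural[of "Ide C Y", OF _ structure_arr(2)[OF A, of X]] by (simp add: ract_lact)
    have assoc: "FA R ?M \<cdot>\<^bsub>C\<^esub> LS R (X \<otimes>\<^sub>o\<^bsub>C\<^esub> Y, ?F)
      = LS R (X, lact Y ?F) \<cdot>\<^bsub>C\<^esub> (Ide C X \<otimes>\<^sub>a\<^bsub>C\<^esub> LS R (Y, ?F)) \<cdot>\<^bsub>C\<^esub> As C X Y (FO R ?F)"
      using adj.s_assoc[of X Y ?F] by simp
    have rassoc: "FA R ?N \<cdot>\<^bsub>C\<^esub> RS R (ract ?F X, Y) \<cdot>\<^bsub>C\<^esub> (RS R (?F, X) \<otimes>\<^sub>a\<^bsub>C\<^esub> Ide C Y)
      = RS R (?F, X \<otimes>\<^sub>o\<^bsub>C\<^esub> Y) \<cdot>\<^bsub>C\<^esub> As C (FO R ?F) X Y"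
      using adj.RS_assoc[of X Y ?F] by simp
    \<comment> \<open>Both sides of the hexagon are compared after composing with the isomorphism that moves \<open>X\<close>
      and \<open>Y\<close> under \<open>R\<close>; there \<open>LS R (X, -) \<cdot> \<sigma> X\<close> can be replaced.\<close>
    let ?e = "LS R (X, lact Y ?F) \<cdot>\<^bsub>C\<^esub> (Ide C X \<otimes>\<^sub>a\<^bsub>C\<^esub> LS R (Y, ?F))"
    have "?e \<cdot>\<^bsub>C\<^esub> As C X Y (FO R ?F) \<cdot>\<^bsub>C\<^esub> ?\<sigma> (X \<otimes>\<^sub>o\<^bsub>C\<^esub> Y) \<cdot>\<^bsub>C\<^esub> As C (FO R ?F) X Y
      = FA R ?M \<cdot>\<^bsub>C\<^esub> LS R (X \<otimes>\<^sub>o\<^bsub>C\<^esub> Y, ?F) \<cdot>\<^bsub>C\<^esub> ?\<sigma> (X \<otimes>\<^sub>o\<^bsub>C\<^esub> Y) \<cdot>\<^bsub>C\<^esub> As C (FO R ?F) X Y"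
      by (simp add: C.reassoc[OF assoc])
    also have "\<dots> = FA R ?M \<cdot>\<^bsub>C\<^esub> FA R (inv_structure A (X \<otimes>\<^sub>o\<^bsub>C\<^esub> Y)) \<cdot>\<^bsub>C\<^esub>
        RS R (?F, X \<otimes>\<^sub>o\<^bsub>C\<^esub> Y) \<cdot>\<^bsub>C\<^esub> As C (FO R ?F) X Y"
      by (simp add: C.reassoc[OF LS\<sigma>])
    also have "\<dots> = FA R ?l \<cdot>\<^bsub>C\<^esub> FA R ?r \<cdot>\<^bsub>C\<^esub> RS R (ract ?F X, Y) \<cdot>\<^bsub>C\<^esub> (RS R (?F, X) \<otimes>\<^sub>a\<^bsub>C\<^esub> Ide C Y)"
      unfolding rassoc[symmetric] by (simp add: C.reassoc3[OF s])
    also have "\<dots> = FA R ?l \<cdot>\<^bsub>C\<^esub> RS R (lact X ?F, Y) \<cdot>\<^bsub>C\<^esub> ((FA R (inv_structure A X) \<cdot>\<^bsub>C\<^esub> RS R (?F, X)) \<otimes>\<^sub>a\<^bsub>C\<^esub> Ide C Y)"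
      by (simp add: C.reassoc[OF r[symmetric]] C.tensor_merge)
    also have "\<dots> = FA R ?l \<cdot>\<^bsub>C\<^esub> RS R (lact X ?F, Y) \<cdot>\<^bsub>C\<^esub> (LS R (X, ?F) \<otimes>\<^sub>a\<^bsub>C\<^esub> Ide C Y) \<cdot>\<^bsub>C\<^esub> (?\<sigma> X \<otimes>\<^sub>a\<^bsub>C\<^esub> Ide C Y)"
      by (simp add: C.tensor_merge LS\<sigma>)
    also have "\<dots> = FA R ?l \<cdot>\<^bsub>C\<^esub> LS R (X, ract ?F Y) \<cdot>\<^bsub>C\<^esub> (Ide C X \<otimes>\<^sub>a\<^bsub>C\<^esub> RS R (?F, Y)) \<cdot>\<^bsub>C\<^esub>
        As C X (FO R ?F) Y \<cdot>\<^bsub>C\<^esub> (?\<sigma> X \<otimes>\<^sub>a\<^bsub>C\<^esub> Ide C Y)"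
      by (simp add: C.reassoc[OF LS_RS])
    also have "\<dots> = LS R (X, lact Y ?F) \<cdot>\<^bsub>C\<^esub> (Ide C X \<otimes>\<^sub>a\<^bsub>C\<^esub> (FA R (inv_structure A Y) \<cdot>\<^bsub>C\<^esub> RS R (?F, Y))) \<cdot>\<^bsub>C\<^esub>
        As C X (FO R ?F) Y \<cdot>\<^bsub>C\<^esub> (?\<sigma> X \<otimes>\<^sub>a\<^bsub>C\<^esub> Ide C Y)"
      by (simp add: C.reassoc[OF l[symmetric]] C.tensor_merge_assoc)
    also have "\<dots> = ?e \<cdot>\<^bsub>C\<^esub> (Ide C X \<otimes>\<^sub>a\<^bsub>C\<^esub> ?\<sigma> Y) \<cdot>\<^bsub>C\<^esub> As C X (FO R ?F) Y \<cdot>\<^bsub>C\<^esub> (?\<sigma> X \<otimes>\<^sub>a\<^bsub>C\<^esub> Ide C Y)"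
      by (simp add: C.tensor_merge_assoc LS\<sigma>)
    finally show ?thesis
      by (rule C.iso_cancel_left) simp_all
  qed
  have "snd (Z_obj A) \<in> extensional (Obj C)"
    by (simp add: Z_ra_obj_def split: prod.splits)
  then show ?thesis
    using nat unit hex by (simp add: half_braiding_def Z_ra_obj_simps(1) Hom_def)
qed

lemma Z_obj_center: "A \<in> Obj D \<Longrightarrow> Z_obj A \<in> Obj (center C)"
  using half_braiding_Z_ra[of A] by (cases "Z_obj A") simp

text \<open>
  A module transformation \<open>\<alpha>\<close> commutes with the inverse module structures in \<open>Rex(M)\<close>; naturality of
  \<open>LS R\<close> and \<open>RS R\<close> at \<open>\<alpha>\<close> carries this over to the half-braidings.
\<close>

lemma Z_ra_arr:
  assumes \<alpha>: "(A, B, \<alpha>) \<in> Arr D"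
  shows "(Z_obj A, Z_obj B, FA R (fst A, fst B, \<alpha>)) \<in> Arr (center C)"
proof -
  let ?F = "fst A" and ?G = "fst B"
  have A: "A \<in> Obj D" and B: "B \<in> Obj D" by (rule dual_arrD[OF \<alpha>])+
  interpret A: module_functor C M M ?F "snd A" by (rule dual_objD[OF A])
  interpret B: module_functor C M M ?G "snd B" by (rule dual_objD[OF B])
  note [simp] = dual_objD(2)[OF A] dual_objD(2)[OF B] dual_arrD(3-5)[OF \<alpha>]
    Z_ra_braiding_arr(1-4)[OF A] structure_arr[OF A] Z_ra_braiding_arr(1-4)[OF B] structure_arr[OF B]
  note LS\<sigma> = Z_ra_braiding_arr(5)[OF A] and LS\<tau> = Z_ra_braiding_arr(5)[OF B]
  have restr: "(\<lambda>P\<in>Obj M. \<alpha> P) = \<alpha>" by (rule extensional_restrict[OF dual_arrD(6)[OF \<alpha>]])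
  have \<alpha>R [simp]: "(?F, ?G, \<alpha>) \<in> Arr (Rex M LM)" using \<alpha> by (simp add: dual_arr_iff)
  then have \<alpha>R': "(?F, ?G, \<lambda>P\<in>Obj M. \<alpha> P) \<in> Arr (Rex M LM)" by (simp add: restr)
  have "(Ide C X \<otimes>\<^sub>a\<^bsub>C\<^esub> FA R (?F, ?G, \<alpha>)) \<cdot>\<^bsub>C\<^esub> snd (Z_obj A) X
    = snd (Z_obj B) X \<cdot>\<^bsub>C\<^esub> (FA R (?F, ?G, \<alpha>) \<otimes>\<^sub>a\<^bsub>C\<^esub> Ide C X)" if [simp]: "X \<in> Obj C" for X
  proof -
    let ?l = "(lact X ?F, lact X ?G, \<lambda>P\<in>Obj M. Ide C X \<rhd>\<^sub>a \<alpha> P)"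
    let ?r = "(ract ?F X, ract ?G X, \<lambda>P\<in>Obj M. FA ?G (Ide C X \<rhd>\<^sub>a Ide M P) \<cdot> \<alpha> (X \<rhd>\<^sub>o P))"
    have [simp]: "?l \<in> Arr (Rex M LM)" "?r \<in> Arr (Rex M LM)"
      using lact_arr[OF _ \<alpha>R', of "Ide C X" X X] ract_arr[OF _ \<alpha>R', of "Ide C X" X X] by simp_all
    have l: "LS R (X, ?G) \<cdot>\<^bsub>C\<^esub> (Ide C X \<otimes>\<^sub>a\<^bsub>C\<^esub> FA R (?F, ?G, \<alpha>)) = FA R ?l \<cdot>\<^bsub>C\<^esub> LS R (X, ?F)"
      using LS_natural[OF _ \<alpha>R', of "Ide C X" X X] by (simp add: restr)
    have r: "RS R (?G, X) \<cdot>\<^bsub>C\<^esub> (FA R (?F, ?G, \<alpha>) \<otimes>\<^sub>a\<^bsub>C\<^esub> Ide C X) = FA R ?r \<cdot>\<^bsub>C\<^esub> RS R (?F, X)"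
      using RS_natural[OF _ \<alpha>R', of "Ide C X" X X] by (simp add: restr)
    have s: "FA R ?l \<cdot>\<^bsub>C\<^esub> FA R (inv_structure A X) = FA R (inv_structure B X) \<cdot>\<^bsub>C\<^esub> FA R ?r"
    proof (rule R_comp_eq)
      have "(Ide C X \<rhd>\<^sub>a \<alpha> P) \<cdot> inv_arr M (snd A (X, P)) = inv_arr M (snd B (X, P)) \<cdot> \<alpha> (X \<rhd>\<^sub>o P)"
        if [simp]: "P \<in> Obj M" for P
        using M.iso_square_inv[OF dual_arrD(8)[OF \<alpha>, of X P]] by simp
      then show "Cmp (Rex M LM) ?l (inv_structure A X) = Cmp (Rex M LM) (inv_structure B X) ?r"
        by (auto intro!: restrict_ext)
    qed simp_all
    show ?thesis
      by (rule C.iso_cancel_left[of "LS R (X, ?G)"])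
        (simp_all add: C.reassoc[OF l] LS\<sigma> C.reassoc[OF LS\<tau>] r C.reassoc[OF s])
  qed
  then show ?thesis
    using half_braiding_Z_ra[OF A] half_braiding_Z_ra[OF B]
    by (cases "Z_obj A"; cases "Z_obj B")
      (use Z_ra_obj_simps(1)[of A] Z_ra_obj_simps(1)[of B] in \<open>simp add: center_arr_iff Hom_def\<close>)
qed

lemma cat_functor_Z_ra: "cat_functor D (center C) (Z_ra C M LM R)"
proof -
  interpret Z: category "center C" by (rule C.category_center)
  show ?thesis
  proof
    fix A assume A: "A \<in> Obj D"
    note [simp] = dual_objD(2)[OF A]
    show "FO (Z_ra C M LM R) A \<in> Obj (center C)" using Z_obj_center[OF A] by (simp add: Z_ra_def)
    show "FA (Z_ra C M LM R) (Ide D A) = Ide (center C) (FO (Z_ra C M LM R) A)"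
      by (simp add: Z_ra_def Z_ra_obj_simps(1))
  next
    fix f A B assume f: "f \<in> Hom D A B"
    then obtain \<alpha> where \<alpha>: "f = (A, B, \<alpha>)" "(A, B, \<alpha>) \<in> Arr D"
      by (cases f rule: prod_cases3) (simp add: Hom_def)
    show "FA (Z_ra C M LM R) f \<in> Hom (center C) (FO (Z_ra C M LM R) A) (FO (Z_ra C M LM R) B)"
      using Z_ra_arr[OF \<alpha>(2)] by (simp add: Z_ra_def Hom_def \<alpha>(1))
  next
    fix f g A B E assume f: "f \<in> Hom D A B" and g: "g \<in> Hom D B E"
    obtain \<alpha> where f': "f = (A, B, \<alpha>)" "(A, B, \<alpha>) \<in> Arr D"
      using f by (cases f rule: prod_cases3) (simp add: Hom_def)
    obtain \<beta> where g': "g = (B, E, \<beta>)" "(B, E, \<beta>) \<in> Arr D"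
      using g by (cases g rule: prod_cases3) (simp add: Hom_def)
    have "FA R (Cmp (Rex M LM) (fst B, fst E, \<beta>) (fst A, fst B, \<alpha>))
      = FA R (fst B, fst E, \<beta>) \<cdot>\<^bsub>C\<^esub> FA R (fst A, fst B, \<alpha>)"
      using f'(2) g'(2) by (intro adj.G.FA_Cmp') (simp_all add: dual_arr_iff)
    then show "FA (Z_ra C M LM R) (Cmp D g f)
      = Cmp (center C) (FA (Z_ra C M LM R) g) (FA (Z_ra C M LM R) f)"
      by (cases A; cases B; cases E) (simp add: f'(1) g'(1) Z_ra_def)
  qed
qed

end

section \<open>The unit and the counit respect the additional structure\<close>

context action_right_adjoint
begin

lemma unit_arr [simp]:
  assumes "V \<in> Obj C"
  shows "\<eta> V \<in> Arr C" "Dom C (\<eta> V) = V" "Cod C (\<eta> V) = FO R (act_functor C M V)"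
  using adj.unit.component_arr[OF assms] assms by simp_all

text \<open>
  The inverse module structure of \<open>V \<rhd> -\<close> is \<open>\<rho> \<sigma>\<^sub>X\<close> between the left and the right bimodule structure
  of \<open>\<rho>\<close> (equation \<open>s\<close> in the proof). As \<open>\<eta>\<close> is a transformation of left and right modules, both
  \<open>(1 \<otimes> \<eta>\<^sub>V) \<cdot> \<sigma>\<^sub>X\<close> and \<open>\<sigma>'\<^sub>X \<cdot> (\<eta>\<^sub>V \<otimes> 1)\<close>, where \<open>\<sigma>'\<close> is the half-braiding of \<open>R (\<rho> V)\<close>, correspond
  to the composite of \<open>\<eta>\<^bsub>V \<otimes> X\<^esub>\<close> and \<open>R (\<rho> \<sigma>\<^sub>X)\<close>.
\<close>

lemma unit_central:
  assumes hb: "half_braiding C V \<sigma>"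
  shows "((V, \<sigma>), Z_obj (theta_obj C M (V, \<sigma>)), \<eta> V) \<in> Arr (center C)"
proof -
  let ?T = "theta_obj C M (V, \<sigma>)" and ?A = "act_functor C M"
  have T: "?T \<in> Obj D" by (rule theta_obj_dual[OF hb])
  note [simp] = C.half_braiding_arr[OF hb]
  have fst [simp]: "fst ?T = ?A V" by simp
  have "(Ide C X \<otimes>\<^sub>a\<^bsub>C\<^esub> \<eta> V) \<cdot>\<^bsub>C\<^esub> \<sigma> X = snd (Z_obj ?T) X \<cdot>\<^bsub>C\<^esub> (\<eta> V \<otimes>\<^sub>a\<^bsub>C\<^esub> Ide C X)"
    if [simp]: "X \<in> Obj C" for X
  proof -
    note [simp] = Z_ra_braiding_arr(1-4)[OF T that, unfolded fst] structure_arr[OF T that, unfolded fst]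
    note LS\<sigma> = Z_ra_braiding_arr(5)[OF T that, unfolded fst]
    let ?l = "(lact X (?A V), ?A (X \<otimes>\<^sub>o\<^bsub>C\<^esub> V), \<lambda>P\<in>Obj M. inv_arr M (Mas M X V P))"
    let ?r = "(lact V (?A X), ?A (V \<otimes>\<^sub>o\<^bsub>C\<^esub> X), \<lambda>P\<in>Obj M. inv_arr M (Mas M V X P))"
    let ?m = "(?A (V \<otimes>\<^sub>o\<^bsub>C\<^esub> X), ?A (X \<otimes>\<^sub>o\<^bsub>C\<^esub> V), \<lambda>P\<in>Obj M. \<sigma> X \<rhd>\<^sub>a Ide M P)"
    let ?s = "(ract (?A V) X, lact X (?A V), \<lambda>P\<in>Obj M. inv_arr M (snd ?T (X, P)))"
    have iso: "is_iso (Rex M LM) ?l" "is_iso (Rex M LM) ?r"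
      using rho_structure_inverse[THEN M.Rex.inverse_arrows_iso(2)] by simp_all
    have arr [simp]: "?l \<in> Arr (Rex M LM)" "?r \<in> Arr (Rex M LM)"
      using iso by (auto dest: M.Rex.is_iso_arr)
    have m [simp]: "?m \<in> Arr (Rex M LM)"
      using adj.F.FA_arr(1)[of "\<sigma> X"] by simp
    have isoR [simp]: "is_iso C (FA R ?l)"
      by (rule adj.G.FA_iso(1)[OF iso(1)])
    have s: "FA R ?l \<cdot>\<^bsub>C\<^esub> FA R ?s = FA R ?m \<cdot>\<^bsub>C\<^esub> FA R ?r"
    proof (rule R_comp_eq)
      show "Cmp (Rex M LM) ?l ?s = Cmp (Rex M LM) ?m ?r"
        by (auto intro!: restrict_ext)
    qed simp_all
    have l: "FA R ?l \<cdot>\<^bsub>C\<^esub> LS R (X, ?A V) \<cdot>\<^bsub>C\<^esub> (Ide C X \<otimes>\<^sub>a\<^bsub>C\<^esub> \<eta> V) = \<eta> (X \<otimes>\<^sub>o\<^bsub>C\<^esub> V)"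
      using bimodule_transD(1)[OF adj.unit_bimodule, of X V] by (simp add: bifcomp_def bifid_def)
    have r: "FA R ?r \<cdot>\<^bsub>C\<^esub> RS R (?A V, X) \<cdot>\<^bsub>C\<^esub> (\<eta> V \<otimes>\<^sub>a\<^bsub>C\<^esub> Ide C X) = \<eta> (V \<otimes>\<^sub>o\<^bsub>C\<^esub> X)"
      using bimodule_transD(2)[OF adj.unit_bimodule, of X V] by (simp add: bifcomp_def bifid_def)
    have nat: "\<eta> (X \<otimes>\<^sub>o\<^bsub>C\<^esub> V) \<cdot>\<^bsub>C\<^esub> \<sigma> X = FA R ?m \<cdot>\<^bsub>C\<^esub> \<eta> (V \<otimes>\<^sub>o\<^bsub>C\<^esub> X)"
      using adj.unit.natural'[of "\<sigma> X"] by simp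
    show ?thesis
    proof (rule C.iso_cancel_left[of "FA R ?l \<cdot>\<^bsub>C\<^esub> LS R (X, ?A V)"])
      have "(FA R ?l \<cdot>\<^bsub>C\<^esub> LS R (X, ?A V)) \<cdot>\<^bsub>C\<^esub> (Ide C X \<otimes>\<^sub>a\<^bsub>C\<^esub> \<eta> V) \<cdot>\<^bsub>C\<^esub> \<sigma> X
        = FA R ?m \<cdot>\<^bsub>C\<^esub> \<eta> (V \<otimes>\<^sub>o\<^bsub>C\<^esub> X)"
        by (simp add: C.reassoc3[OF l] nat)
      also have "\<dots> = FA R ?l \<cdot>\<^bsub>C\<^esub> FA R ?s \<cdot>\<^bsub>C\<^esub> RS R (?A V, X) \<cdot>\<^bsub>C\<^esub> (\<eta> V \<otimes>\<^sub>a\<^bsub>C\<^esub> Ide C X)"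
        unfolding r[symmetric] by (simp add: C.reassoc[OF s])
      also have "\<dots> = (FA R ?l \<cdot>\<^bsub>C\<^esub> LS R (X, ?A V)) \<cdot>\<^bsub>C\<^esub> snd (Z_obj ?T) X \<cdot>\<^bsub>C\<^esub> (\<eta> V \<otimes>\<^sub>a\<^bsub>C\<^esub> Ide C X)"
        by (simp add: C.reassoc[OF LS\<sigma>])
      finally show "(FA R ?l \<cdot>\<^bsub>C\<^esub> LS R (X, ?A V)) \<cdot>\<^bsub>C\<^esub> (Ide C X \<otimes>\<^sub>a\<^bsub>C\<^esub> \<eta> V) \<cdot>\<^bsub>C\<^esub> \<sigma> X
        = (FA R ?l \<cdot>\<^bsub>C\<^esub> LS R (X, ?A V)) \<cdot>\<^bsub>C\<^esub> snd (Z_obj ?T) X \<cdot>\<^bsub>C\<^esub> (\<eta> V \<otimes>\<^sub>a\<^bsub>C\<^esub> Ide C X)" .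
    qed simp_all
  qed
  then show ?thesis
    using hb half_braiding_Z_ra[OF T]
    by (cases "Z_obj ?T") (use Z_ra_obj_simps(1)[of ?T] in \<open>simp add: center_arr_iff Hom_def\<close>)
qed

text \<open>
  An arrow of \<open>Rex(M)\<close> is a triple whose last entry is the family of components.
\<close>

definition counit_component where "counit_component F = snd (snd (\<epsilon> F))"

lemma counit_arr:
  assumes "F \<in> Obj (Rex M LM)"
  shows "\<epsilon> F = (act_functor C M (FO R F), F, counit_component F)"
    and "(act_functor C M (FO R F), F, counit_component F) \<in> Arr (Rex M LM)"
proof -
  have "\<epsilon> F \<in> Hom (Rex M LM) (act_functor C M (FO R F)) F"
    using adj.counit.component[OF assms] assms by simp
  then show "\<epsilon> F = (act_functor C M (FO R F), F, counit_component F)"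
    "(act_functor C M (FO R F), F, counit_component F) \<in> Arr (Rex M LM)"
    by (cases "\<epsilon> F"; simp add: Hom_def counit_component_def)+
qed

text \<open>
  As \<open>\<epsilon>\<close> is a transformation of left and right modules, its component at \<open>F\<close>, acted on by \<open>X\<close> from the
  left or from the right, is expressed by its components at \<open>X \<rhd> F\<close> and \<open>F \<lhd> X\<close> (equations \<open>l\<close> and
  \<open>r\<close> in the proof). Naturality of \<open>\<epsilon>\<close> at the module structure of \<open>F\<close>, which is an arrow from \<open>X \<rhd> F\<close>
  to \<open>F \<lhd> X\<close>, relates the two, and the defining equation of the half-braiding of \<open>R F\<close> accounts for
  the structure on \<open>\<rho> (R F)\<close>.
\<close>

lemma counit_module_trans:
  assumes A: "A \<in> Obj D"
  shows "(theta_obj C M (Z_obj A), A, counit_component (fst A)) \<in> Arr D"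
proof -
  let ?F = "fst A" and ?V = "FO R (fst A)" and ?\<sigma> = "snd (Z_obj A)"
  have Z: "Z_obj A = (?V, ?\<sigma>)" using Z_ra_obj_simps(1)[of A] by (cases "Z_obj A") simp
  have hb: "half_braiding C ?V ?\<sigma>" using half_braiding_Z_ra[OF A] by (simp add: Z_ra_obj_simps(1))
  interpret A: module_functor C M M ?F "snd A" by (rule dual_objD[OF A])
  have F [simp]: "?F \<in> Obj (Rex M LM)" by (rule dual_objD[OF A])
  note [simp] = C.half_braiding_arr[OF hb] structure_arr[OF A] Z_ra_braiding_arr(1-4)[OF A]
  note e = M.Rex_arrD(3-5)[OF counit_arr(2)]
  have "snd A (X, P) \<cdot> (Ide C X \<rhd>\<^sub>a counit_component ?F P) = counit_component ?F (X \<rhd>\<^sub>o P) \<cdot> snd (theta_obj C M (Z_obj A)) (X, P)"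
    if [simp]: "X \<in> Obj C" and P [simp]: "P \<in> Obj M" for X P
  proof -
    let ?str = "(lact X ?F, ract ?F X, \<lambda>P\<in>Obj M. snd A (X, P))"
    have [simp]: "lact X ?F \<in> Obj (Rex M LM)" "ract ?F X \<in> Obj (Rex M LM)" by simp_all
    note [simp] = e[OF F] e[OF \<open>lact X ?F \<in> Obj (Rex M LM)\<close>] e[OF \<open>ract ?F X \<in> Obj (Rex M LM)\<close>]
      counit_arr(1)[OF F] counit_arr(1)[OF \<open>lact X ?F \<in> Obj (Rex M LM)\<close>]
      counit_arr(1)[OF \<open>ract ?F X \<in> Obj (Rex M LM)\<close>]
    have nat: "counit_component (ract ?F X) P \<cdot> (FA R ?str \<rhd>\<^sub>a Ide M P) = snd A (X, P) \<cdot> counit_component (lact X ?F) P"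
      using adj.counit.natural'[of ?str "lact X ?F" "ract ?F X"] structure_arr(1)[OF A, of X]
      by (auto dest!: fun_cong[of _ _ P])
    have l: "Ide C X \<rhd>\<^sub>a counit_component ?F P = counit_component (lact X ?F) P \<cdot> (LS R (X, ?F) \<rhd>\<^sub>a Ide M P) \<cdot> inv_arr M (Mas M X ?V P)"
      using bimodule_transD(1)[OF adj.counit_bimodule, of X ?F]
      by (auto simp: bifcomp_def bifid_def dest!: fun_cong[of _ _ P])
    have r: "counit_component ?F (X \<rhd>\<^sub>o P) = counit_component (ract ?F X) P \<cdot> (RS R (?F, X) \<rhd>\<^sub>a Ide M P) \<cdot> inv_arr M (Mas M ?V X P)"
      using bimodule_transD(2)[OF adj.counit_bimodule, of X ?F]
      by (auto simp: bifcomp_def bifid_def dest!: fun_cong[of _ _ P])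
    have c: "FA R ?str \<cdot>\<^bsub>C\<^esub> FA R (inv_structure A X) \<cdot>\<^bsub>C\<^esub> RS R (?F, X) = RS R (?F, X)"
      unfolding R_inv_structure_iso(2)[OF A that(1), symmetric]
      by (rule C.inv_arr_cancel(1)) (simp_all add: R_inv_structure_iso(1)[OF A that(1)])
    have "FA R ?str \<cdot>\<^bsub>C\<^esub> LS R (X, ?F) = RS R (?F, X) \<cdot>\<^bsub>C\<^esub> inv_arr C (?\<sigma> X)"
    proof (rule C.iso_cancel_right[of _ "?\<sigma> X"])
      show "(FA R ?str \<cdot>\<^bsub>C\<^esub> LS R (X, ?F)) \<cdot>\<^bsub>C\<^esub> ?\<sigma> X = (RS R (?F, X) \<cdot>\<^bsub>C\<^esub> inv_arr C (?\<sigma> X)) \<cdot>\<^bsub>C\<^esub> ?\<sigma> X"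
        by (simp add: Z_ra_braiding_arr(5)[OF A] c)
    qed simp_all
    then have s: "(FA R ?str \<rhd>\<^sub>a Ide M P) \<cdot> (LS R (X, ?F) \<rhd>\<^sub>a Ide M P)
      = (RS R (?F, X) \<rhd>\<^sub>a Ide M P) \<cdot> (inv_arr C (?\<sigma> X) \<rhd>\<^sub>a Ide M P)"
      by (simp add: AA_merge)
    show ?thesis
      unfolding l r by (simp add: Z_ra_obj_simps(1) M.reassoc[OF nat[symmetric]] M.reassoc[OF s])
  qed
  moreover have "theta_obj C M (Z_obj A) \<in> Obj D"
    by (subst Z) (rule theta_obj_dual[OF hb])
  ultimately show ?thesis
    using A counit_arr(2)[OF F] by (simp add: dual_arr_iff module_trans_def Z_ra_obj_simps(1))
qed

end

section \<open>The adjunction between the center and the dual category\<close>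

context action_right_adjoint
begin

abbreviation "U_theta \<equiv> fcomp (center C) forget (theta C M LM)"

lemma U_theta_simps:
  "FO forget (FO (theta C M LM) A) = theta_obj C M A"
  "FA forget (FA (theta C M LM) (A, B, f)) = (theta_obj C M A, theta_obj C M B, \<lambda>P\<in>Obj M. f \<rhd>\<^sub>a Ide M P)"
  by (simp_all add: theta_def forget_def)

lemma Z_ra_simps:
  "FO (Z_ra C M LM R) A = Z_obj A"
  "FA (Z_ra C M LM R) (A, B, \<alpha>) = (Z_obj A, Z_obj B, FA R (fst A, fst B, \<alpha>))"
  by (simp_all add: Z_ra_def)

text \<open>
  On underlying objects and arrows the two functors are \<open>\<rho>\<close> and \<open>R\<close>, and the two transformations
  \<open>\<eta>\<close> and \<open>\<epsilon>\<close>. Naturality and the triangle identities are equations between underlying arrows, hence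
  those of the adjunction between \<open>\<rho>\<close> and \<open>R\<close>.
\<close>

lemma adjunction_theta_Z_ra:
  "adjunction (center C) D U_theta (Z_ra C M LM R)
    (\<lambda>A. (A, Z_obj (theta_obj C M A), \<eta> (fst A)))
    (\<lambda>A. (theta_obj C M (Z_obj A), A, counit_component (fst A)))"
proof -
  let ?Z = "Z_ra C M LM R"
  let ?u = "\<lambda>A. (A, Z_obj (theta_obj C M A), \<eta> (fst A))"
  let ?c = "\<lambda>A. (theta_obj C M (Z_obj A), A, counit_component (fst A))"
  interpret Z: category "center C" by (rule C.category_center)
  interpret U_theta: cat_functor "center C" D U_theta
    by (rule cat_functor_fcomp[OF cat_functor_theta D.cat_functor_forget])
  interpret Zra: cat_functor D "center C" ?Z by (rule cat_functor_Z_ra)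
  interpret idZ: cat_functor "center C" "center C" "fid (center C)"
    by (rule cat_functor_fid) unfold_locales
  interpret idD: cat_functor D D "fid D" by (rule cat_functor_fid) unfold_locales
  interpret Z_ra_theta: cat_functor "center C" "center C" "fcomp (center C) ?Z U_theta"
    by (rule cat_functor_fcomp) unfold_locales
  interpret theta_Z_ra: cat_functor D D "fcomp D U_theta ?Z"
    by (rule cat_functor_fcomp) unfold_locales
  have unit: "nat_trans (center C) (center C) (fid (center C)) (fcomp (center C) ?Z U_theta) ?u"
  proof
    fix A assume A: "A \<in> Obj (center C)"
    then show "?u A \<in> Hom (center C) (FO (fid (center C)) A) (FO (fcomp (center C) ?Z U_theta) A)"
      using unit_central by (cases A) (auto simp: Hom_def U_theta_simps Z_ra_simps)
  next
    fix t A B assume t: "t \<in> Hom (center C) A B"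
    then obtain f where f: "t = (A, B, f)" "(A, B, f) \<in> Arr (center C)"
      by (cases t rule: prod_cases3) (simp add: Hom_def)
    have f': "f \<in> Arr C" "Dom C f = fst A" "Cod C f = fst B"
      using f(2) by (cases A; cases B; simp add: center_arr_iff Hom_def)+
    have "\<eta> (fst B) \<cdot>\<^bsub>C\<^esub> f = FA R (FA (rho C M LM) f) \<cdot>\<^bsub>C\<^esub> \<eta> (fst A)"
      using adj.unit.natural'[OF f'] f'(1) by simp
    then show "Cmp (center C) (?u B) (FA (fid (center C)) t)
      = Cmp (center C) (FA (fcomp (center C) ?Z U_theta) t) (?u A)"
      using f(2) by (simp add: f(1) U_theta_simps Z_ra_simps f')
  qed
  have counit: "nat_trans D D (fcomp D U_theta ?Z) (fid D) ?c"
  proof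
    fix A assume A: "A \<in> Obj D"
    then show "?c A \<in> Hom D (FO (fcomp D U_theta ?Z) A) (FO (fid D) A)"
      using counit_module_trans[OF A] Z_obj_center[OF A] by (simp add: Hom_def U_theta_simps Z_ra_simps)
  next
    fix t A B assume t: "t \<in> Hom D A B"
    then obtain \<alpha> where \<alpha>: "t = (A, B, \<alpha>)" "(A, B, \<alpha>) \<in> Arr D"
      by (cases t rule: prod_cases3) (simp add: Hom_def)
    have \<alpha>R: "(fst A, fst B, \<alpha>) \<in> Arr (Rex M LM)" using \<alpha>(2) by (simp add: dual_arr_iff)
    have AB: "fst A \<in> Obj (Rex M LM)" "fst B \<in> Obj (Rex M LM)"
      using M.Rex_arrD(1,2)[OF \<alpha>R] by auto
    have R: "FA R (fst A, fst B, \<alpha>) \<in> Arr C" "Dom C (FA R (fst A, fst B, \<alpha>)) = FO R (fst A)"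
      "Cod C (FA R (fst A, fst B, \<alpha>)) = FO R (fst B)"
      using \<alpha>R by simp_all
    have "Cmp (Rex M LM) (\<epsilon> (fst B)) (FA (rho C M LM) (FA R (fst A, fst B, \<alpha>)))
      = Cmp (Rex M LM) (fst A, fst B, \<alpha>) (\<epsilon> (fst A))"
      using adj.counit.natural'[OF \<alpha>R, of "fst A" "fst B"] \<alpha>R by simp
    then show "Cmp D (?c B) (FA (fcomp D U_theta ?Z) t) = Cmp D (FA (fid D) t) (?c A)"
      using \<alpha>(2) Z_ra_arr[OF \<alpha>(2)]
      by (simp add: \<alpha>(1) U_theta_simps Z_ra_simps counit_arr(1)[OF AB(1)] counit_arr(1)[OF AB(2)] R
          cong: restrict_cong)
  qed
  show ?thesis
  proof (intro adjunction.intro adjunction_axioms.intro unit counit)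
    show "cat_functor (center C) D U_theta" "cat_functor D (center C) ?Z" by unfold_locales
  next
    fix A assume A: "A \<in> Obj (center C)"
    then obtain V \<sigma> where V: "A = (V, \<sigma>)" "half_braiding C V \<sigma>" by (cases A) auto
    note [simp] = C.half_braiding_arr(1)[OF V(2)]
    have "Cmp (Rex M LM) (\<epsilon> (act_functor C M V)) (FA (rho C M LM) (\<eta> V)) = Ide (Rex M LM) (act_functor C M V)"
      using adj.triangle_left[of V] by simp
    then show "Cmp D (?c (FO U_theta A)) (FA U_theta (?u A)) = Ide D (FO U_theta A)"
      using A unit_central[OF V(2)] by (simp add: U_theta_simps V(1) counit_arr(1) cong: restrict_cong)
  next
    fix A assume A: "A \<in> Obj D"
    note [simp] = dual_objD(2)[OF A]
    show "Cmp (center C) (FA ?Z (?c A)) (?u (FO ?Z A)) = Ide (center C) (FO ?Z A)"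
      using adj.triangle_right[of "fst A"] by (simp add: Z_ra_simps Z_ra_obj_simps(1) counit_arr(1))
  qed
qed

end

theorem theorem3p14:
  fixes C :: "('c, 'f) moncat" and LC :: "('k::alg_closed_field, 'c, 'f) lin"
    and M :: "('c, 'f, 'o, 'a) modcat" and LM :: "('k, 'o, 'a) lin"
    and R :: "('c, ('o, 'a) endo, ('o, 'a) endo_arr, 'c, 'f) bifunc"
    and \<eta> :: "'c \<Rightarrow> 'f" and \<epsilon> :: "('o, 'a) endo \<Rightarrow> ('o, 'a) endo_arr"
  assumes "finite_tensor_category C LC"
    and "finite_module_category C LC M LM"
    and "rho_right_adjoint C M LM R \<eta> \<epsilon>"
  shows "cat_functor (center C) (center (dual_cat C M LM)) (theta C M LM) \<and>
    adjoint_pair (center C) (dual_cat C M LM)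
      (fcomp (center C) forget (theta C M LM)) (Z_ra C M LM R)"
proof -
  interpret N: finite_module_category C LC M LM by fact
  have "right_exact_action C M LM"
    by (intro right_exact_action.intro right_exact_action_axioms.intro N.act_right_exact_right)
      unfold_locales
  then have "action_right_adjoint C M LM R \<eta> \<epsilon>"
    using assms(3) by (rule action_right_adjoint.intro)
  then show ?thesis
    unfolding adjoint_pair_def
    by (blast intro: action_right_adjoint.adjunction_theta_Z_ra right_exact_action.cat_functor_theta
        \<open>right_exact_action C M LM\<close>)
qed

end
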